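(* Let $\alpha\in(-\infty,-3/2)\cup\big([1/2,\infty)\setminus\mathbb{N}\big)$ and suppose $f$ is given by $$f(x)=\int_{-\pi}^{\pi}e^{-ixt}\,d\mu(t),\quad x\in\mathbb{R},$$ for some $\mu\in M(\mathbb{T})$ which is absolutely continuous with respect to the Lebesgue measure. Then $$\lim_{c\to\infty}\mathscr{I}_{\alpha,c}f(x)=f(x),\quad x\in\mathbb{R},$$ with convergence being uniform on $\mathbb{R}$.
   Context: $M(\mathbb{T})$ is the space of $2\pi$-periodic complex Borel measures on $\mathbb{R}$ with norm $|\mu|([-\pi,\pi))$; integrals $\int_{-\pi}^{\pi}\cdot\,d\mu$ are over $[-\pi,\pi)$. For $c>0$ and $\alpha\in\mathbb{R}\setminus\{0,1,2,\dots\}$, the one-dimensional general multiquadric $\phi_{\alpha,c}(x)=(x^2+c^2)^\alpha$ has generalized Fourier transform $$\widehat{\phi}_{\alpha,c}(\xi)=\frac{2^{1+\alpha}}{\Gamma(-\alpha)}\Big(\frac{c}{|\xi|}\Big)^{\alpha+\frac12}K_{\alpha+\frac12}(c|\xi|),\quad \xi\neq 0,$$ where $K_\nu=K_{-\nu}$ is the modified Bessel function of the second kind. Set $$\widehat{L}_{\alpha,c}(\xi)=\frac{\widehat{\phi}_{\alpha,c}(\xi)}{\sum_{j\in\mathbb{Z}}\widehat{\phi}_{\alpha,c}(\xi+2\pi j)},\quad\xi\in\mathbb{R}$$ (extended by continuity to $\xi\in2\pi\mathbb{Z}$). This is in $L_1(\mathbb{R})$, and the fundamental function is $L_{\alpha,c}(x)=\frac1{2\pi}\int_{\mathbb{R}}\widehat{L}_{\alpha,c}(\xi)e^{ix\xi}d\xi$.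 The cardinal interpolant of $f$ is $\mathscr{I}_{\alpha,c}f(x)=\sum_{j\in\mathbb{Z}}f(j)L_{\alpha,c}(x-j)$, a convergent series for bounded $f$ and these $\alpha$. *)

theory Defs
  imports "HOL-Analysis.Analysis"
begin

text \<open>
  A nonzero \<open>2\<pi>\<close>-periodic complex measure on the line has infinite total variation, so it
  is a set function on the bounded Borel sets only, countably additive there; its values on
  other sets are irrelevant. Applying countable additivity to the constant family of empty sets
  gives \<open>\<mu> {} = 0\<close>. Finiteness of the norm \<open>|\<mu>|([-\<pi>,\<pi>))\<close> is automatic, as for every
  complex measure.
\<close>

definition periodic_complex_measure :: "(real set \<Rightarrow> complex) \<Rightarrow> bool" where
  "periodic_complex_measure \<mu> \<longleftrightarrow>
     (\<forall>A :: nat \<Rightarrow> real set. range A \<subseteq> sets borel \<longrightarrow> disjoint_family A \<longrightarrow> bounded (\<Union>n. A n) \<longrightarrow>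
        (\<lambda>n. \<mu> (A n)) sums \<mu> (\<Union>n. A n)) \<and>
     (\<forall>A \<in> sets borel. bounded A \<longrightarrow> \<mu> ((\<lambda>t. t + 2 * pi) ` A) = \<mu> A)"

definition abs_continuous :: "(real set \<Rightarrow> complex) \<Rightarrow> bool" where
  "abs_continuous \<mu> \<longleftrightarrow> (\<forall>E \<in> null_sets lborel. bounded E \<longrightarrow> \<mu> E = 0)"

text \<open>
  The positive part \<open>\<nu>\<^sup>+\<close> of the Jordan decomposition of a real signed measure \<open>\<nu>\<close>, restricted
  to \<open>[-\<pi>,\<pi>)\<close>: \<open>\<nu>\<^sup>+(E)\<close> is the supremum of \<open>\<nu>(A)\<close> over Borel sets \<open>A \<subseteq> E\<close>. (\<open>ennreal\<close> sends
  negative reals to 0, which is harmless since \<open>A = {}\<close> is admitted.) The negative part is the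
  positive part of \<open>-\<nu>\<close>.
\<close>

definition positive_part :: "(real set \<Rightarrow> real) \<Rightarrow> real measure" where
  "positive_part \<nu> =
     measure_of {-pi..<pi} {E \<in> sets borel. E \<subseteq> {-pi..<pi}}
       (\<lambda>E. SUP A \<in> {A \<in> sets borel. A \<subseteq> E}. ennreal (\<nu> A))"

text \<open>The integral over \<open>[-\<pi>,\<pi>)\<close> against a complex measure.\<close>

definition integral_cm :: "(real set \<Rightarrow> complex) \<Rightarrow> (real \<Rightarrow> complex) \<Rightarrow> complex" where
  "integral_cm \<mu> g =
     (LINT t | positive_part (\<lambda>E. Re (\<mu> E)). g t) - (LINT t | positive_part (\<lambda>E. - Re (\<mu> E)). g t)
     + \<i> * ((LINT t | positive_part (\<lambda>E. Im (\<mu> E)). g t)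
            - (LINT t | positive_part (\<lambda>E. - Im (\<mu> E)). g t))"

text \<open>
  The set function used in \<open>measure_of\<close> above really is a measure, so \<open>measure_of\<close> does not
  fall back to its default.
\<close>

lemma sets_positive_part: "sets (positive_part \<nu>) = {E \<in> sets borel. E \<subseteq> {-pi..<pi}}"
  and space_positive_part: "space (positive_part \<nu>) = {-pi..<pi}"
  and sigma_algebra_positive_part:
    "sigma_algebra {-pi..<pi} {E \<in> sets borel. E \<subseteq> {-pi..<pi :: real}}"
proof -
  have eq: "{E \<in> sets borel. E \<subseteq> {-pi..<pi}} = sets (restrict_space borel {-pi..<pi})"
    by (simp add: sets_restrict_space_iff conj_commute set_eq_iff)
  show sa: "sigma_algebra {-pi..<pi} {E \<in> sets borel. E \<subseteq> {-pi..<pi :: real}}"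
    unfolding eq using sets.sigma_algebra_axioms[of "restrict_space borel {-pi..<pi :: real}"]
    by (simp add: space_restrict_space)
  show "sets (positive_part \<nu>) = {E \<in> sets borel. E \<subseteq> {-pi..<pi}}"
    unfolding positive_part_def using sa
    by (simp add: sigma_algebra.sets_measure_of_eq)
  show "space (positive_part \<nu>) = {-pi..<pi}"
    unfolding positive_part_def by (rule space_measure_of) blast
qed

lemma emeasure_positive_part:
  assumes add: "\<And>A :: nat \<Rightarrow> real set. range A \<subseteq> sets borel \<Longrightarrow> disjoint_family A \<Longrightarrow>
      (\<Union>n. A n) \<subseteq> {-pi..<pi} \<Longrightarrow> (\<lambda>n. \<nu> (A n)) sums \<nu> (\<Union>n. A n)"
    and E: "E \<in> sets borel" "E \<subseteq> {-pi..<pi}"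
  shows "emeasure (positive_part \<nu>) E = (SUP A \<in> {A \<in> sets borel. A \<subseteq> E}. ennreal (\<nu> A))"
proof -
  let ?S = "{E \<in> sets borel. E \<subseteq> {-pi..<pi :: real}}"
  let ?p = "\<lambda>E. SUP A \<in> {A \<in> sets borel. A \<subseteq> E}. ennreal (\<nu> A)"
  have empty: "\<nu> {} = 0"
  proof -
    have "(\<lambda>n::nat. \<nu> {}) sums \<nu> {}"
      using add[of "\<lambda>_. {}"] by (simp add: disjoint_family_on_def)
    then show ?thesis
      using sums_summable summable_const_iff by blast
  qed
  have Un: "\<nu> (A \<union> B) = \<nu> A + \<nu> B"
    if "A \<in> sets borel" "B \<in> sets borel" "A \<inter> B = {}" "A \<union> B \<subseteq> {-pi..<pi}" for A B
  proof -
    have "(\<lambda>n. \<nu> (binaryset A B n)) sums \<nu> (\<Union>n. binaryset A B n)"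
    proof (rule add)
      show "range (binaryset A B) \<subseteq> sets borel" "disjoint_family (binaryset A B)"
        "(\<Union>n. binaryset A B n) \<subseteq> {-pi..<pi}"
        using that unfolding disjoint_family_on_def
        by (auto simp: range_binaryset_eq UN_binaryset_eq binaryset_def)
    qed
    moreover have "(\<lambda>n. \<nu> (binaryset A B n)) sums (\<nu> A + \<nu> B)"
      by (rule binaryset_sums) (rule empty)
    ultimately show ?thesis
      by (simp add: UN_binaryset_eq sums_unique2)
  qed
  have superadd: "(\<Sum>n<N. ?p (F n)) \<le> ?p (\<Union>n. F n)"
    if F: "range F \<subseteq> ?S" "disjoint_family F" for F :: "nat \<Rightarrow> real set" and N
  proof -
    have step: "?p A + ?p B \<le> ?p (A \<union> B)"
      if AB: "A \<in> ?S" "B \<in> ?S" "A \<inter> B = {}" for A B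
    proof -
      have "ennreal (\<nu> C) + ennreal (\<nu> D) \<le> ?p (A \<union> B)"
        if "C \<in> sets borel" "C \<subseteq> A" "D \<in> sets borel" "D \<subseteq> B" for C D
      proof -
        consider "\<nu> C < 0" | "\<nu> D < 0" | "\<nu> C \<ge> 0" "\<nu> D \<ge> 0" by linarith
        then show ?thesis
        proof cases
          case 1
          then show ?thesis using that
            by (auto simp: ennreal_neg intro!: SUP_upper)
        next
          case 2
          then show ?thesis using that
            by (auto simp: ennreal_neg intro!: SUP_upper)
        next
          case 3
          have "C \<inter> D = {}" "C \<union> D \<subseteq> {-pi..<pi}"
            using that AB by blast+
          then have "ennreal (\<nu> C) + ennreal (\<nu> D) = ennreal (\<nu> (C \<union> D))"
            using 3 Un[of C D] that by (simp add: ennreal_plus)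
          also have "\<dots> \<le> ?p (A \<union> B)"
            using that by (intro SUP_upper) auto
          finally show ?thesis .
        qed
      qed
      then have *: "(SUP C \<in> {C \<in> sets borel. C \<subseteq> A}. ennreal (\<nu> C) + ennreal (\<nu> D)) \<le> ?p (A \<union> B)"
        if "D \<in> sets borel" "D \<subseteq> B" for D
        using that by (intro SUP_least) auto
      have "?p A + ennreal (\<nu> D) \<le> ?p (A \<union> B)" if "D \<in> sets borel" "D \<subseteq> B" for D
        using *[OF that] by (subst ennreal_SUP_add_left[symmetric]) auto
      then have "(SUP D \<in> {D \<in> sets borel. D \<subseteq> B}. ?p A + ennreal (\<nu> D)) \<le> ?p (A \<union> B)"
        by (intro SUP_least) auto
      then show ?thesis
        by (subst ennreal_SUP_add_right) auto
    qed
    have "(\<Sum>n<N. ?p (F n)) \<le> ?p (\<Union>n<N. F n)"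
    proof (induction N)
      case 0
      show ?case by simp
    next
      case (Suc N)
      have "(\<Sum>n<Suc N. ?p (F n)) \<le> ?p (\<Union>n<N. F n) + ?p (F N)"
        using Suc by (simp add: add_right_mono)
      also have "\<dots> \<le> ?p ((\<Union>n<N. F n) \<union> F N)"
      proof (rule step)
        show "(\<Union>n<N. F n) \<in> ?S" "F N \<in> ?S"
          using F(1) by (auto intro!: sets.finite_UN)
        show "(\<Union>n<N. F n) \<inter> F N = {}"
          using F(2) by (auto simp: disjoint_family_on_def) (metis IntI empty_iff less_irrefl)
      qed
      also have "(\<Union>n<N. F n) \<union> F N = (\<Union>n<Suc N. F n)"
        by (auto simp: less_Suc_eq)
      finally show ?case .
    qed
    also have "\<dots> \<le> ?p (\<Union>n. F n)"
      by (rule SUP_subset_mono) auto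
    finally show ?thesis .
  qed
  have ca: "countably_additive ?S ?p"
  proof (rule countably_additiveI)
    fix F :: "nat \<Rightarrow> real set"
    assume F: "range F \<subseteq> ?S" "disjoint_family F" "(\<Union>n. F n) \<in> ?S"
    have "(\<Sum>n. ?p (F n)) \<le> ?p (\<Union>n. F n)"
      by (rule suminf_le_const) (use superadd[OF F(1,2)] in auto)
    moreover have "?p (\<Union>n. F n) \<le> (\<Sum>n. ?p (F n))"
    proof (rule SUP_least, clarify)
      fix A :: "real set"
      assume A: "A \<in> sets borel" "A \<subseteq> (\<Union>n. F n)"
      have "(\<lambda>n. \<nu> (A \<inter> F n)) sums \<nu> (\<Union>n. A \<inter> F n)"
      proof (rule add)
        show "range (\<lambda>n. A \<inter> F n) \<subseteq> sets borel"
          using A F(1) by auto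
        show "disjoint_family (\<lambda>n. A \<inter> F n)"
          using F(2) by (auto simp: disjoint_family_on_def)
        show "(\<Union>n. A \<inter> F n) \<subseteq> {-pi..<pi}"
          using F(3) by auto
      qed
      also have "(\<Union>n. A \<inter> F n) = A" using A by auto
      finally have s: "(\<lambda>n. \<nu> (A \<inter> F n)) sums \<nu> A" .
      have "ennreal (\<Sum>n<N. \<nu> (A \<inter> F n)) \<le> (\<Sum>n. ?p (F n))" for N
      proof -
        have "ennreal (\<Sum>n<N. \<nu> (A \<inter> F n)) \<le> ennreal (\<Sum>n<N. max 0 (\<nu> (A \<inter> F n)))"
          by (intro ennreal_leI sum_mono) auto
        also have "\<dots> = (\<Sum>n<N. ennreal (max 0 (\<nu> (A \<inter> F n))))"
          by (rule sum_ennreal[symmetric]) simp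
        also have "\<dots> = (\<Sum>n<N. ennreal (\<nu> (A \<inter> F n)))"
          by (rule sum.cong) (simp_all add: max_def ennreal_neg)
        also have "\<dots> \<le> (\<Sum>n<N. ?p (F n))"
          using A F(1) by (intro sum_mono SUP_upper) (auto intro!: sets.Int)
        also have "\<dots> \<le> (\<Sum>n. ?p (F n))"
          by (rule sum_le_suminf) auto
        finally show ?thesis .
      qed
      moreover have "(\<lambda>N. ennreal (\<Sum>n<N. \<nu> (A \<inter> F n))) \<longlonglongrightarrow> ennreal (\<nu> A)"
        using s unfolding sums_def by (rule tendsto_ennrealI)
      ultimately show "ennreal (\<nu> A) \<le> (\<Sum>n. ?p (F n))"
        by (intro LIMSEQ_le_const2) auto
    qed
    ultimately show "(\<Sum>n. ?p (F n)) = ?p (\<Union>n. F n)"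
      by (rule antisym)
  qed
  have "?p {} = 0"
    by (simp add: bot_ennreal empty cong: conj_cong)
  then have pos: "positive ?S ?p"
    by (simp add: positive_def)
  show ?thesis
    unfolding positive_part_def
    by (rule emeasure_measure_of_sigma[OF sigma_algebra_positive_part pos ca]) (use E in auto)
qed

text \<open>Modified Bessel function of the second kind, for argument \<open>z > 0\<close>.\<close>

definition bessel_K :: "real \<Rightarrow> real \<Rightarrow> real" where
  "bessel_K \<nu> z = (LBINT t:{0..}. exp (- z * cosh t) * cosh (\<nu> * t))"

definition phi_hat :: "real \<Rightarrow> real \<Rightarrow> real \<Rightarrow> real" where
  "phi_hat \<alpha> c \<xi> =
     2 powr (1 + \<alpha>) / Gamma (- \<alpha>) * (c / \<bar>\<xi>\<bar>) powr (\<alpha> + 1/2) * bessel_K (\<alpha> + 1/2) (c * \<bar>\<xi>\<bar>)"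

text \<open>
  The quotient makes literal sense off \<open>2\<pi>\<int>\<close>, where no argument of \<open>phi_hat\<close> vanishes;
  on \<open>2\<pi>\<int>\<close> the value is the limit.
\<close>

definition L_hat_quotient :: "real \<Rightarrow> real \<Rightarrow> real \<Rightarrow> real" where
  "L_hat_quotient \<alpha> c \<xi> = phi_hat \<alpha> c \<xi> / (\<Sum>\<^sub>\<infinity>j::int. phi_hat \<alpha> c (\<xi> + 2 * pi * of_int j))"

definition L_hat :: "real \<Rightarrow> real \<Rightarrow> real \<Rightarrow> real" where
  "L_hat \<alpha> c \<xi> =
     (if \<exists>k::int. \<xi> = 2 * pi * of_int k then Lim (at \<xi>) (L_hat_quotient \<alpha> c)
      else L_hat_quotient \<alpha> c \<xi>)"

definition fundamental_function :: "real \<Rightarrow> real \<Rightarrow> real \<Rightarrow> complex" where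
  "fundamental_function \<alpha> c x =
     1 / (2 * pi) * (LBINT \<xi>. of_real (L_hat \<alpha> c \<xi>) * exp (\<i> * of_real x * of_real \<xi>))"

definition cardinal_interpolant ::
  "real \<Rightarrow> real \<Rightarrow> (real \<Rightarrow> complex) \<Rightarrow> real \<Rightarrow> complex" where
  "cardinal_interpolant \<alpha> c f x =
     (\<Sum>\<^sub>\<infinity>j::int. f (of_int j) * fundamental_function \<alpha> c (x - of_int j))"

end

(*
  Write \<nu> = \<alpha> + 1/2. The substitution t = ln z + s in the integral for K_\<nu> exhibits
  2 z^(-\<nu>) K_\<nu>(z) as a mixture of the Gaussians exp(-z^2 u), with elementary monotonicity,
  decay and Lipschitz estimates, even at z = 0 for negative order. The symbol
  s = L_hat is nonnegative and its 2 pi-translates sum to 1. Poisson summation gives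
    sum_j exp(ijt) L(x - j) = sum_k s(t + 2 pi k) exp(ix(t + 2 pi k)),
  which differs from exp(ixt) by at most 2 (1 - s(t)). Hence the interpolation error is bounded,
  uniformly in x, by 2 times the integral of 1 - s(-t) against |\<mu>|, and s(t) -> 1 for
  0 < |t| < pi as c -> \<infinity>. Absolute continuity enters by ruling out atoms of |\<mu>|
  at 0 and -pi, so the four Jordan parts suffice and no density is required.
  Poisson summation, including the absolute summability of L(x - j), rests on the right-hand side
  being Lipschitz in t away from 2 pi Z; this is where |\<nu>| > 1/2 enters.
*)
theory Submission
  imports Defs
begin

subsection \<open>Bessel functions as Gaussian mixtures\<close>

text \<open>The normalisation z^(-\<nu>) is dictated by \<open>phi_hat\<close>: (c/|\<xi>|)^\<nu>
  K_\<nu>(c|\<xi>|) is c^(2\<nu>) times z^(-\<nu>) K_\<nu>(z) at z = c|\<xi>|, so the Gamma factor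
  and the powers of c cancel in the quotient. Gaussians replace Bessel asymptotics because each
  estimate becomes pointwise in the mixing variable. The obstacle is the frequency 0. For -1 < \<nu>
  < 0 the mixture has a singular term of size z^(2|\<nu>|) there; for \<nu> > 0 it blows up like
  z^(-2\<nu>), and its reciprocal vanishes like z^(2\<nu>). Lipschitz control up to 0 is thus a
  condition on 2|\<nu>|, and a first-order estimate of the Gaussian costs half an order, which
  2|\<nu>| > 1 can pay. The two exceptional points have different origins. At 0 the Lipschitz
  estimates stop, and for \<nu> > 0 the mixture itself diverges. At -pi the frequencies pi and -pi
  are equally far from 0, so s(-pi) = s(pi) is at most 1/2 for every c and cannot tend to 1.\<close>

lemma integrable_exp_minus_abs:
  fixes \<kappa> :: real
  assumes "\<kappa> > 0"
  shows "integrable lborel (\<lambda>s. exp (- \<kappa> * \<bar>s\<bar>))"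
proof -
  have "(\<lambda>s. exp (- \<kappa> * s)) absolutely_integrable_on {0..}"
    using assms by (intro nonnegative_absolutely_integrable_1 integrable_on_exp_minus_to_infinity) auto
  then have I: "integrable lborel (\<lambda>s. indicator {0..} s * exp (- \<kappa> * s))"
    unfolding set_integrable_def by (subst (asm) integrable_completion) auto
  have J: "integrable lborel (\<lambda>s. indicator {0..} (-s) * exp (- \<kappa> * (-s)))"
    using lborel_integrable_real_affine[OF I, of "-1" 0] by simp
  show ?thesis
    by (rule Bochner_Integration.integrable_bound[OF Bochner_Integration.integrable_add[OF I J]])
      (auto simp: indicator_def)
qed

text \<open>The exponent comes from z cosh(ln z + s) = (z^2 exp s + exp(-s)) / 2. With u = exp s / 2
  the dependence on z is the single Gaussian factor exp(-z^2 u); the remaining factor exp(\<nu> s -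
  exp(-s)/2) is the mixing weight.\<close>

definition mix_kernel :: "real \<Rightarrow> real \<Rightarrow> real \<Rightarrow> real" where
  "mix_kernel \<nu> z s = exp (\<nu> * s - (z\<^sup>2 * exp s + exp (- s)) / 2)"

text \<open>
  For \<open>z > 0\<close> this is \<open>2 z\<^sup>-\<^sup>\<nu> K\<^sub>\<nu>(z)\<close>. At \<open>z = 0\<close> the integral converges only for \<open>\<nu> < 0\<close>;
  otherwise the value is 0 by convention.
\<close>

definition bessel_mix :: "real \<Rightarrow> real \<Rightarrow> real" where
  "bessel_mix \<nu> z = (LBINT s. mix_kernel \<nu> z s)"

lemma mix_kernel_measurable [measurable]:
  "case_prod (mix_kernel \<nu>) \<in> borel_measurable (borel \<Otimes>\<^sub>M borel)"
  unfolding mix_kernel_def by measurable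

lemma mix_kernel_measurable1 [measurable]: "mix_kernel \<nu> z \<in> borel_measurable borel"
  unfolding mix_kernel_def by measurable

lemma bessel_mix_measurable [measurable]: "bessel_mix \<nu> \<in> borel_measurable borel"
  unfolding bessel_mix_def by (intro lborel.borel_measurable_lebesgue_integral) simp

text \<open>The right-hand side is the maximum over s, attained at s = ln(m/A); the proof is the
  tangent line inequality for exp at that point.\<close>

lemma linear_minus_exp_bounded:
  fixes A m :: real
  assumes "A > 0" "m > 0"
  shows "m * s - A * exp s \<le> m * ln (m / A) - m"
proof -
  have "exp (s - ln (m / A)) \<ge> 1 + (s - ln (m / A))" by (rule exp_ge_add_one_self)
  then have "m * (1 + (s - ln (m / A))) \<le> m * exp (s - ln (m / A))"
    using assms by simp
  also have "\<dots> = A * exp s"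
    using assms by (simp add: exp_diff)
  finally show ?thesis by (simp add: algebra_simps)
qed

text \<open>The majorant is a multiple of exp(-\<kappa>|s|). Toward minus infinity exp(-s)/2 always
  wins. Toward plus infinity the decay comes from z^2 exp s if z is nonzero and from exp(\<nu> s) if
  \<nu> < 0, which is why the hypothesis is a disjunction.\<close>

lemma integrable_mix_kernel:
  assumes "z \<noteq> 0 \<or> \<nu> < 0"
  shows "integrable lborel (mix_kernel \<nu> z)"
proof -
  have "\<exists>\<kappa> C1. \<kappa> > 0 \<and> \<kappa> \<le> 1 \<and> (\<forall>s\<ge>0. \<nu> * s - z\<^sup>2 * exp s / 2 \<le> C1 - \<kappa> * s)"
  proof (cases "\<nu> < 0")
    case True
    have "\<nu> * s - z\<^sup>2 * exp s / 2 \<le> 0 - min 1 (-\<nu>) * s" if "s \<ge> 0" for s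
    proof -
      have "\<nu> * s \<le> - min 1 (-\<nu>) * s" using that by (intro mult_right_mono) auto
      moreover have "z\<^sup>2 * exp s / 2 \<ge> 0" by simp
      ultimately show ?thesis by linarith
    qed
    then show ?thesis using True by (intro exI[of _ "min 1 (-\<nu>)"] exI[of _ 0]) auto
  next
    case False
    then have "z \<noteq> 0" "\<nu> \<ge> 0" using assms by auto
    then have "(\<nu> + 1) * s - z\<^sup>2 / 2 * exp s \<le> (\<nu> + 1) * ln ((\<nu> + 1) / (z\<^sup>2 / 2)) - (\<nu> + 1)" for s
      by (intro linear_minus_exp_bounded) auto
    then show ?thesis
      by (intro exI[of _ 1] exI[of _ "(\<nu> + 1) * ln ((\<nu> + 1) / (z\<^sup>2 / 2)) - (\<nu> + 1)"])
        (simp add: algebra_simps)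
  qed
  then obtain \<kappa> C1 where \<kappa>: "\<kappa> > 0" "\<kappa> \<le> 1"
    and C1: "\<And>s. s \<ge> 0 \<Longrightarrow> \<nu> * s - z\<^sup>2 * exp s / 2 \<le> C1 - \<kappa> * s" by blast
  \<comment> \<open>The slope |\<nu>| + 1 dominates |\<nu> - \<kappa>|; this uses \<kappa> \<le> 1,
    arranged above for this purpose.\<close>
  define C2 where "C2 = (\<bar>\<nu>\<bar> + 1) * ln ((\<bar>\<nu>\<bar> + 1) / (1/2)) - (\<bar>\<nu>\<bar> + 1)"
  have C2: "\<nu> * s - exp (- s) / 2 \<le> C2 + \<kappa> * s" if "s \<le> 0" for s
  proof -
    have "(\<bar>\<nu>\<bar> + 1) * (-s) - 1/2 * exp (-s) \<le> C2"
      unfolding C2_def by (rule linear_minus_exp_bounded) auto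
    moreover have "(\<nu> - \<kappa>) * s \<le> (\<bar>\<nu>\<bar> + 1) * (-s)"
    proof -
      have "(\<kappa> - \<nu>) * (-s) \<le> (\<bar>\<nu>\<bar> + 1) * (-s)" using \<kappa> that by (intro mult_right_mono) auto
      then show ?thesis by (simp add: algebra_simps)
    qed
    ultimately show ?thesis by (simp add: algebra_simps)
  qed
  have bound: "mix_kernel \<nu> z s \<le> exp (max C1 C2) * exp (- \<kappa> * \<bar>s\<bar>)" for s
  proof -
    have "\<nu> * s - (z\<^sup>2 * exp s + exp (- s)) / 2 \<le> max C1 C2 - \<kappa> * \<bar>s\<bar>"
    proof (cases "s \<ge> 0")
      case True
      have "exp (-s) / 2 \<ge> 0" by simp
      then show ?thesis using C1[OF True] True unfolding add_divide_distrib by linarith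
    next
      case False
      then have "s \<le> 0" by simp
      moreover have "z\<^sup>2 * exp s / 2 \<ge> 0" by simp
      ultimately show ?thesis using C2[of s] unfolding add_divide_distrib abs_of_nonpos[OF \<open>s \<le> 0\<close>] by (smt (verit) mult_minus_right)
    qed
    then show ?thesis
      unfolding mix_kernel_def by (simp flip: exp_add)
  qed
  show ?thesis
    by (rule Bochner_Integration.integrable_bound[OF
          integrable_mult_right[OF integrable_exp_minus_abs[OF \<kappa>(1)], of "exp (max C1 C2)"]])
      (use bound in \<open>auto simp: mix_kernel_def\<close>)
qed

lemma bessel_mix_pos:
  assumes "z \<noteq> 0 \<or> \<nu> < 0"
  shows "bessel_mix \<nu> z > 0"
proof -
  have "bessel_mix \<nu> z \<ge> 0"
    unfolding bessel_mix_def by (intro integral_nonneg_AE) (auto simp: mix_kernel_def)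
  moreover have "bessel_mix \<nu> z \<noteq> 0"
  proof
    assume "bessel_mix \<nu> z = 0"
    then have "AE s in lborel. mix_kernel \<nu> z s = 0"
      unfolding bessel_mix_def
      by (subst (asm) integral_nonneg_eq_0_iff_AE) (auto simp: mix_kernel_def integrable_mix_kernel[OF assms, unfolded mix_kernel_def[abs_def]] mix_kernel_def[abs_def])
    then have "AE s in (lborel :: real measure). False" by eventually_elim (simp add: mix_kernel_def)
    then obtain N where "{s \<in> space (lborel :: real measure). \<not> False} \<subseteq> N" "emeasure lborel N = 0"
      by (rule AE_E)
    then show False by (simp add: top_unique)
  qed
  ultimately show ?thesis by simp
qed

lemma bessel_mix_nonneg: "bessel_mix \<nu> z \<ge> 0"
  unfolding bessel_mix_def by (intro integral_nonneg_AE) (auto simp: mix_kernel_def)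

lemma integrable_bessel_integrand:
  assumes "z > 0"
  shows "integrable lborel (\<lambda>t. exp (- z * cosh t + \<nu> * t))"
    and "(LBINT t. exp (- z * cosh t + \<nu> * t)) = z powr \<nu> * bessel_mix \<nu> z"
proof -
  have eq: "exp (- z * cosh (ln z + 1 * s) + \<nu> * (ln z + 1 * s)) = z powr \<nu> * mix_kernel \<nu> z s" for s
  proof -
    have "z * cosh (ln z + s) = (z\<^sup>2 * exp s + exp (- s)) / 2"
      using assms by (simp add: cosh_field_def exp_add exp_diff exp_minus power2_eq_square field_simps)
    then have "- z * cosh (ln z + 1 * s) + \<nu> * (ln z + 1 * s)
        = \<nu> * ln z + (\<nu> * s - (z\<^sup>2 * exp s + exp (- s)) / 2)"
      by (simp add: algebra_simps)
    then show ?thesis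
      unfolding mix_kernel_def using assms by (simp only: exp_add powr_def) simp
  qed
  have I: "integrable lborel (mix_kernel \<nu> z)" using assms by (intro integrable_mix_kernel) simp
  show "integrable lborel (\<lambda>t. exp (- z * cosh t + \<nu> * t))"
    by (subst lborel_integrable_real_affine_iff[of 1 _ "ln z", symmetric])
      (use I in \<open>auto simp only: eq intro: integrable_mult_right\<close>)
  show "(LBINT t. exp (- z * cosh t + \<nu> * t)) = z powr \<nu> * bessel_mix \<nu> z"
    unfolding bessel_mix_def using I
    by (subst lborel_integral_real_affine[of 1 _ "ln z"]) (simp_all only: eq, simp_all)
qed

text \<open>Since cosh(\<nu> t) is the mean of exp(\<nu> t) and exp(-\<nu> t), and cosh t is even,
  reflecting the second half unfolds the half-line integral into half of the integral over the whole
  line.\<close>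

lemma bessel_K_eq_mix:
  assumes "z > 0"
  shows "bessel_K \<nu> z = z powr \<nu> * bessel_mix \<nu> z / 2"
proof -
  define E where "E t = exp (- z * cosh t + \<nu> * t)" for t
  have I: "integrable lborel E" unfolding E_def by (rule integrable_bessel_integrand) fact
  have Ei: "integrable lborel (\<lambda>t. indicator {0..} t * E t)"
    using integrable_mult_indicator[OF _ I, of "{0..}"] by simp
  have Em: "integrable lborel (\<lambda>t. indicator {..0} t * E t)"
    using integrable_mult_indicator[OF _ I, of "{..0}"] by simp
  have refl: "integrable lborel (\<lambda>t. indicator {0..} t * E (- t))"
    "(LBINT t. indicator {0..} t * E (- t)) = (LBINT t. indicator {..0} t * E t)"
  proof -
    have *: "indicator {..0} (0 + - 1 * t) * E (0 + - 1 * t) = indicator {0..} t * E (- t)" for t :: real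
      by (auto simp: indicator_def)
    show "integrable lborel (\<lambda>t. indicator {0..} t * E (- t))"
      using lborel_integrable_real_affine[OF Em, of "-1" 0] unfolding * by simp
    show "(LBINT t. indicator {0..} t * E (- t)) = (LBINT t. indicator {..0} t * E t)"
      by (subst lborel_integral_real_affine[of "-1" _ 0]) (simp_all only: *, simp_all)
  qed
  have "bessel_K \<nu> z = (LBINT t. (indicator {0..} t * E t + indicator {0..} t * E (- t)) / 2)"
    unfolding bessel_K_def set_lebesgue_integral_def
    by (intro Bochner_Integration.integral_cong)
      (auto simp: E_def exp_add exp_diff exp_minus cosh_field_def[of "_ * \<nu>"]  cosh_field_def[of "\<nu> * _"] field_simps indicator_def)
  also have "\<dots> = ((LBINT t. indicator {0..} t * E t) + (LBINT t. indicator {..0} t * E t)) / 2"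
    using Ei refl by simp
  also have "(LBINT t. indicator {0..} t * E t) + (LBINT t. indicator {..0} t * E t)
      = (LBINT t. indicator {0..} t * E t + indicator {..0} t * E t)"
    using Ei Em by simp
  also have "\<dots> = (LBINT t. E t)"
  proof (rule integral_cong_AE)
    show "AE t in lborel. indicator {0..} t * E t + indicator {..0} t * E t = E t"
      using AE_lborel_singleton[of 0] by eventually_elim (auto simp: indicator_def)
  qed (use borel_measurable_integrable[OF I] in simp_all)
  also have "\<dots> = z powr \<nu> * bessel_mix \<nu> z"
    unfolding E_def by (rule integrable_bessel_integrand) fact
  finally show ?thesis .
qed

lemma bessel_K_minus: "bessel_K (- \<nu>) z = bessel_K \<nu> z"
  unfolding bessel_K_def by simp

text \<open>K_\<nu> is even in its order. This carries results from negative order, where the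
  mixture is finite at 0, to positive order, where it is not.\<close>

lemma bessel_mix_minus:
  assumes "z > 0"
  shows "bessel_mix \<nu> z = z powr (- 2 * \<nu>) * bessel_mix (- \<nu>) z"
proof -
  have "z powr \<nu> * bessel_mix \<nu> z = z powr (- \<nu>) * bessel_mix (- \<nu>) z"
    using bessel_K_minus[of \<nu> z] unfolding bessel_K_eq_mix[OF assms] by simp
  then have "z powr (-\<nu>) * (z powr \<nu> * bessel_mix \<nu> z)
      = (z powr (- \<nu>) * z powr (- \<nu>)) * bessel_mix (- \<nu>) z" by simp
  also have "z powr (-\<nu>) * (z powr \<nu> * bessel_mix \<nu> z) = bessel_mix \<nu> z"
    using assms by (simp add: powr_minus)
  also have "z powr (- \<nu>) * z powr (- \<nu>) = z powr (- 2 * \<nu>)"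
    by (simp flip: powr_add)
  finally show ?thesis .
qed

text \<open>Because cosh t is at least 1, raising the argument from a to b multiplies the Bessel
  integrand by at most exp(-(b - a)). The power of b/a only undoes the normalisation.\<close>

lemma bessel_mix_exp_decay:
  assumes "0 < a" "a \<le> b"
  shows "bessel_mix \<nu> b \<le> (b / a) powr (- \<nu>) * exp (- (b - a)) * bessel_mix \<nu> a"
proof -
  have "b > 0" using assms by simp
  have "b powr \<nu> * bessel_mix \<nu> b = (LBINT t. exp (- b * cosh t + \<nu> * t))"
    by (rule integrable_bessel_integrand(2)[symmetric]) fact
  also have "\<dots> \<le> (LBINT t. exp (- (b - a)) * exp (- a * cosh t + \<nu> * t))"
  proof (intro integral_mono integrable_mult_right integrable_bessel_integrand assms \<open>b > 0\<close>)
    fix t :: real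
    have "(b - a) * 1 \<le> (b - a) * cosh t" using assms cosh_real_ge_1 by (intro mult_left_mono) auto
    then show "exp (- b * cosh t + \<nu> * t) \<le> exp (- (b - a)) * exp (- a * cosh t + \<nu> * t)"
      by (simp add: algebra_simps flip: exp_add)
  qed
  also have "\<dots> = exp (- (b - a)) * (a powr \<nu> * bessel_mix \<nu> a)"
    by (simp only: integral_mult_right_zero integrable_bessel_integrand(2)[OF assms(1)])
  finally have "bessel_mix \<nu> b \<le> exp (- (b - a)) * (a powr \<nu> * bessel_mix \<nu> a) / b powr \<nu>"
    using \<open>b > 0\<close> by (simp add: field_simps)
  also have "\<dots> = (b / a) powr (- \<nu>) * exp (- (b - a)) * bessel_mix \<nu> a"
    using assms \<open>b > 0\<close> by (simp add: powr_divide powr_minus field_simps)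
  finally show ?thesis .
qed

lemma bessel_mix_antimono:
  assumes "0 \<le> a" "a \<le> b" "a \<noteq> 0 \<or> \<nu> < 0"
  shows "bessel_mix \<nu> b \<le> bessel_mix \<nu> a"
  unfolding bessel_mix_def
proof (intro integral_mono integrable_mix_kernel)
  show "a \<noteq> 0 \<or> \<nu> < 0" "b \<noteq> 0 \<or> \<nu> < 0" using assms by auto
  show "mix_kernel \<nu> b s \<le> mix_kernel \<nu> a s" for s
    using assms by (auto simp: mix_kernel_def intro!: mult_right_mono power_mono)
qed

text \<open>Passing from a to b multiplies the kernel by exp(-d) with d proportional to exp s, and 1
  - exp(-d) \<le> d. The extra factor exp s raises the order by one. This is the estimate used away
  from 0, where the higher order does no harm.\<close>

lemma bessel_mix_diff_le:
  assumes "0 < a" "a \<le> b"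
  shows "bessel_mix \<nu> a - bessel_mix \<nu> b \<le> (b\<^sup>2 - a\<^sup>2) / 2 * bessel_mix (\<nu> + 1) a"
proof -
  have I: "integrable lborel (mix_kernel \<nu> a)" "integrable lborel (mix_kernel \<nu> b)"
    "integrable lborel (mix_kernel (\<nu> + 1) a)"
    using assms by (auto intro!: integrable_mix_kernel)
  have "bessel_mix \<nu> a - bessel_mix \<nu> b = (LBINT s. mix_kernel \<nu> a s - mix_kernel \<nu> b s)"
    unfolding bessel_mix_def using I by simp
  also have "\<dots> \<le> (LBINT s. (b\<^sup>2 - a\<^sup>2) / 2 * mix_kernel (\<nu> + 1) a s)"
  proof (intro integral_mono)
    fix s :: real
    define d where "d = (b\<^sup>2 - a\<^sup>2) / 2 * exp s"
    have "mix_kernel \<nu> b s = mix_kernel \<nu> a s * exp (- d)"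
      by (simp add: mix_kernel_def d_def field_simps flip: exp_add)
    moreover have "1 - exp (- d) \<le> d" using exp_ge_add_one_self[of "-d"] by simp
    ultimately have "mix_kernel \<nu> a s - mix_kernel \<nu> b s \<le> mix_kernel \<nu> a s * d"
      using mult_left_mono[of "1 - exp (- d)" d "mix_kernel \<nu> a s"]
      by (simp add: right_diff_distrib) (simp add: mix_kernel_def)
    also have "\<dots> = (b\<^sup>2 - a\<^sup>2) / 2 * (mix_kernel \<nu> a s * exp s)"
      by (simp add: d_def)
    also have "mix_kernel \<nu> a s * exp s = mix_kernel (\<nu> + 1) a s"
      by (simp add: mix_kernel_def algebra_simps flip: exp_add)
    finally show "mix_kernel \<nu> a s - mix_kernel \<nu> b s \<le> (b\<^sup>2 - a\<^sup>2) / 2 * mix_kernel (\<nu> + 1) a s" .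
  qed (use I in auto)
  also have "\<dots> = (b\<^sup>2 - a\<^sup>2) / 2 * bessel_mix (\<nu> + 1) a"
    unfolding bessel_mix_def using I by simp
  finally show ?thesis .
qed

text \<open>The derivative has modulus at most 1 because z \<le> 1 + z^2/2 \<le> exp(z^2/2).\<close>

lemma gaussian_1_lipschitz:
  fixes v w :: real
  assumes "v \<le> w"
  shows "exp (- v\<^sup>2 / 2) - exp (- w\<^sup>2 / 2) \<le> w - v"
proof -
  have "\<exists>z. v \<le> z \<and> z \<le> w \<and> exp (- w\<^sup>2 / 2) - exp (- v\<^sup>2 / 2) = (w - v) * (- z * exp (- z\<^sup>2 / 2))" if "v < w"
  proof -
    have "\<exists>z. v < z \<and> z < w \<and> exp (- w\<^sup>2 / 2) - exp (- v\<^sup>2 / 2) = (w - v) * (- z * exp (- z\<^sup>2 / 2))"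
      using that by (intro MVT2) (auto intro!: derivative_eq_intros simp: power2_eq_square)
    then show ?thesis by (meson less_imp_le)
  qed
  moreover have "z * exp (- z\<^sup>2 / 2) \<le> 1" for z :: real
  proof -
    have "z \<le> 1 + z\<^sup>2 / 2" using zero_le_power2[of "z - 1"] by (simp add: power2_eq_square algebra_simps)
    also have "\<dots> \<le> exp (z\<^sup>2 / 2)" by (rule exp_ge_add_one_self)
    finally show ?thesis by (simp add: exp_minus field_simps)
  qed
  ultimately have "v < w \<Longrightarrow> ?thesis"
    by (smt (verit) mult_left_mono mult_cancel_left1 mult_minus_left mult_minus_right)
  then show ?thesis using assms by (cases "v = w") auto
qed

text \<open>A bound linear in b - a, instead of b^2 - a^2, costs only a factor exp(s/2), that is
  half an order. It therefore remains finite down to a = 0 as long as \<nu> + 1/2 is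
  negative.\<close>

lemma bessel_mix_lipschitz:
  assumes "0 \<le> a" "a \<le> b" "\<nu> < - 1 / 2"
  shows "bessel_mix \<nu> a - bessel_mix \<nu> b \<le> (b - a) * bessel_mix (\<nu> + 1/2) 0"
proof -
  have I: "integrable lborel (mix_kernel \<nu> a)" "integrable lborel (mix_kernel \<nu> b)"
    "integrable lborel (mix_kernel (\<nu> + 1/2) 0)"
    using assms by (auto intro!: integrable_mix_kernel)
  have "bessel_mix \<nu> a - bessel_mix \<nu> b = (LBINT s. mix_kernel \<nu> a s - mix_kernel \<nu> b s)"
    unfolding bessel_mix_def using I by simp
  also have "\<dots> \<le> (LBINT s. (b - a) * mix_kernel (\<nu> + 1/2) 0 s)"
  proof (intro integral_mono)
    fix s :: real
    define e where "e = exp (s / 2)"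
    have e2: "exp s = e\<^sup>2" by (simp add: e_def flip: exp_double)
    have eq: "mix_kernel \<nu> y s = mix_kernel \<nu> 0 s * exp (- (y * e)\<^sup>2 / 2)" for y
      by (simp add: mix_kernel_def e2[symmetric] power_mult_distrib field_simps flip: exp_add)
    have "exp (- (a * e)\<^sup>2 / 2) - exp (- (b * e)\<^sup>2 / 2) \<le> b * e - a * e"
      by (rule gaussian_1_lipschitz) (use assms in \<open>auto simp: e_def\<close>)
    then have "mix_kernel \<nu> a s - mix_kernel \<nu> b s \<le> mix_kernel \<nu> 0 s * (b * e - a * e)"
      unfolding eq[of a] eq[of b] right_diff_distrib[symmetric]
      by (intro mult_left_mono) (simp_all add: mix_kernel_def)
    also have "\<dots> = (b - a) * (mix_kernel \<nu> 0 s * e)"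
      by (simp add: algebra_simps)
    also have "mix_kernel \<nu> 0 s * e = mix_kernel (\<nu> + 1/2) 0 s"
      by (simp add: mix_kernel_def e_def algebra_simps flip: exp_add)
    finally show "mix_kernel \<nu> a s - mix_kernel \<nu> b s \<le> (b - a) * mix_kernel (\<nu> + 1/2) 0 s" .
  qed (use I in auto)
  also have "\<dots> = (b - a) * bessel_mix (\<nu> + 1/2) 0"
    unfolding bessel_mix_def using I by simp
  finally show ?thesis .
qed

lemma powr_le_const_exp:
  fixes m \<epsilon> z0 :: real
  assumes "\<epsilon> > 0" "z0 > 0"
  obtains C where "C > 0" "\<And>z. z \<ge> z0 \<Longrightarrow> z powr m \<le> C * exp (\<epsilon> * z)"
proof (cases "m > 0")
  case True
  have "z powr m \<le> exp (m * ln (m / \<epsilon>) - m) * exp (\<epsilon> * z)" if "z \<ge> z0" for z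
  proof -
    have "z > 0" using that assms by simp
    have "m * ln z - \<epsilon> * exp (ln z) \<le> m * ln (m / \<epsilon>) - m"
      using assms True by (intro linear_minus_exp_bounded)
    then have "m * ln z \<le> m * ln (m / \<epsilon>) - m + \<epsilon> * z" using \<open>z > 0\<close> by simp
    then show ?thesis using \<open>z > 0\<close> by (simp add: powr_def flip: exp_add)
  qed
  then show ?thesis using that[of "exp (m * ln (m / \<epsilon>) - m)"] by simp
next
  case False
  have "z powr m \<le> z0 powr m * exp (\<epsilon> * z)" if "z \<ge> z0" for z
  proof -
    have "z powr m \<le> z0 powr m * 1" using that False assms by (simp add: powr_mono2')
    also have "\<dots> \<le> z0 powr m * exp (\<epsilon> * z)"
      using that assms by (intro mult_left_mono) auto
    finally show ?thesis .
  qed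
  then show ?thesis using that[of "z0 powr m"] assms by simp
qed

text \<open>Half of the decay exp(-z) is spent on absorbing the power z^(-\<nu>).\<close>

lemma bessel_mix_le_exp:
  assumes "z0 > 0"
  obtains D where "D > 0" "\<And>z. z \<ge> z0 \<Longrightarrow> bessel_mix \<nu> z \<le> D * exp (- z / 2)"
proof -
  obtain C where C: "C > 0" "\<And>z. z \<ge> z0 \<Longrightarrow> z powr (- \<nu>) \<le> C * exp (1/2 * z)"
    using powr_le_const_exp[of "1/2" z0 "- \<nu>"] assms by auto
  define D where "D = C * z0 powr \<nu> * exp z0 * bessel_mix \<nu> z0"
  have "bessel_mix \<nu> z \<le> D * exp (- z / 2)" if "z \<ge> z0" for z
  proof -
    have "bessel_mix \<nu> z \<le> (z / z0) powr (- \<nu>) * exp (- (z - z0)) * bessel_mix \<nu> z0"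
      by (rule bessel_mix_exp_decay) fact+
    also have "\<dots> = z powr (- \<nu>) * (z0 powr \<nu> * exp (z0 - z) * bessel_mix \<nu> z0)"
      using that assms by (simp add: powr_divide powr_minus field_simps)
    also have "\<dots> \<le> C * exp (1/2 * z) * (z0 powr \<nu> * exp (z0 - z) * bessel_mix \<nu> z0)"
      using C(2)[OF that] by (intro mult_right_mono) (auto simp: bessel_mix_nonneg)
    also have "\<dots> = D * (exp (1/2 * z) * exp (- z))"
      by (simp add: D_def exp_diff exp_minus field_simps)
    also have "exp (1/2 * z) * exp (- z) = exp (- z / 2)"
      by (simp flip: exp_add)
    finally show ?thesis .
  qed
  moreover have "D > 0" using C assms bessel_mix_pos[of z0 \<nu>] by (simp add: D_def)
  ultimately show ?thesis using that by blast
qed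

text \<open>A further quarter of the exponent absorbs the factor z, which arises from b^2 - a^2 in
  the difference estimate.\<close>

lemma mult_bessel_mix_le_exp:
  assumes "z0 > 0"
  obtains D where "D > 0" "\<And>z. z \<ge> z0 \<Longrightarrow> z * bessel_mix \<nu> z \<le> D * exp (- z / 4)"
proof -
  obtain D where D: "D > 0" "\<And>z. z \<ge> z0 \<Longrightarrow> bessel_mix \<nu> z \<le> D * exp (- z / 2)"
    using bessel_mix_le_exp[OF assms] by blast
  have "z * bessel_mix \<nu> z \<le> 4 * D * exp (- z / 4)" if "z \<ge> z0" for z
  proof -
    have "z \<le> 4 * exp (z / 4)" using exp_ge_add_one_self[of "z / 4"] by linarith
    then have "z * bessel_mix \<nu> z \<le> (4 * exp (z / 4)) * (D * exp (- z / 2))"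
      using D that assms by (intro mult_mono) (auto simp: bessel_mix_nonneg)
    also have "\<dots> = 4 * D * exp (- z / 4)" by (simp flip: exp_add)
    finally show ?thesis .
  qed
  then show ?thesis using that[of "4 * D"] D(1) by simp
qed

subsection \<open>Sums over the integers\<close>

lemma summable_on_int_abs:
  fixes g :: "nat \<Rightarrow> real"
  assumes "summable g" "\<And>n. g n \<ge> 0"
  shows "(\<lambda>k::int. g (nat \<bar>k\<bar>)) summable_on UNIV"
proof -
  have g: "g summable_on UNIV"
    using assms by (subst summable_on_UNIV_nonneg_real_iff) auto
  have "(\<lambda>k::int. g (nat \<bar>k\<bar>)) summable_on range int"
    by (subst summable_on_reindex) (auto simp: o_def g)
  moreover have "(\<lambda>k::int. g (nat \<bar>k\<bar>)) summable_on range (\<lambda>n. - int n)"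
    by (subst summable_on_reindex) (auto simp: o_def g inj_def)
  moreover have "(UNIV :: int set) = range int \<union> range (\<lambda>n. - int n)"
    by (auto simp: image_iff) (metis int_cases2)
  ultimately show ?thesis
    by (metis summable_on_union)
qed

lemma summable_on_int_exp:
  fixes \<kappa> :: real
  assumes "\<kappa> > 0"
  shows "(\<lambda>k::int. exp (- \<kappa> * \<bar>of_int k\<bar>)) summable_on UNIV"
proof -
  have "(\<lambda>k::int. exp (- \<kappa>) ^ nat \<bar>k\<bar>) summable_on UNIV"
    by (rule summable_on_int_abs[of "\<lambda>n. exp (- \<kappa>) ^ n"]) (use assms in \<open>auto intro!: summable_geometric\<close>)
  also have "(\<lambda>k::int. exp (- \<kappa>) ^ nat \<bar>k\<bar>) = (\<lambda>k. exp (- \<kappa> * \<bar>of_int k\<bar>))"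
    by (simp flip: exp_of_nat_mult add: mult.commute)
  finally show ?thesis .
qed

text \<open>The term at k = 0 is 1 / 0 = 0.\<close>

lemma summable_on_int_inverse_square:
  "(\<lambda>k::int. 1 / (of_int k)\<^sup>2 :: real) summable_on UNIV"
proof -
  have "(\<lambda>k::int. 1 / (real (nat \<bar>k\<bar>))\<^sup>2 :: real) summable_on UNIV"
    by (rule summable_on_int_abs[of "\<lambda>n. 1 / (real n)\<^sup>2"])
      (use inverse_power_summable[of 2, where 'a = real] in \<open>auto simp: inverse_eq_divide\<close>)
  then show ?thesis by simp
qed

text \<open>Turns unordered sums into sequences, on which dominated convergence and telescoping
  operate.\<close>

lemma has_sum_int_symmetric:
  fixes f :: "int \<Rightarrow> 'a :: {comm_monoid_add, topological_space}"
  assumes "(f has_sum S) UNIV"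
  shows "(\<lambda>N. \<Sum>k\<in>{- int N..int N}. f k) \<longlonglongrightarrow> S"
proof -
  have "filterlim (\<lambda>N. {- int N..int N}) (finite_subsets_at_top UNIV) sequentially"
    unfolding filterlim_finite_subsets_at_top
  proof safe
    fix X :: "int set"
    assume "finite X"
    define B where "B = Max (insert 0 (abs ` X))"
    have B: "\<forall>x\<in>X. \<bar>x\<bar> \<le> B"
      unfolding B_def using \<open>finite X\<close> by (auto intro!: Max_ge)
    show "\<forall>\<^sub>F N in sequentially. finite {- int N..int N} \<and> X \<subseteq> {- int N..int N} \<and> {- int N..int N} \<subseteq> UNIV"
      using eventually_ge_at_top[of "nat B"]
    proof eventually_elim
      case (elim N)
      then have "B \<le> int N" by simp
      then show ?case using B by (fastforce simp: abs_le_iff)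
    qed
  qed
  then show ?thesis
    using assms unfolding has_sum_def by (rule filterlim_compose[rotated])
qed

lemma borel_measurable_infsum_int:
  fixes f :: "int \<Rightarrow> 'a \<Rightarrow> 'b :: {banach, second_countable_topology}"
  assumes "\<And>k. f k \<in> borel_measurable M"
    and "\<And>x. x \<in> space M \<Longrightarrow> (\<lambda>k. f k x) summable_on UNIV"
  shows "(\<lambda>x. \<Sum>\<^sub>\<infinity>k. f k x) \<in> borel_measurable M"
proof (rule borel_measurable_LIMSEQ_metric)
  show "(\<lambda>x. \<Sum>k\<in>{- int N..int N}. f k x) \<in> borel_measurable M" for N
    using assms by measurable
  show "(\<lambda>N. \<Sum>k\<in>{- int N..int N}. f k x) \<longlonglongrightarrow> (\<Sum>\<^sub>\<infinity>k. f k x)" if "x \<in> space M" for x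
    using assms(2)[OF that] by (intro has_sum_int_symmetric) simp
qed

lemma norm_sum_le_infsum:
  fixes f :: "'a \<Rightarrow> 'b :: real_normed_vector" and g :: "'a \<Rightarrow> real"
  assumes "finite F" "F \<subseteq> A" "\<And>k. k \<in> A \<Longrightarrow> norm (f k) \<le> g k" "g summable_on A"
  shows "norm (sum f F) \<le> infsum g A"
proof -
  have "norm (sum f F) \<le> sum g F"
    using assms by (intro sum_norm_le) auto
  also have "\<dots> \<le> infsum g A"
    using assms by (intro finite_sum_le_infsum) (auto intro: order_trans[OF norm_ge_zero])
  finally show ?thesis .
qed

lemma abs_summable_on_comparison:
  fixes f :: "'a \<Rightarrow> 'b :: banach" and g :: "'a \<Rightarrow> real"
  assumes "g summable_on A" "\<And>k. k \<in> A \<Longrightarrow> norm (f k) \<le> g k"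
  shows "(\<lambda>k. norm (f k)) summable_on A" "f summable_on A" "norm (infsum f A) \<le> infsum g A"
proof -
  show *: "(\<lambda>k. norm (f k)) summable_on A"
    using assms by (intro summable_on_comparison_test[OF assms(1)]) auto
  then show "f summable_on A" by (rule abs_summable_summable)
  show "norm (infsum f A) \<le> infsum g A"
    using norm_infsum_bound[OF *] infsum_mono[OF * assms(1)] assms(2) by fastforce
qed

subsection \<open>Periodization\<close>

lemma exp_decay_shift:
  fixes \<kappa> t :: real and k :: int
  assumes "\<kappa> \<ge> 0"
  shows "exp (- \<kappa> * \<bar>t + 2 * pi * of_int k\<bar>) \<le> exp (\<kappa> * \<bar>t\<bar>) * exp (- (2 * pi * \<kappa>) * \<bar>of_int k\<bar>)"
proof -
  have "\<bar>2 * pi * real_of_int k\<bar> \<le> \<bar>t + 2 * pi * of_int k\<bar> + \<bar>t\<bar>" by linarith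
  then have "2 * pi * \<bar>real_of_int k\<bar> - \<bar>t\<bar> \<le> \<bar>t + 2 * pi * of_int k\<bar>" by (simp add: abs_mult)
  then have "\<kappa> * (2 * pi * \<bar>real_of_int k\<bar> - \<bar>t\<bar>) \<le> \<kappa> * \<bar>t + 2 * pi * of_int k\<bar>"
    using assms by (rule mult_left_mono)
  then show ?thesis by (simp add: algebra_simps flip: exp_add)
qed

abbreviation circle :: "real measure" where
  "circle \<equiv> restrict_space lborel {-pi..<pi}"

lemma finite_measure_circle: "finite_measure circle"
  by (rule finite_measureI) (simp add: emeasure_restrict_space)

lemma measure_circle: "measure circle (space circle) = 2 * pi"
  by (simp add: measure_restrict_space space_restrict_space)

lemma measurable_circle: "f \<in> borel_measurable borel \<Longrightarrow> f \<in> borel_measurable circle"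
  by (rule measurable_restrict_space1) simp

lemma AE_circle_not_countable:
  assumes "countable Z"
  shows "AE t in circle. t \<notin> Z"
proof -
  have "AE t in lborel. t \<notin> Z"
    by (rule AE_not_in) (use assms in \<open>simp add: countable_imp_null_set_lborel\<close>)
  then show ?thesis
    by (subst AE_restrict_space_iff) auto
qed

text \<open>The majorant in the last three claims does not depend on t within one period, so it
  serves both as a bound for the sum and as a dominating constant for its partial sums.\<close>

lemma summable_on_periodization:
  fixes F :: "real \<Rightarrow> complex"
  assumes "\<kappa> > 0" "\<And>\<xi>. norm (F \<xi>) \<le> D * exp (- \<kappa> * \<bar>\<xi>\<bar>)"
  shows "(\<lambda>k::int. F (t + 2 * pi * of_int k)) summable_on UNIV"
    and "\<bar>t\<bar> \<le> pi \<Longrightarrow> norm (\<Sum>\<^sub>\<infinity>k::int. F (t + 2 * pi * of_int k))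
      \<le> (\<Sum>\<^sub>\<infinity>k::int. D * exp (\<kappa> * pi) * exp (- (2 * pi * \<kappa>) * \<bar>of_int k\<bar>))"
    and "\<bar>t\<bar> \<le> pi \<Longrightarrow> norm (F (t + 2 * pi * of_int k)) \<le> D * exp (\<kappa> * pi) * exp (- (2 * pi * \<kappa>) * \<bar>of_int k\<bar>)"
    and "(\<lambda>k::int. D * exp (\<kappa> * pi) * exp (- (2 * pi * \<kappa>) * \<bar>of_int k\<bar>)) summable_on UNIV"
proof -
  have D: "D \<ge> 0" using order_trans[OF norm_ge_zero assms(2)[of 0]] by simp
  have S: "(\<lambda>k::int. A * exp (- (2 * pi * \<kappa>) * \<bar>of_int k\<bar>)) summable_on UNIV" for A
    using assms(1) by (intro summable_on_cmult_right summable_on_int_exp) auto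
  have le: "norm (F (t + 2 * pi * of_int k)) \<le> D * exp (\<kappa> * r) * exp (- (2 * pi * \<kappa>) * \<bar>of_int k\<bar>)"
    if "\<bar>t\<bar> \<le> r" for r k
  proof -
    have "norm (F (t + 2 * pi * of_int k)) \<le> D * (exp (\<kappa> * \<bar>t\<bar>) * exp (- (2 * pi * \<kappa>) * \<bar>of_int k\<bar>))"
      using assms D exp_decay_shift[of \<kappa> t k]
      by (intro order_trans[OF assms(2)] mult_left_mono) auto
    also have "\<dots> \<le> D * (exp (\<kappa> * r) * exp (- (2 * pi * \<kappa>) * \<bar>of_int k\<bar>))"
      using D assms that by (intro mult_left_mono mult_right_mono) auto
    finally show ?thesis by (simp add: mult.assoc)
  qed
  show "(\<lambda>k::int. F (t + 2 * pi * of_int k)) summable_on UNIV"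
    by (rule abs_summable_on_comparison(2)[OF S le[OF order_refl]])
  show "\<bar>t\<bar> \<le> pi \<Longrightarrow> norm (F (t + 2 * pi * of_int k)) \<le> D * exp (\<kappa> * pi) * exp (- (2 * pi * \<kappa>) * \<bar>of_int k\<bar>)"
    by (rule le)
  show "\<bar>t\<bar> \<le> pi \<Longrightarrow> norm (\<Sum>\<^sub>\<infinity>k::int. F (t + 2 * pi * of_int k))
      \<le> (\<Sum>\<^sub>\<infinity>k::int. D * exp (\<kappa> * pi) * exp (- (2 * pi * \<kappa>) * \<bar>of_int k\<bar>))"
    by (rule abs_summable_on_comparison(3)[OF S le])
  show "(\<lambda>k::int. D * exp (\<kappa> * pi) * exp (- (2 * pi * \<kappa>) * \<bar>of_int k\<bar>)) summable_on UNIV"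
    by (rule S)
qed

text \<open>The translates of [-pi, pi) tile the line, each \<xi> lying only in the one of index
  \<open>k0 \<xi>\<close>. The integral over the tiles with index between -N and N is computed in
  two ways, and dominated convergence applies on the line as well as on the circle.\<close>

lemma integral_periodization:
  fixes F :: "real \<Rightarrow> complex"
  assumes "\<kappa> > 0" and le: "\<And>\<xi>. norm (F \<xi>) \<le> D * exp (- \<kappa> * \<bar>\<xi>\<bar>)"
    and [measurable]: "F \<in> borel_measurable borel"
  shows "(LBINT \<xi>. F \<xi>) = (LINT t|circle. (\<Sum>\<^sub>\<infinity>k::int. F (t + 2 * pi * of_int k)))"
proof -
  define k0 :: "real \<Rightarrow> int" where "k0 \<xi> = \<lfloor>(\<xi> + pi) / (2 * pi)\<rfloor>" for \<xi>
  have mem: "\<xi> - 2 * pi * of_int k \<in> {-pi..<pi} \<longleftrightarrow> k = k0 \<xi>" for \<xi> k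
  proof -
    have "k = k0 \<xi> \<longleftrightarrow> of_int k \<le> (\<xi> + pi) / (2 * pi) \<and> (\<xi> + pi) / (2 * pi) < of_int k + 1"
      unfolding k0_def by (auto simp: floor_eq_iff eq_commute[of k])
    also have "\<dots> \<longleftrightarrow> \<xi> - 2 * pi * of_int k \<in> {-pi..<pi}"
      by (auto simp: field_simps)
    finally show ?thesis by simp
  qed
  have IF: "integrable lborel F"
  proof (rule Bochner_Integration.integrable_bound)
    show "integrable lborel (\<lambda>\<xi>. D * exp (- \<kappa> * \<bar>\<xi>\<bar>))"
      by (intro integrable_mult_right integrable_exp_minus_abs assms)
  qed (use order_trans[OF le abs_ge_self] in auto)
  define P where "P N \<xi> = (\<Sum>k\<in>{- int N..int N}. indicator {-pi..<pi} (\<xi> - 2 * pi * of_int k) *\<^sub>R F \<xi>)" for N \<xi>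
  have P: "P N \<xi> = (if k0 \<xi> \<in> {- int N..int N} then F \<xi> else 0)" for N \<xi>
  proof -
    have "P N \<xi> = (\<Sum>k\<in>{- int N..int N}. if k = k0 \<xi> then F \<xi> else 0)"
      unfolding P_def by (intro sum.cong) (auto simp: mem indicator_def simp del: atLeastLessThan_iff)
    then show ?thesis by simp
  qed
  have IP: "(LBINT \<xi>. indicator {-pi..<pi} (\<xi> - 2 * pi * of_int k) *\<^sub>R F \<xi>)
      = (LINT t|circle. F (t + 2 * pi * of_int k))" for k :: int
  proof -
    have "(LBINT \<xi>. indicator {-pi..<pi} (\<xi> - 2 * pi * of_int k) *\<^sub>R F \<xi>)
        = (LBINT t. indicator {-pi..<pi} t *\<^sub>R F (t + 2 * pi * of_int k))"
      by (subst lborel_integral_real_affine[of 1 _ "2 * pi * of_int k"]) (simp_all add: add.commute)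
    then show ?thesis by (simp add: integral_restrict_space)
  qed
  have intF: "integrable lborel (\<lambda>\<xi>. indicator {-pi..<pi} (\<xi> - 2 * pi * of_int k) *\<^sub>R F \<xi>)" for k :: int
    by (rule Bochner_Integration.integrable_bound[OF IF]) (auto simp: indicator_def)
  have P_eq: "(LBINT \<xi>. P N \<xi>) = (LINT t|circle. (\<Sum>k\<in>{- int N..int N}. F (t + 2 * pi * of_int k)))" for N
  proof -
    have "integrable circle (\<lambda>t. F (t + 2 * pi * of_int k))" for k :: int
    proof (rule finite_measure.integrable_const_bound[OF finite_measure_circle])
      show "AE t in circle. norm (F (t + 2 * pi * of_int k)) \<le> D * exp (\<kappa> * pi) * exp (- (2 * pi * \<kappa>) * \<bar>of_int k\<bar>)"
        by (rule AE_I2) (intro summable_on_periodization(3) assms, auto simp: space_restrict_space)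
    qed (auto intro!: measurable_circle)
    moreover have "(LBINT \<xi>. P N \<xi>) = (\<Sum>k\<in>{- int N..int N}. (LBINT \<xi>. indicator {-pi..<pi} (\<xi> - 2 * pi * of_int k) *\<^sub>R F \<xi>))"
      unfolding P_def by (intro Bochner_Integration.integral_sum intF)
    ultimately show ?thesis by (simp only: IP Bochner_Integration.integral_sum)
  qed
  have "(\<lambda>N. LBINT \<xi>. P N \<xi>) \<longlonglongrightarrow> (LBINT \<xi>. F \<xi>)"
  proof (rule integral_dominated_convergence[where w = "\<lambda>\<xi>. norm (F \<xi>)"])
    show "AE \<xi> in lborel. (\<lambda>N. P N \<xi>) \<longlonglongrightarrow> F \<xi>"
    proof (rule AE_I2)
      fix \<xi> :: real
      have "\<forall>\<^sub>F N in sequentially. P N \<xi> = F \<xi>"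
        using eventually_ge_at_top[of "nat \<bar>k0 \<xi>\<bar>"]
        by eventually_elim (auto simp: P)
      then show "(\<lambda>N. P N \<xi>) \<longlonglongrightarrow> F \<xi>" by (rule tendsto_eventually)
    qed
    show "AE \<xi> in lborel. norm (P N \<xi>) \<le> norm (F \<xi>)" for N by (auto simp: P)
    show "P N \<in> borel_measurable lborel" for N unfolding P_def by measurable
  qed (use IF in auto)
  moreover have "(\<lambda>N. LBINT \<xi>. P N \<xi>) \<longlonglongrightarrow> (LINT t|circle. (\<Sum>\<^sub>\<infinity>k::int. F (t + 2 * pi * of_int k)))"
    unfolding P_eq
  proof (rule integral_dominated_convergence)
    show "integrable circle (\<lambda>_. \<Sum>\<^sub>\<infinity>k::int. D * exp (\<kappa> * pi) * exp (- (2 * pi * \<kappa>) * \<bar>of_int k\<bar>))"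
      using finite_measure_circle by (intro finite_measure.integrable_const)
    show "(\<lambda>t. \<Sum>\<^sub>\<infinity>k::int. F (t + 2 * pi * of_int k)) \<in> borel_measurable circle"
      by (intro measurable_circle borel_measurable_infsum_int summable_on_periodization(1)[OF assms(1,2)]) auto
    show "AE t in circle. (\<lambda>N. \<Sum>k\<in>{- int N..int N}. F (t + 2 * pi * of_int k))
        \<longlonglongrightarrow> (\<Sum>\<^sub>\<infinity>k::int. F (t + 2 * pi * of_int k))"
      by (intro AE_I2 has_sum_int_symmetric has_sum_infsum summable_on_periodization(1)[OF assms(1,2)])
    show "AE t in circle. norm (\<Sum>k\<in>{- int N..int N}. F (t + 2 * pi * of_int k))
        \<le> (\<Sum>\<^sub>\<infinity>k::int. D * exp (\<kappa> * pi) * exp (- (2 * pi * \<kappa>) * \<bar>of_int k\<bar>))" for N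
      by (intro AE_I2 norm_sum_le_infsum summable_on_periodization(3)[OF assms(1,2)]
            summable_on_periodization(4)[OF assms(1,2)]) (auto simp: space_restrict_space)
  qed (auto intro!: measurable_circle)
  ultimately show ?thesis by (rule LIMSEQ_unique)
qed

subsection \<open>Fourier coefficients\<close>

definition fourier_coeff :: "(real \<Rightarrow> complex) \<Rightarrow> int \<Rightarrow> complex" where
  "fourier_coeff g j = (LINT t|circle. g t * cis (- of_int j * t)) / (2 * pi)"

lemma cis_measurable [measurable]: "f \<in> borel_measurable M \<Longrightarrow> (\<lambda>x. cis (f x)) \<in> borel_measurable M"
  by (rule borel_measurable_continuous_on[where f = cis]) (auto intro!: continuous_intros)

lemma integrable_circle_bounded:
  fixes g :: "real \<Rightarrow> complex"
  assumes "g \<in> borel_measurable circle" "AE t in circle. norm (g t) \<le> B"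
  shows "integrable circle (\<lambda>t. g t * cis (a * t))"
  using assms by (intro finite_measure.integrable_const_bound[OF finite_measure_circle, of _ B] borel_measurable_times)
    (auto simp: norm_mult intro!: measurable_circle)

lemma integral_circle_cis:
  "(LINT t|circle. cis (of_int n * t)) = (if n = 0 then 2 * pi else 0)"
proof (cases "n = 0")
  case True
  then show ?thesis using measure_circle by (simp add: scaleR_conv_of_real)
next
  case False
  have "(LINT t|circle. cis (of_int n * t)) = (LBINT t. indicator {-pi..<pi} t *\<^sub>R cis (of_int n * t))"
    by (simp add: integral_restrict_space)
  also have "\<dots> = (LBINT t. indicator {-pi..pi} t *\<^sub>R cis (of_int n * t))"
  proof (rule integral_cong_AE)
    show "AE t in lborel. indicator {-pi..<pi} t *\<^sub>R cis (of_int n * t) = indicator {-pi..pi} t *\<^sub>R cis (of_int n * t)"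
      using AE_lborel_singleton[of pi] by eventually_elim (auto simp: indicator_def)
  qed auto
  also have "\<dots> = cis (of_int n * pi) / (\<i> * of_int n) - cis (of_int n * (- pi)) / (\<i> * of_int n)"
  proof (rule has_bochner_integral_integral_eq, rule has_bochner_integral_FTC_Icc)
    fix t :: real
    show "((\<lambda>t. cis (of_int n * t) / (\<i> * of_int n)) has_vector_derivative cis (of_int n * t)) (at t within {-pi..pi})"
    proof -
      have "((\<lambda>z. exp (\<i> * of_int n * z) / (\<i> * of_int n)) has_field_derivative exp (\<i> * of_int n * of_real t)) (at (of_real t))"
        using False by (auto intro!: derivative_eq_intros)
      then show ?thesis
        by (auto simp: cis_conv_exp mult.assoc dest!: has_vector_derivative_real_field)
    qed
  qed (auto intro!: continuous_intros)
  also have "cis (of_int n * (- pi)) = cis (of_int n * pi)"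
    by (simp add: complex_eq_iff) (auto simp: sin_zero_iff_int2)
  finally show ?thesis using False by simp
qed

text \<open>\<open>p\<close> is the orthogonal projection of \<open>g\<close> onto the chosen
  characters, so pairing it with \<open>g\<close> and with itself gives the same number 2 pi S.
  Expanding the integral of |g - p|^2 \<ge> 0 leaves 2 pi S below the integral of |g|^2, hence below
  2 pi B^2.\<close>

lemma bessel_inequality:
  assumes g: "g \<in> borel_measurable circle" "AE t in circle. norm (g t) \<le> B" and "finite F"
  shows "(\<Sum>j\<in>F. (norm (fourier_coeff g j))\<^sup>2) \<le> B\<^sup>2"
proof -
  interpret finite_measure circle by (rule finite_measure_circle)
  define c where "c = fourier_coeff g"
  define p where "p t = (\<Sum>j\<in>F. c j * cis (of_int j * t))" for t
  define C where "C = (\<Sum>j\<in>F. norm (c j))"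
  have pm: "p \<in> borel_measurable circle" unfolding p_def by (intro measurable_circle) measurable
  have pb: "norm (p t) \<le> C" for t
    unfolding p_def C_def by (intro sum_norm_le) (simp add: norm_mult)
  have Ig: "integrable circle (\<lambda>t. g t * cis (a * t))" for a by (rule integrable_circle_bounded[OF g])
  have Ip: "integrable circle (\<lambda>t. p t * cis (a * t))" for a
    by (rule integrable_circle_bounded[OF pm, of C]) (use pb in auto)
  have orth: "(LINT t|circle. p t * cis (- of_int j * t)) = 2 * pi * c j" if "j \<in> F" for j
  proof -
    have cis: "(LINT t|circle. cis ((real_of_int k - real_of_int j) * t)) = (if k = j then 2 * pi else 0)" for k
      using integral_circle_cis[of "k - j"] by simp
    have "(LINT t|circle. p t * cis (- of_int j * t))
        = (LINT t|circle. (\<Sum>k\<in>F. c k * cis (of_int (k - j) * t)))"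
      unfolding p_def sum_distrib_right
      by (intro Bochner_Integration.integral_cong sum.cong) (auto simp: mult.assoc cis_mult algebra_simps)
    also have "\<dots> = (\<Sum>k\<in>F. c k * (LINT t|circle. cis (of_int (k - j) * t)))"
      using integrable_circle_bounded[of "\<lambda>_. 1" 1]
      by (subst Bochner_Integration.integral_sum) (auto intro!: integrable_mult_right)
    also have "\<dots> = (\<Sum>k\<in>F. if k = j then 2 * pi * c k else 0)"
      by (intro sum.cong) (auto simp: cis simp del: Bochner_Integration.lebesgue_integral_const)
    finally show ?thesis using assms that by simp
  qed
  have cnj_p: "cnj (p t) = (\<Sum>j\<in>F. cnj (c j) * cis (- of_int j * t))" for t
    by (simp add: p_def cis_cnj)
  have inner: "(LINT t|circle. q t * cnj (p t)) = (\<Sum>j\<in>F. cnj (c j) * (LINT t|circle. q t * cis (- of_int j * t)))"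
    if "\<And>a. integrable circle (\<lambda>t. q t * cis (a * t))" for q
  proof -
    have "(LINT t|circle. q t * cnj (p t)) = (LINT t|circle. (\<Sum>j\<in>F. cnj (c j) * (q t * cis (- of_int j * t))))"
      unfolding cnj_p sum_distrib_left by (intro Bochner_Integration.integral_cong sum.cong) auto
    also have "\<dots> = (\<Sum>j\<in>F. (LINT t|circle. cnj (c j) * (q t * cis (- of_int j * t))))"
      by (intro Bochner_Integration.integral_sum integrable_mult_right that)
    finally show ?thesis by simp
  qed
  define S where "S = (\<Sum>j\<in>F. (norm (c j))\<^sup>2)"
  have gp: "(LINT t|circle. g t * cnj (p t)) = of_real (2 * pi * S)"
    and pp: "(LINT t|circle. p t * cnj (p t)) = of_real (2 * pi * S)"
  proof -
    have cj: "(LINT t|circle. g t * cis (- of_int j * t)) = 2 * pi * c j" for j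
      by (simp add: c_def fourier_coeff_def)
    have "(\<Sum>j\<in>F. cnj (c j) * (2 * pi * c j)) = of_real (2 * pi * S)"
      unfolding S_def of_real_mult of_real_sum sum_distrib_left complex_norm_square
      by (intro sum.cong) (auto simp: mult_ac)
    then show "(LINT t|circle. g t * cnj (p t)) = of_real (2 * pi * S)"
      "(LINT t|circle. p t * cnj (p t)) = of_real (2 * pi * S)"
      unfolding inner[OF Ig] inner[OF Ip] using orth cj by (simp_all cong: sum.cong)
  qed
  have bounded_int: "integrable circle f" if "f \<in> borel_measurable circle" "AE t in circle. norm (f t) \<le> K"
    for f :: "real \<Rightarrow> complex" and K
    using that by (intro integrable_const_bound)
  \<comment> \<open>A bound almost everywhere by a negative number would make the circle a null
    set.\<close>
  have "B \<ge> 0"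
  proof (rule ccontr)
    assume "\<not> B \<ge> 0"
    then have "\<not> norm (g t) \<le> B" for t using norm_ge_zero[of "g t"] by linarith
    then obtain N where "space circle \<subseteq> N" "emeasure circle N = 0" "N \<in> sets circle"
      using AE_E[OF g(2)] by (metis (mono_tags, lifting) Collect_cong Collect_mem_eq)
    then have "emeasure circle (space circle) = 0"
      using emeasure_mono[of "space circle" N circle] by simp
    then show False by (simp add: emeasure_restrict_space space_restrict_space)
  qed
  have gpm: "(\<lambda>t. g t * cnj (p t)) \<in> borel_measurable circle" 
    by (intro borel_measurable_times g(1)) (unfold cnj_p, intro measurable_circle, measurable)
  have Igp: "integrable circle (\<lambda>t. g t * cnj (p t))"
    using gpm g(2) pb \<open>B \<ge> 0\<close> by (intro bounded_int[of _ "B * C"]) (auto simp: norm_mult elim!: eventually_mono intro!: mult_mono)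
  have Ipp: "integrable circle (\<lambda>t. p t * cnj (p t))"
  proof (rule bounded_int)
    show "(\<lambda>t. p t * cnj (p t)) \<in> borel_measurable circle"
      by (intro borel_measurable_times pm) (unfold cnj_p, intro measurable_circle, measurable)
    show "AE t in circle. norm (p t * cnj (p t)) \<le> C * C"
      using pb order_trans[OF norm_ge_zero pb] by (intro AE_I2) (auto simp: norm_mult intro!: mult_mono)
  qed
  have "0 \<le> (LINT t|circle. (norm (g t - p t))\<^sup>2)" by simp
  also have "\<dots> = (LINT t|circle. (norm (g t))\<^sup>2 - 2 * Re (g t * cnj (p t)) + Re (p t * cnj (p t)))"
    unfolding cmod_power2
    by (intro Bochner_Integration.integral_cong) (auto simp: power2_eq_square algebra_simps)
  also have "\<dots> = (LINT t|circle. (norm (g t))\<^sup>2) - 2 * (2 * pi * S) + 2 * pi * S"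
  proof -
    have "integrable circle (\<lambda>t. (norm (g t))\<^sup>2)"
      using g by (intro integrable_const_bound[of _ "B\<^sup>2"]) (auto elim!: eventually_mono intro!: power_mono)
    moreover have "(LINT t|circle. u t - 2 * Re (v t) + Re (w t))
        = (LINT t|circle. u t) - 2 * Re (LINT t|circle. v t) + Re (LINT t|circle. w t)"
      if "integrable circle u" "integrable circle v" "integrable circle w" for u v w
      using that by simp
    ultimately show ?thesis using Igp Ipp by (simp only: gp pp Re_complex_of_real)
  qed
  also have "(LINT t|circle. (norm (g t))\<^sup>2) \<le> (LINT t|circle. B\<^sup>2)"
    using g by (intro integral_mono_AE integrable_const integrable_const_bound[of _ "B\<^sup>2"])
      (auto elim!: eventually_mono intro!: power_mono)
  also have "(LINT t|circle. B\<^sup>2) = 2 * pi * B\<^sup>2" using measure_circle by simp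
  finally have "2 * pi * S \<le> 2 * pi * B\<^sup>2" by simp
  then have "S \<le> B\<^sup>2" by simp
  then show ?thesis by (simp add: S_def c_def)
qed

lemma norm_cis_minus_one_ge:
  assumes "\<bar>t\<bar> \<le> pi"
  shows "\<bar>t\<bar> / 4 \<le> norm (cis t - 1)"
proof -
  \<comment> \<open>Up to pi/3 the cosine is at least 1/2, so the mean value theorem gives v/2.
    Beyond, sin v is at least sin(pi/6) = 1/2, while v/4 \<le> pi/8 < 1/2.\<close>
  have *: "v / 4 \<le> sin v" if "0 \<le> v" "v \<le> pi / 2" for v
  proof (cases "v \<le> pi / 3")
    case True
    show ?thesis
    proof (cases "v = 0")
      case False
      then have "0 < v" using that by simp
      then have "\<exists>z. 0 < z \<and> z < v \<and> sin v - sin 0 = (v - 0) * cos z"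
        by (intro MVT2) (auto intro!: derivative_eq_intros)
      then obtain z where z: "0 < z" "z < v" "sin v = v * cos z" by auto
      have "cos (pi / 3) \<le> cos z" using z True by (intro cos_monotone_0_pi_le) auto
      then have "v * (1/2) \<le> v * cos z" using \<open>0 < v\<close> by (intro mult_left_mono) (auto simp: cos_60)
      then show ?thesis using z \<open>0 < v\<close> by simp
    qed simp
  next
    case False
    have "sin (pi / 6) \<le> sin v" using False that by (intro sin_monotone_2pi_le) auto
    moreover have "v / 4 \<le> 1 / 2" using that pi_less_4 by simp
    ultimately show ?thesis by (simp add: sin_30)
  qed
  have "\<bar>t\<bar> / 2 / 4 \<le> sin (\<bar>t\<bar> / 2)" using assms by (intro *) auto
  also have "\<dots> \<le> \<bar>sin (t / 2)\<bar>"
    by (cases "t \<ge> 0") (auto simp: abs_if)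
  finally have "\<bar>t\<bar> / 4 \<le> 2 * \<bar>sin (t / 2)\<bar>" by simp
  also have "\<dots> = norm (cis t - 1)" by (simp add: cis_conv_exp dist_exp_i_1)
  finally show ?thesis .
qed

section \<open>Absolutely summable coefficients and pointwise convergence\<close>

lemma tendsto_norm_cis_minus_one_div:
  "((\<lambda>h. norm (cis (j * h) - 1) / h) \<longlongrightarrow> \<bar>j\<bar>) (at_right 0)"
proof -
  have "((\<lambda>z. exp (\<i> * of_real j * z)) has_field_derivative \<i> * of_real j) (at (of_real 0))"
    by (auto intro!: derivative_eq_intros)
  then have "((\<lambda>z. (exp (\<i> * of_real j * z) - 1) / z) \<longlongrightarrow> \<i> * of_real j) (at 0)"
    by (simp add: DERIV_def)
  moreover have "filterlim (complex_of_real) (at 0) (at 0)"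
    by (auto simp: filterlim_at eventually_at_filter intro!: tendsto_eq_intros)
  ultimately have "((\<lambda>h::real. (exp (\<i> * of_real j * of_real h) - 1) / of_real h) \<longlongrightarrow> \<i> * of_real j) (at 0)"
    by (rule filterlim_compose)
  then have "((\<lambda>h::real. (cis (j * h) - 1) /\<^sub>R h) \<longlongrightarrow> \<i> * of_real j) (at 0)"
    by (simp add: cis_conv_exp scaleR_conv_of_real divide_inverse mult_ac)
  then have "((\<lambda>h::real. norm ((cis (j * h) - 1) /\<^sub>R h)) \<longlongrightarrow> norm (\<i> * of_real j)) (at_right 0)"
    by (intro tendsto_norm) (auto intro: tendsto_mono[OF at_le])
  then have "((\<lambda>h::real. norm ((cis (j * h) - 1) /\<^sub>R h)) \<longlongrightarrow> \<bar>j\<bar>) (at_right 0)"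
    by (simp add: norm_mult)
  moreover have "\<forall>\<^sub>F h in at_right (0::real). norm ((cis (j * h) - 1) /\<^sub>R h) = norm (cis (j * h) - 1) / h"
    by (simp add: eventually_at_right_less divide_inverse eventually_mono[OF eventually_at_right_less] mult.commute)
  ultimately show ?thesis by (rule Lim_transform_eventually)
qed

text \<open>If \<open>c\<close> lists the Fourier coefficients of a function, then c_j (cis(jh) - 1)
  are those of its difference with step h. Dividing by h^2 and letting h tend to 0 shows that j c_j
  is square summable. Then |c_j| = |j c_j| (1/|j|) is at most the sum of the two squares; the index
  0 is put back at the end.\<close>

lemma summable_on_of_difference_bound:
  fixes c :: "int \<Rightarrow> complex"
  assumes "\<And>h F. 0 < h \<Longrightarrow> h \<le> 1 \<Longrightarrow> finite F \<Longrightarrow> (\<Sum>j\<in>F. (norm (c j * (cis (of_int j * h) - 1)))\<^sup>2) \<le> (C * h)\<^sup>2"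
  shows "(\<lambda>j. norm (c j)) summable_on UNIV"
proof -
  have sq: "(\<Sum>j\<in>F. (norm (c j) * \<bar>of_int j\<bar>)\<^sup>2) \<le> C\<^sup>2" if "finite F" for F
  proof (rule tendsto_upperbound)
    show "((\<lambda>h. \<Sum>j\<in>F. (norm (c j) * (norm (cis (of_int j * h) - 1) / h))\<^sup>2) \<longlongrightarrow> (\<Sum>j\<in>F. (norm (c j) * \<bar>of_int j\<bar>)\<^sup>2)) (at_right 0)"
      by (intro tendsto_intros tendsto_norm_cis_minus_one_div)
    show "\<forall>\<^sub>F h in at_right (0::real). (\<Sum>j\<in>F. (norm (c j) * (norm (cis (of_int j * h) - 1) / h))\<^sup>2) \<le> C\<^sup>2"
      using eventually_at_right_real[of 0 1]
    proof (rule eventually_mono)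
      fix h :: real assume h: "h \<in> {0<..<1}"
      have "(\<Sum>j\<in>F. (norm (c j) * (norm (cis (of_int j * h) - 1) / h))\<^sup>2)
          = (\<Sum>j\<in>F. (norm (c j * (cis (of_int j * h) - 1)))\<^sup>2) / h\<^sup>2"
        by (simp add: sum_divide_distrib norm_mult power_mult_distrib power_divide)
      also have "\<dots> \<le> (C * h)\<^sup>2 / h\<^sup>2" using h that by (intro divide_right_mono assms) auto
      also have "\<dots> = C\<^sup>2" using h by (simp add: power_mult_distrib)
      finally show "(\<Sum>j\<in>F. (norm (c j) * (norm (cis (of_int j * h) - 1) / h))\<^sup>2) \<le> C\<^sup>2" .
    qed simp
  qed simp
  have S1: "(\<lambda>j::int. (norm (c j) * \<bar>of_int j\<bar>)\<^sup>2) summable_on UNIV"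
    by (rule nonneg_bdd_above_summable_on) (auto intro!: bdd_aboveI[of _ "C\<^sup>2"] sq)
  have "(\<lambda>j. norm (c j)) summable_on (UNIV - {0})"
  proof (rule summable_on_comparison_test)
    show "(\<lambda>j::int. (norm (c j) * \<bar>of_int j\<bar>)\<^sup>2 + 1 / (of_int j)\<^sup>2) summable_on (UNIV - {0})"
      by (intro summable_on_add summable_on_subset[OF S1] summable_on_subset[OF summable_on_int_inverse_square]) auto
    fix j :: int assume "j \<in> UNIV - {0}"
    define a where "a = norm (c j) * \<bar>of_int j\<bar>"
    define b where "b = 1 / \<bar>real_of_int j\<bar>"
    have "norm (c j) = a * b" using \<open>j \<in> _\<close> by (simp add: a_def b_def)
    also have "\<dots> \<le> a\<^sup>2 + b\<^sup>2" using sum_squares_bound[of a b] zero_le_power2[of a] zero_le_power2[of b] by linarith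
    also have "b\<^sup>2 = 1 / (of_int j)\<^sup>2" by (simp add: b_def power_divide)
    finally show "norm (c j) \<le> (norm (c j) * \<bar>of_int j\<bar>)\<^sup>2 + 1 / (of_int j)\<^sup>2" by (simp add: a_def)
  qed auto
  moreover have "(\<lambda>j. norm (c j)) summable_on (insert 0 (UNIV - {0}))"
    using calculation by (subst summable_on_insert_iff)
  ultimately show ?thesis by (simp add: insert_UNIV)
qed

lemma telescoping_int_sum:
  fixes f :: "int \<Rightarrow> 'a :: ab_group_add"
  shows "(\<Sum>j\<in>{- int N..int N}. f (j - 1) - f j) = f (- int N - 1) - f (int N)"
proof (induction N)
  case (Suc N)
  define n where "n = int N"
  have "n \<ge> 0" by (simp add: n_def)
  then have "{- int (Suc N)..int (Suc N)} = insert (- n - 1) (insert (n + 1) {- n..n})"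
    by (auto simp: n_def)
  then have "(\<Sum>j\<in>{- int (Suc N)..int (Suc N)}. f (j - 1) - f j)
      = (f (- n - 1 - 1) - f (- n - 1)) + ((f (n + 1 - 1) - f (n + 1)) + (f (- n - 1) - f n))"
    using \<open>n \<ge> 0\<close> Suc by (simp flip: n_def)
  then show ?case by (simp add: n_def algebra_simps)
qed simp

text \<open>The Riemann-Lebesgue lemma for bounded functions: by Bessel's inequality the squares are
  summable over all integers, and injectivity of \<sigma> makes them summable along the
  sequence.\<close>

lemma fourier_coeff_tendsto_0:
  assumes "g \<in> borel_measurable circle" "AE t in circle. norm (g t) \<le> B"
    and "inj (\<sigma> :: nat \<Rightarrow> int)"
  shows "(\<lambda>N. fourier_coeff g (\<sigma> N)) \<longlonglongrightarrow> 0"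
proof -
  have "(\<lambda>j. (norm (fourier_coeff g j))\<^sup>2) summable_on UNIV"
    by (rule nonneg_bdd_above_summable_on)
      (auto intro!: bdd_aboveI[of _ "B\<^sup>2"] bessel_inequality assms)
  then have "(\<lambda>j. (norm (fourier_coeff g j))\<^sup>2) summable_on range \<sigma>"
    by (rule summable_on_subset) simp
  then have "summable (\<lambda>N. (norm (fourier_coeff g (\<sigma> N)))\<^sup>2)"
    using assms(3) by (subst (asm) summable_on_reindex) (auto simp: o_def dest: summable_on_imp_summable)
  then have "(\<lambda>N. (norm (fourier_coeff g (\<sigma> N)))\<^sup>2) \<longlonglongrightarrow> 0"
    by (rule summable_LIMSEQ_zero)
  then have "(\<lambda>N. sqrt ((norm (fourier_coeff g (\<sigma> N)))\<^sup>2)) \<longlonglongrightarrow> sqrt 0"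
    by (rule tendsto_real_sqrt)
  then show ?thesis by (simp add: tendsto_norm_zero_iff)
qed

text \<open>
  Absolute convergence comes from Bessel's inequality for the difference quotients of \<open>G\<close>;
  pointwise convergence from Chernoff's observation that the symmetric partial sums of
  \<open>(G (t + s) - G s) / (cis t - 1)\<close> telescope.
\<close>

lemma
  fixes F G :: "real \<Rightarrow> complex"
  defines "G \<equiv> \<lambda>t. \<Sum>\<^sub>\<infinity>k::int. F (t + 2 * pi * of_int k)"
  defines "c \<equiv> \<lambda>j::int. (LBINT \<xi>. F \<xi> * cis (- of_int j * \<xi>)) / (2 * pi)"
  assumes \<kappa>: "\<kappa> > 0" and le: "\<And>\<xi>. norm (F \<xi>) \<le> D * exp (- \<kappa> * \<bar>\<xi>\<bar>)"
    and F [measurable]: "F \<in> borel_measurable borel"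
    and Z: "countable Z"
    and lip: "\<And>t h. t \<notin> Z \<Longrightarrow> t + h \<notin> Z \<Longrightarrow> \<bar>h\<bar> \<le> pi \<Longrightarrow> norm (G (t + h) - G t) \<le> C * \<bar>h\<bar>"
  shows abs_summable_on_periodization_coeff: "(\<lambda>j. norm (c j)) summable_on UNIV"
    and fourier_series_periodization_tendsto:
      "\<And>s. s \<notin> Z \<Longrightarrow> (\<lambda>N. \<Sum>j\<in>{- int N..int N}. c j * cis (of_int j * s)) \<longlonglongrightarrow> G s"
proof -
  have Gm [measurable]: "G \<in> borel_measurable borel"
    unfolding G_def by (intro borel_measurable_infsum_int summable_on_periodization(1)[OF \<kappa> le]) measurable
  \<comment> \<open>Translation by h only enlarges the constant, so the periodization results apply
    to every translate of \<open>F\<close>.\<close>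
  have le_shift: "norm (F (\<xi> + h) * cis a) \<le> D * exp (\<kappa> * \<bar>h\<bar>) * exp (- \<kappa> * \<bar>\<xi>\<bar>)" for \<xi> h a
  proof -
    have D: "D \<ge> 0" using order_trans[OF norm_ge_zero le[of 0]] by simp
    have "\<bar>\<xi>\<bar> - \<bar>h\<bar> \<le> \<bar>\<xi> + h\<bar>" by linarith
    then have "\<kappa> * (\<bar>\<xi>\<bar> - \<bar>h\<bar>) \<le> \<kappa> * \<bar>\<xi> + h\<bar>" using \<kappa> by (intro mult_left_mono) auto
    then have "exp (- \<kappa> * \<bar>\<xi> + h\<bar>) \<le> exp (\<kappa> * \<bar>h\<bar>) * exp (- \<kappa> * \<bar>\<xi>\<bar>)"
      by (simp add: algebra_simps flip: exp_add)
    then have "D * exp (- \<kappa> * \<bar>\<xi> + h\<bar>) \<le> D * (exp (\<kappa> * \<bar>h\<bar>) * exp (- \<kappa> * \<bar>\<xi>\<bar>))"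
      using D by (rule mult_left_mono)
    then show ?thesis using le[of "\<xi> + h"] by (simp add: norm_mult mult.assoc)
  qed
  have shift_sum: "(\<Sum>\<^sub>\<infinity>k::int. F (t + 2 * pi * of_int k + h) * cis (- of_int j * (t + 2 * pi * of_int k)))
      = G (t + h) * cis (- of_int j * t)" for t h and j :: int
  proof -
    have "cis (- of_int j * (t + 2 * pi * of_int k)) = cis (- of_int j * t)" for k :: int
    proof -
      have "cis (- of_int j * (t + 2 * pi * of_int k)) = cis (- of_int j * t) * cis (2 * pi * of_int (- j * k))"
        by (simp add: cis_mult algebra_simps)
      also have "cis (2 * pi * of_int (- j * k)) = 1"
        by (rule cis_multiple_2pi) simp
      finally show ?thesis by simp
    qed
    then show ?thesis
      unfolding G_def by (simp add: infsum_cmult_left' add_ac)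
  qed
  \<comment> \<open>The shift is made in the integral over the line, which is translation invariant,
    and only then folded into one period. The case h = 0 identifies \<open>c j\<close> as a Fourier
    coefficient of \<open>G\<close>.\<close>
  have coeff: "c j * cis (of_int j * h) = fourier_coeff (\<lambda>t. G (t + h)) j" for j h
  proof -
    have "(LBINT \<xi>. F \<xi> * cis (- of_int j * \<xi>)) = (LBINT \<xi>. F (\<xi> + h) * cis (- of_int j * (\<xi> + h)))"
      by (subst lborel_integral_real_affine[of 1 _ h]) (simp_all add: add.commute)
    also have "\<dots> = (LBINT \<xi>. (F (\<xi> + h) * cis (- of_int j * \<xi>)) * cis (- of_int j * h))"
      by (intro Bochner_Integration.integral_cong) (auto simp: mult.assoc cis_mult algebra_simps)
    also have "\<dots> = (LBINT \<xi>. F (\<xi> + h) * cis (- of_int j * \<xi>)) * cis (- of_int j * h)"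
      by simp
    also have "(LBINT \<xi>. F (\<xi> + h) * cis (- of_int j * \<xi>))
        = (LINT t|circle. (\<Sum>\<^sub>\<infinity>k::int. F (t + 2 * pi * of_int k + h) * cis (- of_int j * (t + 2 * pi * of_int k))))"
      by (rule integral_periodization[OF \<kappa> le_shift]) measurable
    also have "\<dots> = (LINT t|circle. G (t + h) * cis (- of_int j * t))"
      by (simp only: shift_sum)
    finally have "c j = fourier_coeff (\<lambda>t. G (t + h)) j * cis (- of_int j * h)"
      by (simp add: c_def fourier_coeff_def)
    then show ?thesis by (simp add: mult.assoc cis_mult)
  qed
  have G_bound: "\<exists>K. \<forall>t. \<bar>t\<bar> \<le> pi \<longrightarrow> norm (G (t + h)) \<le> K" for h
  proof -
    have "norm (G (t + h)) \<le> (\<Sum>\<^sub>\<infinity>k::int. D * exp (\<kappa> * \<bar>h\<bar>) * exp (\<kappa> * pi) * exp (- (2 * pi * \<kappa>) * \<bar>of_int k\<bar>))"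
      if "\<bar>t\<bar> \<le> pi" for t
      using summable_on_periodization(2)[OF \<kappa> le_shift[of _ h 0] that] unfolding G_def by (simp add: add_ac)
    then show ?thesis by blast
  qed
  have G_int: "integrable circle (\<lambda>t. G (t + h) * cis (a * t))" for h a
  proof -
    obtain K where "\<forall>t. \<bar>t\<bar> \<le> pi \<longrightarrow> norm (G (t + h)) \<le> K" using G_bound by blast
    then show ?thesis
      by (intro integrable_circle_bounded[of _ K] measurable_circle AE_I2) (auto simp: space_restrict_space)
  qed
  \<comment> \<open>The Lipschitz hypothesis needs both ends of the step off \<open>Z\<close>; since
    \<open>Z\<close> and its translate are countable, almost every t qualifies.\<close>
  have avoid: "AE t in circle. t + h \<notin> Z" for h
  proof -
    have "AE t in circle. t \<notin> (\<lambda>z. z - h) ` Z" using Z by (intro AE_circle_not_countable) simp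
    then show ?thesis by eventually_elim force
  qed
  show sum: "(\<lambda>j. norm (c j)) summable_on UNIV"
  proof (rule summable_on_of_difference_bound)
    fix h :: real and J :: "int set"
    assume h: "0 < h" "h \<le> 1" and "finite J"
    have "c j * (cis (of_int j * h) - 1) = fourier_coeff (\<lambda>t. G (t + h) - G t) j" for j
      using coeff[of j h] coeff[of j 0] G_int[of h "- of_int j"] G_int[of 0 "- of_int j"]
      by (simp add: fourier_coeff_def algebra_simps diff_divide_distrib)
    moreover have "(\<Sum>j\<in>J. (norm (fourier_coeff (\<lambda>t. G (t + h) - G t) j))\<^sup>2) \<le> (C * h)\<^sup>2"
    proof (rule bessel_inequality)
      show "AE t in circle. norm (G (t + h) - G t) \<le> C * h"
        using avoid[of h] avoid[of 0]
      proof eventually_elim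
        case (elim t)
        then show ?case using lip[of t h] h pi_gt3 by simp
      qed
    qed (auto intro!: measurable_circle \<open>finite J\<close>)
    ultimately show "(\<Sum>j\<in>J. (norm (c j * (cis (of_int j * h) - 1)))\<^sup>2) \<le> (C * h)\<^sup>2" by simp
  qed
  show "(\<lambda>N. \<Sum>j\<in>{- int N..int N}. c j * cis (of_int j * s)) \<longlonglongrightarrow> G s" if "s \<notin> Z" for s
  proof -
    define H where "H t = (G (t + s) - G s) / (cis t - 1)" for t
    have [measurable]: "H \<in> borel_measurable borel" unfolding H_def by measurable
    have Hm: "H \<in> borel_measurable circle" by (intro measurable_circle) measurable
    \<comment> \<open>The Lipschitz bound C|t| on the numerator meets the lower bound |t|/4 on the
      denominator, whence 4 C.\<close>
    have Hb: "AE t in circle. norm (H t) \<le> 4 * C"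
      using avoid[of s] AE_circle_not_countable[of "{0}", simplified] AE_space
    proof eventually_elim
      case (elim t)
      then have t: "\<bar>t\<bar> \<le> pi" "t \<noteq> 0" by (auto simp: space_restrict_space)
      have "norm (G (t + s) - G s) \<le> C * \<bar>t\<bar>"
        using lip[of s t] elim that t by (simp add: add.commute)
      moreover have "\<bar>t\<bar> / 4 \<le> norm (cis t - 1)" by (rule norm_cis_minus_one_ge) fact
      moreover have "C \<ge> 0"
        using order_trans[OF norm_ge_zero calculation(1)] t by (simp add: zero_le_mult_iff)
      ultimately have "norm (G (t + s) - G s) \<le> (4 * C) * norm (cis t - 1)"
        using mult_left_mono[of "\<bar>t\<bar> / 4" "norm (cis t - 1)" "4 * C"] by simp
      moreover have "norm (cis t - 1) > 0"
        using \<open>\<bar>t\<bar> / 4 \<le> norm (cis t - 1)\<close> t by linarith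
      ultimately show ?case
        by (simp add: H_def norm_divide pos_divide_le_eq)
    qed
    have HI: "integrable circle (\<lambda>t. H t * cis (a * t))" for a
      by (rule integrable_circle_bounded[OF Hm Hb])
    have GH: "AE t in circle. G (t + s) - G s = H t * cis t - H t"
      using AE_circle_not_countable[of "{0}", simplified] AE_space
    proof eventually_elim
      case (elim t)
      then have "\<bar>t\<bar> \<le> pi" "t \<noteq> 0" by (auto simp: space_restrict_space)
      then have "norm (cis t - 1) > 0" using norm_cis_minus_one_ge[of t] by linarith
      then have "H t * (cis t - 1) = G (t + s) - G s" by (simp add: H_def)
      then show ?case by (simp add: right_diff_distrib)
    qed
    \<comment> \<open>The identity G(t + s) - G(s) = H(t) (cis t - 1) is read on Fourier
      coefficients: multiplication by cis t lowers the index by one, and the constant G(s)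
      contributes only at j = 0.\<close>
    have step: "c j * cis (of_int j * s) - (if j = 0 then G s else 0) = fourier_coeff H (j - 1) - fourier_coeff H j" for j
    proof -
      have "(LINT t|circle. G (t + s) * cis (- of_int j * t) - G s * cis (- of_int j * t))
          = (LINT t|circle. H t * cis (- of_int (j - 1) * t) - H t * cis (- of_int j * t))"
      proof (rule integral_cong_AE)
        show "AE t in circle. G (t + s) * cis (- of_int j * t) - G s * cis (- of_int j * t)
            = H t * cis (- of_int (j - 1) * t) - H t * cis (- of_int j * t)"
          using GH
        proof eventually_elim
          case (elim t)
          have "cis (- of_int (j - 1) * t) = cis t * cis (- of_int j * t)"
            by (simp add: cis_mult algebra_simps)
          moreover have "(G (t + s) - G s) * cis (- of_int j * t) = (H t * cis t - H t) * cis (- of_int j * t)"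
            using elim by simp
          ultimately show ?case by (simp only: left_diff_distrib mult.assoc)
        qed
      next
        show "(\<lambda>t. G (t + s) * cis (- of_int j * t) - G s * cis (- of_int j * t)) \<in> borel_measurable circle"
          by (rule measurable_circle) measurable
        show "(\<lambda>t. H t * cis (- of_int (j - 1) * t) - H t * cis (- of_int j * t)) \<in> borel_measurable circle"
          by (rule measurable_circle) measurable
      qed
      moreover have "integrable circle (\<lambda>t. G s * cis (- of_int j * t))"
        by (rule integrable_circle_bounded[of _ "norm (G s)"]) auto
      moreover have "(LINT t|circle. G s * cis (- of_int j * t)) = G s * (if j = 0 then 2 * pi else 0)"
        using integral_circle_cis[of "- j"] by simp
      moreover have "(LINT t|circle. g t * cis (- of_int k * t)) = 2 * pi * fourier_coeff g k" for g k
        by (simp add: fourier_coeff_def)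
      ultimately have "2 * pi * fourier_coeff (\<lambda>t. G (t + s)) j - G s * (if j = 0 then 2 * pi else 0)
          = 2 * pi * fourier_coeff H (j - 1) - 2 * pi * fourier_coeff H j"
        by (simp only: Bochner_Integration.integral_diff G_int HI)
      then have "2 * pi * (c j * cis (of_int j * s) - (if j = 0 then G s else 0))
          = 2 * pi * (fourier_coeff H (j - 1) - fourier_coeff H j)"
        unfolding coeff by (auto simp: algebra_simps split: if_splits)
      then show ?thesis by simp
    qed
    \<comment> \<open>Only the indices -N - 1 and N survive the telescoping; both run injectively
      through the integers, so the two coefficients tend to 0.\<close>
    have "(\<Sum>j\<in>{- int N..int N}. c j * cis (of_int j * s))
        = G s + fourier_coeff H (- int N - 1) - fourier_coeff H (int N)" for N
    proof -
      have "(\<Sum>j\<in>{- int N..int N}. c j * cis (of_int j * s) - (if j = 0 then G s else 0))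
          = fourier_coeff H (- int N - 1) - fourier_coeff H (int N)"
        unfolding step by (rule telescoping_int_sum)
      then show ?thesis by (simp add: sum_subtractf algebra_simps)
    qed
    moreover have "(\<lambda>N. G s + fourier_coeff H (- int N - 1) - fourier_coeff H (int N)) \<longlonglongrightarrow> G s + 0 - 0"
      by (intro tendsto_intros fourier_coeff_tendsto_0[OF Hm Hb]) (auto simp: inj_def)
    ultimately show ?thesis by simp
  qed
qed

subsection \<open>Bounded Lipschitz functions\<close>

text \<open>Boundedness belongs to the notion because products require it. The bound compares any
  two points of \<open>X\<close> directly, with no path inside \<open>X\<close>, so it reaches
  across a removed point such as 0.\<close>

definition bdd_lipschitz_on :: "real set \<Rightarrow> (real \<Rightarrow> complex) \<Rightarrow> bool" where
  "bdd_lipschitz_on X f \<longleftrightarrow>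
     (\<exists>B\<ge>0. \<forall>x\<in>X. \<forall>y\<in>X. norm (f x) \<le> B \<and> norm (f x - f y) \<le> B * \<bar>x - y\<bar>)"

lemma bdd_lipschitz_onI:
  assumes "\<And>x. x \<in> X \<Longrightarrow> norm (f x) \<le> B" "\<And>x y. x \<in> X \<Longrightarrow> y \<in> X \<Longrightarrow> norm (f x - f y) \<le> C * \<bar>x - y\<bar>"
  shows "bdd_lipschitz_on X f"
  unfolding bdd_lipschitz_on_def
proof (intro exI[of _ "max 0 (max B C)"] conjI ballI)
  fix x y assume xy: "x \<in> X" "y \<in> X"
  show "norm (f x) \<le> max 0 (max B C)" using assms(1)[OF xy(1)] by simp
  have "C * \<bar>x - y\<bar> \<le> max 0 (max B C) * \<bar>x - y\<bar>" by (intro mult_right_mono) auto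
  then show "norm (f x - f y) \<le> max 0 (max B C) * \<bar>x - y\<bar>" using assms(2)[OF xy] by linarith
qed simp

lemma bdd_lipschitz_onE:
  assumes "bdd_lipschitz_on X f"
  obtains B where "B \<ge> 0" "\<And>x. x \<in> X \<Longrightarrow> norm (f x) \<le> B"
    "\<And>x y. x \<in> X \<Longrightarrow> y \<in> X \<Longrightarrow> norm (f x - f y) \<le> B * \<bar>x - y\<bar>"
  using assms unfolding bdd_lipschitz_on_def by metis

lemma bdd_lipschitz_on_cong:
  "(\<And>x. x \<in> X \<Longrightarrow> f x = g x) \<Longrightarrow> bdd_lipschitz_on X f \<longleftrightarrow> bdd_lipschitz_on X g"
  unfolding bdd_lipschitz_on_def by (intro ex_cong1 conj_cong ball_cong refl) auto

lemma bdd_lipschitz_on_const: "bdd_lipschitz_on X (\<lambda>_. a)"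
  by (rule bdd_lipschitz_onI[of _ _ "norm a" 0]) auto

lemma bdd_lipschitz_on_add:
  assumes "bdd_lipschitz_on X f" "bdd_lipschitz_on X g"
  shows "bdd_lipschitz_on X (\<lambda>x. f x + g x)"
proof -
  obtain B C where B: "\<And>x. x \<in> X \<Longrightarrow> norm (f x) \<le> B"
      "\<And>x y. x \<in> X \<Longrightarrow> y \<in> X \<Longrightarrow> norm (f x - f y) \<le> B * \<bar>x - y\<bar>"
    and C: "\<And>x. x \<in> X \<Longrightarrow> norm (g x) \<le> C"
      "\<And>x y. x \<in> X \<Longrightarrow> y \<in> X \<Longrightarrow> norm (g x - g y) \<le> C * \<bar>x - y\<bar>"
    using assms by (metis bdd_lipschitz_onE)
  show ?thesis
  proof (rule bdd_lipschitz_onI)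
    show "norm (f x + g x) \<le> B + C" if "x \<in> X" for x
      using B(1) C(1) that by (intro order_trans[OF norm_triangle_ineq] add_mono) auto
    show "norm (f x + g x - (f y + g y)) \<le> (B + C) * \<bar>x - y\<bar>" if "x \<in> X" "y \<in> X" for x y
      using norm_triangle_ineq[of "f x - f y" "g x - g y"] B(2)[OF that] C(2)[OF that]
      by (simp add: algebra_simps)
  qed
qed

lemma bdd_lipschitz_on_mult:
  assumes "bdd_lipschitz_on X f" "bdd_lipschitz_on X g"
  shows "bdd_lipschitz_on X (\<lambda>x. f x * g x)"
proof -
  obtain B C where B: "B \<ge> 0" "\<And>x. x \<in> X \<Longrightarrow> norm (f x) \<le> B"
      "\<And>x y. x \<in> X \<Longrightarrow> y \<in> X \<Longrightarrow> norm (f x - f y) \<le> B * \<bar>x - y\<bar>"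
    and C: "C \<ge> 0" "\<And>x. x \<in> X \<Longrightarrow> norm (g x) \<le> C"
      "\<And>x y. x \<in> X \<Longrightarrow> y \<in> X \<Longrightarrow> norm (g x - g y) \<le> C * \<bar>x - y\<bar>"
    using assms by (metis bdd_lipschitz_onE)
  show ?thesis
  proof (rule bdd_lipschitz_onI)
    show "norm (f x * g x) \<le> B * C" if "x \<in> X" for x
      unfolding norm_mult using B C that by (intro mult_mono) auto
    show "norm (f x * g x - f y * g y) \<le> (2 * B * C) * \<bar>x - y\<bar>" if "x \<in> X" "y \<in> X" for x y
    proof -
      have "f x * g x - f y * g y = f x * (g x - g y) + (f x - f y) * g y" by (simp add: algebra_simps)
      also have "norm \<dots> \<le> norm (f x) * norm (g x - g y) + norm (f x - f y) * norm (g y)"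
        by (metis norm_mult norm_triangle_ineq)
      also have "\<dots> \<le> B * (C * \<bar>x - y\<bar>) + (B * \<bar>x - y\<bar>) * C"
        using B C that by (intro add_mono mult_mono) auto
      finally show ?thesis by (simp add: algebra_simps)
    qed
  qed
qed

lemma bdd_lipschitz_on_inverse:
  assumes "bdd_lipschitz_on X f" "m > 0" "\<And>x. x \<in> X \<Longrightarrow> norm (f x) \<ge> m"
  shows "bdd_lipschitz_on X (\<lambda>x. inverse (f x))"
proof -
  obtain B where B: "B \<ge> 0" "\<And>x y. x \<in> X \<Longrightarrow> y \<in> X \<Longrightarrow> norm (f x - f y) \<le> B * \<bar>x - y\<bar>"
    using assms by (metis bdd_lipschitz_onE)
  have inv: "norm (inverse (f x)) \<le> inverse m" if "x \<in> X" for x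
    unfolding norm_inverse using assms that by (intro le_imp_inverse_le) auto
  show ?thesis
  proof (rule bdd_lipschitz_onI)
    show "norm (inverse (f x)) \<le> inverse m" if "x \<in> X" for x by (rule inv[OF that])
    show "norm (inverse (f x) - inverse (f y)) \<le> (inverse m * B * inverse m) * \<bar>x - y\<bar>"
      if "x \<in> X" "y \<in> X" for x y
    proof -
      have "f x \<noteq> 0" "f y \<noteq> 0" using assms(2,3) that by force+
      then have "inverse (f x) - inverse (f y) = - (inverse (f x) * (f x - f y) * inverse (f y))"
        by (rule inverse_diff_inverse)
      then have "norm (inverse (f x) - inverse (f y)) = norm (inverse (f x)) * norm (f x - f y) * norm (inverse (f y))"
        by (simp add: norm_mult)
      also have "\<dots> \<le> inverse m * (B * \<bar>x - y\<bar>) * inverse m"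
        using B inv that assms(2) by (intro mult_mono mult_nonneg_nonneg) auto
      finally show ?thesis by (simp add: mult_ac)
    qed
  qed
qed

lemma bdd_lipschitz_on_infsum:
  assumes "b summable_on K"
    and "\<And>k x. k \<in> K \<Longrightarrow> x \<in> X \<Longrightarrow> norm (f k x) \<le> b k"
    and "\<And>k x y. k \<in> K \<Longrightarrow> x \<in> X \<Longrightarrow> y \<in> X \<Longrightarrow> norm (f k x - f k y) \<le> b k * \<bar>x - y\<bar>"
  shows "bdd_lipschitz_on X (\<lambda>x. \<Sum>\<^sub>\<infinity>k\<in>K. f k x)"
proof (rule bdd_lipschitz_onI)
  show "norm (\<Sum>\<^sub>\<infinity>k\<in>K. f k x) \<le> infsum b K" if "x \<in> X" for x
    by (rule abs_summable_on_comparison(3)[OF assms(1)]) (use assms that in auto)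
  show "norm ((\<Sum>\<^sub>\<infinity>k\<in>K. f k x) - (\<Sum>\<^sub>\<infinity>k\<in>K. f k y)) \<le> infsum b K * \<bar>x - y\<bar>"
    if "x \<in> X" "y \<in> X" for x y
  proof -
    have S: "(\<lambda>k. f k x) summable_on K" if "x \<in> X" for x
      by (rule abs_summable_on_comparison(2)[OF assms(1)]) (use assms that in auto)
    have "((\<lambda>k. f k x - f k y) has_sum (\<Sum>\<^sub>\<infinity>k\<in>K. f k x) - (\<Sum>\<^sub>\<infinity>k\<in>K. f k y)) K"
      using has_sum_add[OF has_sum_infsum[OF S[OF that(1)]] has_sum_uminusI[OF has_sum_infsum[OF S[OF that(2)]]]]
      by simp
    then have "(\<Sum>\<^sub>\<infinity>k\<in>K. f k x) - (\<Sum>\<^sub>\<infinity>k\<in>K. f k y) = (\<Sum>\<^sub>\<infinity>k\<in>K. f k x - f k y)"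
      by (simp add: infsumI)
    also have "norm \<dots> \<le> (\<Sum>\<^sub>\<infinity>k\<in>K. b k * \<bar>x - y\<bar>)"
      by (rule abs_summable_on_comparison(3)) (use assms that in \<open>auto intro: summable_on_cmult_left\<close>)
    also have "\<dots> = infsum b K * \<bar>x - y\<bar>" by (rule infsum_cmult_left')
    finally show ?thesis .
  qed
qed

lemma bdd_lipschitz_on_compose:
  assumes "bdd_lipschitz_on Y f" "L \<ge> 0" "\<And>x. x \<in> X \<Longrightarrow> g x \<in> Y"
    "\<And>x y. x \<in> X \<Longrightarrow> y \<in> X \<Longrightarrow> \<bar>g x - g y\<bar> \<le> L * \<bar>x - y\<bar>"
  shows "bdd_lipschitz_on X (\<lambda>x. f (g x))"
proof -
  obtain B where B: "B \<ge> 0" "\<And>x. x \<in> Y \<Longrightarrow> norm (f x) \<le> B"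
      "\<And>x y. x \<in> Y \<Longrightarrow> y \<in> Y \<Longrightarrow> norm (f x - f y) \<le> B * \<bar>x - y\<bar>"
    using assms by (metis bdd_lipschitz_onE)
  show ?thesis
  proof (rule bdd_lipschitz_onI)
    show "norm (f (g x)) \<le> B" if "x \<in> X" for x using B assms that by auto
    show "norm (f (g x) - f (g y)) \<le> (B * L) * \<bar>x - y\<bar>" if "x \<in> X" "y \<in> X" for x y
      using B(3)[OF assms(3)[OF that(1)] assms(3)[OF that(2)]] mult_left_mono[OF assms(4)[OF that] B(1)]
      by (simp add: mult.assoc)
  qed
qed

section \<open>Characters, powers and reciprocals of Bessel mixtures\<close>

lemma norm_cis_diff_le: "norm (cis a - cis b) \<le> \<bar>a - b\<bar>"
proof -
  have "cis a - cis b = cis b * (cis (a - b) - 1)" by (simp add: algebra_simps cis_mult)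
  then have "norm (cis a - cis b) = norm (cis (a - b) - 1)"
    by (simp only: norm_mult norm_cis mult_1)
  also have "\<dots> = norm (exp (\<i> * of_real (a - b)) - 1)"
    by (simp only: cis_conv_exp)
  also have "\<dots> = 2 * \<bar>sin ((a - b) / 2)\<bar>" by (rule dist_exp_i_1)
  also have "\<dots> \<le> 2 * \<bar>(a - b) / 2\<bar>" by (intro mult_left_mono abs_sin_x_le_abs_x) auto
  finally show ?thesis by simp
qed

lemma bdd_lipschitz_on_cis: "bdd_lipschitz_on X (\<lambda>t. cis (x * t))"
proof (rule bdd_lipschitz_onI)
  show "norm (cis (x * t) - cis (x * s)) \<le> \<bar>x\<bar> * \<bar>t - s\<bar>" for t s
    using norm_cis_diff_le[of "x * t" "x * s"] by (simp flip: abs_mult right_diff_distrib)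
  show "norm (cis (x * t)) \<le> 1" for t by simp
qed

text \<open>For p \<ge> 1 the derivative p z^(p - 1) stays bounded near 0 and is largest at the
  right end \<open>Z\<close>.\<close>

lemma bdd_lipschitz_on_powr:
  assumes "p \<ge> 1"
  shows "bdd_lipschitz_on {0<..Z} (\<lambda>z. of_real (z powr p))"
proof (rule bdd_lipschitz_onI)
  show "norm (complex_of_real (z powr p)) \<le> Z powr p" if "z \<in> {0<..Z}" for z
    using that assms by (auto intro!: powr_mono2)
  have *: "\<bar>b powr p - a powr p\<bar> \<le> (p * Z powr (p - 1)) * \<bar>b - a\<bar>"
    if "a \<in> {0<..Z}" "b \<in> {0<..Z}" "a < b" for a b
  proof -
    have "\<exists>z. a < z \<and> z < b \<and> b powr p - a powr p = (b - a) * (p * z powr (p - 1))"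
      using that by (intro MVT2) (auto intro!: has_real_derivative_powr)
    then obtain z where z: "a < z" "z < b" "b powr p - a powr p = (b - a) * (p * z powr (p - 1))" by blast
    have "z powr (p - 1) \<le> Z powr (p - 1)" using z that assms by (intro powr_mono2) auto
    then have "(b - a) * (p * z powr (p - 1)) \<le> (b - a) * (p * Z powr (p - 1))"
      using that assms by (intro mult_left_mono) auto
    moreover have "0 \<le> (b - a) * (p * z powr (p - 1))" using that assms by simp
    ultimately show ?thesis using z that by (simp add: mult.commute)
  qed
  show "norm (complex_of_real (a powr p) - complex_of_real (b powr p)) \<le> (p * Z powr (p - 1)) * \<bar>a - b\<bar>"
    if "a \<in> {0<..Z}" "b \<in> {0<..Z}" for a b
  proof -
    have "\<bar>a powr p - b powr p\<bar> \<le> (p * Z powr (p - 1)) * \<bar>a - b\<bar>"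
      using *[of a b] *[of b a] that by (cases a b rule: linorder_cases) (auto simp: abs_minus_commute)
    then show ?thesis by (simp only: norm_of_real flip: of_real_diff)
  qed
qed

text \<open>By monotonicity the mixture lies between its value at \<open>Z\<close>, which is
  positive, and its value at 0, which is finite for negative order. The first bounds the
  reciprocal.\<close>

lemma bdd_lipschitz_on_inverse_bessel_mix_neg:
  assumes "\<nu> < - 1 / 2" "Z > 0"
  shows "bdd_lipschitz_on {0<..Z} (\<lambda>z. inverse (of_real (bessel_mix \<nu> z)))"
proof (rule bdd_lipschitz_on_inverse)
  show "bdd_lipschitz_on {0<..Z} (\<lambda>z. of_real (bessel_mix \<nu> z))"
  proof (rule bdd_lipschitz_onI)
    show "norm (complex_of_real (bessel_mix \<nu> z)) \<le> bessel_mix \<nu> 0" if "z \<in> {0<..Z}" for z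
      using that assms bessel_mix_antimono[of 0 z \<nu>] by (auto simp: bessel_mix_nonneg)
    have *: "\<bar>bessel_mix \<nu> a - bessel_mix \<nu> b\<bar> \<le> bessel_mix (\<nu> + 1/2) 0 * \<bar>a - b\<bar>"
      if "a \<in> {0<..Z}" "b \<in> {0<..Z}" "a \<le> b" for a b
      using bessel_mix_lipschitz[of a b \<nu>] bessel_mix_antimono[of a b \<nu>] that assms
      by (simp add: mult.commute)
    show "norm (complex_of_real (bessel_mix \<nu> a) - complex_of_real (bessel_mix \<nu> b)) \<le> bessel_mix (\<nu> + 1/2) 0 * \<bar>a - b\<bar>"
      if "a \<in> {0<..Z}" "b \<in> {0<..Z}" for a b
    proof -
      have "\<bar>bessel_mix \<nu> a - bessel_mix \<nu> b\<bar> \<le> bessel_mix (\<nu> + 1/2) 0 * \<bar>a - b\<bar>"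
        using *[of a b] *[of b a] that by (cases "a \<le> b") (auto simp: abs_minus_commute)
      then show ?thesis by (simp only: norm_of_real flip: of_real_diff)
    qed
  qed
  show "bessel_mix \<nu> Z > 0" using assms by (intro bessel_mix_pos) auto
  show "norm (complex_of_real (bessel_mix \<nu> z)) \<ge> bessel_mix \<nu> Z" if "z \<in> {0<..Z}" for z
    using that bessel_mix_antimono[of z Z \<nu>] by (auto simp: bessel_mix_nonneg)
qed

text \<open>For positive order the reflection formula writes the reciprocal as z^(2\<nu>) times the
  reciprocal of negative order, and 2\<nu> > 1 makes the power Lipschitz up to 0.\<close>

lemma bdd_lipschitz_on_inverse_bessel_mix:
  assumes "\<bar>\<nu>\<bar> > 1 / 2" "Z > 0"
  shows "bdd_lipschitz_on {0<..Z} (\<lambda>z. inverse (of_real (bessel_mix \<nu> z)))"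
proof (cases "\<nu> < 0")
  case True
  then show ?thesis using assms by (intro bdd_lipschitz_on_inverse_bessel_mix_neg) auto
next
  case False
  have "bdd_lipschitz_on {0<..Z} (\<lambda>z. of_real (z powr (2 * \<nu>)) * inverse (of_real (bessel_mix (- \<nu>) z)))"
    using assms False
    by (intro bdd_lipschitz_on_mult bdd_lipschitz_on_powr bdd_lipschitz_on_inverse_bessel_mix_neg) auto
  moreover have "inverse (complex_of_real (bessel_mix \<nu> z))
      = of_real (z powr (2 * \<nu>)) * inverse (of_real (bessel_mix (- \<nu>) z))" if "z \<in> {0<..Z}" for z
    using that by (subst bessel_mix_minus) (auto simp: powr_minus)
  ultimately show ?thesis by (subst bdd_lipschitz_on_cong) auto
qed

subsection \<open>The symbol of the cardinal interpolation operator\<close>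

lemma infsum_int_shift:
  fixes f :: "int \<Rightarrow> 'b :: {comm_monoid_add, t2_space}"
  shows "(\<Sum>\<^sub>\<infinity>k. f (k + m)) = (\<Sum>\<^sub>\<infinity>k. f k)"
  by (rule infsum_reindex_bij_betw) (auto intro!: bij_betwI[where g = "\<lambda>k. k - m"])

lemma abs_shift_ge:
  fixes k :: int
  assumes "k \<noteq> 0" "\<bar>t\<bar> \<le> pi"
  shows "pi * \<bar>of_int k\<bar> \<le> \<bar>t + 2 * pi * of_int k\<bar>" "pi \<le> pi * \<bar>real_of_int k\<bar>"
proof -
  have "1 \<le> \<bar>real_of_int k\<bar>" using assms(1) by linarith
  then show *: "pi \<le> pi * \<bar>real_of_int k\<bar>" by simp
  have "\<bar>2 * pi * real_of_int k\<bar> \<le> \<bar>t + 2 * pi * of_int k\<bar> + \<bar>t\<bar>" by linarith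
  then show "pi * \<bar>of_int k\<bar> \<le> \<bar>t + 2 * pi * of_int k\<bar>"
    using assms(2) * unfolding abs_mult by (simp only: abs_numeral abs_of_pos[OF pi_gt_zero])
qed

lemma infsum_complex_of_real:
  "f summable_on A \<Longrightarrow> (\<Sum>\<^sub>\<infinity>x\<in>A. complex_of_real (f x)) = of_real (infsum f A)"
  by (intro infsumI has_sum_of_real has_sum_infsum)

locale multiquadric_symbol =
  fixes \<nu> c :: real
  assumes \<nu>: "\<bar>\<nu>\<bar> > 1 / 2" and c: "c > 0"
begin

text \<open>Off 0 this is \<open>phi_hat\<close> up to a constant factor. For \<nu> > 0 its value at
  0 is the default 0 of a divergent integral, which alters \<open>symbol\<close> only on the
  lattice.\<close>

definition h :: "real \<Rightarrow> real" where
  "h \<xi> = bessel_mix \<nu> (c * \<bar>\<xi>\<bar>)"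

definition h_sum :: "real \<Rightarrow> real" where
  "h_sum \<xi> = (\<Sum>\<^sub>\<infinity>k::int. h (\<xi> + 2 * pi * of_int k))"

definition symbol :: "real \<Rightarrow> real" where
  "symbol \<xi> = h \<xi> / h_sum \<xi>"

text \<open>The periodization of \<open>symbol\<close> times the character of frequency x. As a
  function of t it is what interpolation makes of the exponential exp(ixt).\<close>

definition twisted_sum :: "real \<Rightarrow> real \<Rightarrow> complex" where
  "twisted_sum x t = (\<Sum>\<^sub>\<infinity>k::int. of_real (symbol (t + 2 * pi * of_int k)) * cis (x * (t + 2 * pi * of_int k)))"

lemma h_nonneg: "h \<xi> \<ge> 0"
  by (simp add: h_def bessel_mix_nonneg)

lemma h_pos: "\<xi> \<noteq> 0 \<Longrightarrow> h \<xi> > 0"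
  unfolding h_def using c by (intro bessel_mix_pos) auto

lemma h_measurable [measurable]: "h \<in> borel_measurable borel"
  unfolding h_def[abs_def] by measurable

lemma h_antimono:
  assumes "0 < \<bar>\<xi>\<bar>" "\<bar>\<xi>\<bar> \<le> \<bar>\<eta>\<bar>"
  shows "h \<eta> \<le> h \<xi>"
  unfolding h_def using assms c by (intro bessel_mix_antimono) auto

text \<open>The available rate c/2 is weakened to c/4, the rate at which differences of
  \<open>h\<close> decay below, so that one majorant serves both.\<close>

lemma h_le_exp:
  obtains D where "D > 0" "\<And>\<xi>. \<bar>\<xi>\<bar> \<ge> pi \<Longrightarrow> h \<xi> \<le> D * exp (- (c / 4) * \<bar>\<xi>\<bar>)"
proof -
  obtain D where D: "D > 0" "\<And>z. z \<ge> c * pi \<Longrightarrow> bessel_mix \<nu> z \<le> D * exp (- z / 2)"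
    using bessel_mix_le_exp[of "c * pi" \<nu>] c by auto
  have "h \<xi> \<le> D * exp (- (c / 4) * \<bar>\<xi>\<bar>)" if "\<bar>\<xi>\<bar> \<ge> pi" for \<xi>
  proof -
    have "h \<xi> \<le> D * exp (- (c * \<bar>\<xi>\<bar>) / 2)" unfolding h_def using that c by (intro D(2)) auto
    also have "\<dots> \<le> D * exp (- (c / 4) * \<bar>\<xi>\<bar>)" using D(1) c by simp
    finally show ?thesis .
  qed
  then show ?thesis using that D(1) by blast
qed

text \<open>The parameter r records the distance from 0; with r = pi |k| the constants become
  summable over the translates. Steps of length at most 2 pi keep the larger argument within three
  times the smaller, since c * 2 pi \<le> 2 a, so b + a is at most 4 a.\<close>

lemma h_lipschitz:
  obtains E where "E > 0" "\<And>\<xi> \<eta> r. r \<ge> pi \<Longrightarrow> \<bar>\<xi>\<bar> \<ge> r \<Longrightarrow> \<bar>\<eta>\<bar> \<ge> r \<Longrightarrow> \<bar>\<xi> - \<eta>\<bar> \<le> 2 * pi \<Longrightarrow>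
    \<bar>h \<xi> - h \<eta>\<bar> \<le> E * exp (- (c / 4) * r) * \<bar>\<xi> - \<eta>\<bar>"
proof -
  obtain D where D: "D > 0" "\<And>z. z \<ge> c * pi \<Longrightarrow> z * bessel_mix (\<nu> + 1) z \<le> D * exp (- z / 4)"
    using mult_bessel_mix_le_exp[of "c * pi" "\<nu> + 1"] c by auto
  have *: "\<bar>h \<xi> - h \<eta>\<bar> \<le> (2 * D * c) * exp (- (c / 4) * r) * \<bar>\<xi> - \<eta>\<bar>"
    if r: "r \<ge> pi" "\<bar>\<xi>\<bar> \<ge> r" "\<bar>\<xi> - \<eta>\<bar> \<le> 2 * pi" and le: "\<bar>\<xi>\<bar> \<le> \<bar>\<eta>\<bar>" for \<xi> \<eta> r
  proof -
    define a b where "a = c * \<bar>\<xi>\<bar>" and "b = c * \<bar>\<eta>\<bar>"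
    have a: "a \<ge> c * r" "a \<ge> c * pi" using c r by (auto simp: a_def)
    have "a > 0" using r c pi_gt_zero unfolding a_def by (intro mult_pos_pos) linarith+
    have ab: "a \<le> b" using le c by (simp add: a_def b_def)
    have ba: "b - a \<le> c * \<bar>\<xi> - \<eta>\<bar>"
    proof -
      have "c * (\<bar>\<eta>\<bar> - \<bar>\<xi>\<bar>) \<le> c * \<bar>\<xi> - \<eta>\<bar>" using c by (intro mult_left_mono) linarith+
      then show ?thesis by (simp add: a_def b_def right_diff_distrib)
    qed
    have "c * \<bar>\<xi> - \<eta>\<bar> \<le> c * (2 * pi)" using c r by (intro mult_left_mono) auto
    then have b3: "b \<le> 3 * a" using ba a by simp
    have "0 \<le> h \<xi> - h \<eta>" using h_antimono[of \<xi> \<eta>] le r pi_gt_zero by linarith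
    then have "\<bar>h \<xi> - h \<eta>\<bar> = bessel_mix \<nu> a - bessel_mix \<nu> b" by (simp add: h_def a_def b_def)
    also have "\<dots> \<le> (b\<^sup>2 - a\<^sup>2) / 2 * bessel_mix (\<nu> + 1) a"
      by (rule bessel_mix_diff_le) fact+
    also have "\<dots> = (b - a) * ((b + a) / 2 * bessel_mix (\<nu> + 1) a)"
      by (simp add: power2_eq_square algebra_simps)
    also have "\<dots> \<le> (b - a) * (2 * a * bessel_mix (\<nu> + 1) a)"
      using ab b3 by (intro mult_left_mono mult_right_mono) (auto simp: bessel_mix_nonneg)
    also have "\<dots> \<le> (b - a) * (2 * (D * exp (- a / 4)))"
      using ab D(2)[OF a(2)] by (intro mult_left_mono) auto
    also have "\<dots> \<le> (b - a) * (2 * (D * exp (- (c / 4) * r)))"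
      using ab D a by (intro mult_left_mono) auto
    also have "\<dots> \<le> (c * \<bar>\<xi> - \<eta>\<bar>) * (2 * (D * exp (- (c / 4) * r)))"
      using ba D by (intro mult_right_mono) auto
    finally show ?thesis by (simp add: mult_ac)
  qed
  show ?thesis
  proof (rule that[of "2 * D * c"])
    show "2 * D * c > 0" using D c by simp
    fix \<xi> \<eta> r assume "r \<ge> pi" "\<bar>\<xi>\<bar> \<ge> r" "\<bar>\<eta>\<bar> \<ge> r" "\<bar>\<xi> - \<eta>\<bar> \<le> 2 * pi"
    then show "\<bar>h \<xi> - h \<eta>\<bar> \<le> (2 * D * c) * exp (- (c / 4) * r) * \<bar>\<xi> - \<eta>\<bar>"
      using *[of r \<xi> \<eta>] *[of r \<eta> \<xi>] by (cases "\<bar>\<xi>\<bar> \<le> \<bar>\<eta>\<bar>") (auto simp: abs_minus_commute)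
  qed
qed

text \<open>Exponential decay is available only at distance pi or more from 0; the finitely many
  translates closer to 0 are split off.\<close>

lemma summable_on_h: "(\<lambda>k::int. h (\<xi> + 2 * pi * of_int k)) summable_on A"
proof -
  obtain D where D: "D > 0" "\<And>\<xi>. \<bar>\<xi>\<bar> \<ge> pi \<Longrightarrow> h \<xi> \<le> D * exp (- (c / 4) * \<bar>\<xi>\<bar>)"
    using h_le_exp by blast
  let ?B = "{k::int. \<bar>\<xi> + 2 * pi * of_int k\<bar> < pi}"
  have "?B \<subseteq> {- \<lceil>\<bar>\<xi>\<bar>\<rceil> - 1 .. \<lceil>\<bar>\<xi>\<bar>\<rceil> + 1}"
  proof
    fix k :: int assume "k \<in> ?B"
    then have "\<bar>\<xi> + 2 * pi * of_int k\<bar> < pi" by simp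
    then have "\<bar>2 * pi * of_int k\<bar> < \<bar>\<xi>\<bar> + pi" by linarith
    then have "pi * (2 * \<bar>of_int k\<bar>) < \<bar>\<xi>\<bar> + pi" by (simp add: abs_mult mult_ac)
    moreover have "\<bar>\<xi>\<bar> \<le> pi * \<bar>\<xi>\<bar>" using pi_gt3 by (simp add: mult_le_cancel_right1)
    ultimately have "pi * (2 * \<bar>of_int k\<bar>) < pi * (\<bar>\<xi>\<bar> + 1)" by (simp add: distrib_left)
    then have "2 * \<bar>real_of_int k\<bar> < \<bar>\<xi>\<bar> + 1" by (simp only: mult_less_cancel_left_pos[OF pi_gt_zero])
    then have "real_of_int \<bar>k\<bar> \<le> of_int (\<lceil>\<bar>\<xi>\<bar>\<rceil> + 1)" by linarith
    then have "\<bar>k\<bar> \<le> \<lceil>\<bar>\<xi>\<bar>\<rceil> + 1" by (simp only: of_int_le_iff)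
    then show "k \<in> {- \<lceil>\<bar>\<xi>\<bar>\<rceil> - 1 .. \<lceil>\<bar>\<xi>\<bar>\<rceil> + 1}" by auto
  qed
  then have "finite ?B" by (rule finite_subset) simp
  moreover have "(\<lambda>k::int. h (\<xi> + 2 * pi * of_int k)) summable_on (- ?B)"
  proof (rule abs_summable_on_comparison(2))
    show "(\<lambda>k::int. D * exp (c / 4 * \<bar>\<xi>\<bar>) * exp (- (2 * pi * (c / 4)) * \<bar>of_int k\<bar>)) summable_on (- ?B)"
      using c by (intro summable_on_cmult_right summable_on_subset[OF summable_on_int_exp]) auto
    fix k :: int assume "k \<in> - ?B"
    then have "h (\<xi> + 2 * pi * of_int k) \<le> D * exp (- (c / 4) * \<bar>\<xi> + 2 * pi * of_int k\<bar>)"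
      by (intro D(2)) auto
    also have "\<dots> \<le> D * (exp (c / 4 * \<bar>\<xi>\<bar>) * exp (- (2 * pi * (c / 4)) * \<bar>of_int k\<bar>))"
      using D(1) c by (intro mult_left_mono exp_decay_shift) auto
    finally show "norm (h (\<xi> + 2 * pi * of_int k)) \<le> D * exp (c / 4 * \<bar>\<xi>\<bar>) * exp (- (2 * pi * (c / 4)) * \<bar>of_int k\<bar>)"
      using h_nonneg by (simp add: mult.assoc)
  qed
  ultimately have "(\<lambda>k::int. h (\<xi> + 2 * pi * of_int k)) summable_on (?B \<union> - ?B)"
    by (intro summable_on_union) auto
  then show ?thesis by (rule summable_on_subset) auto
qed

lemma h_sum_periodic: "h_sum (\<xi> + 2 * pi * of_int m) = h_sum \<xi>"
  unfolding h_sum_def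
  using infsum_int_shift[of "\<lambda>k. h (\<xi> + 2 * pi * of_int k)" m] by (simp add: algebra_simps)

lemma h_le_h_sum: "h (\<xi> + 2 * pi * of_int k) \<le> h_sum \<xi>"
  using finite_sum_le_infsum[OF summable_on_h[of \<xi> UNIV], of "{k}"] h_nonneg
  by (simp add: h_sum_def)

text \<open>Some translate of \<xi> falls into [pi, 3 pi], a full period that stays away from 0, and
  there \<open>h\<close> is at least its value at 3 pi.\<close>

lemma h_sum_lower_bound: "bessel_mix \<nu> (c * (3 * pi)) \<le> h_sum \<xi>" "bessel_mix \<nu> (c * (3 * pi)) > 0"
proof -
  define k where "k = \<lceil>(pi - \<xi>) / (2 * pi)\<rceil>"
  have "(pi - \<xi>) / (2 * pi) \<le> of_int k" "of_int k < (pi - \<xi>) / (2 * pi) + 1"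
    unfolding k_def by linarith+
  then have k: "pi \<le> \<xi> + 2 * pi * of_int k" "\<xi> + 2 * pi * of_int k \<le> 3 * pi"
    by (auto simp: field_simps)
  then have "0 < \<bar>\<xi> + 2 * pi * of_int k\<bar>" "\<bar>\<xi> + 2 * pi * of_int k\<bar> \<le> \<bar>3 * pi\<bar>"
    using pi_gt_zero by linarith+
  then have "h (3 * pi) \<le> h (\<xi> + 2 * pi * of_int k)"
    by (rule h_antimono)
  then show "bessel_mix \<nu> (c * (3 * pi)) \<le> h_sum \<xi>"
    using h_le_h_sum[of \<xi> k] by (simp add: h_def)
  show "bessel_mix \<nu> (c * (3 * pi)) > 0" using c by (intro bessel_mix_pos) auto
qed

lemma h_sum_pos: "h_sum \<xi> > 0"
  using h_sum_lower_bound(1)[of \<xi>] h_sum_lower_bound(2) by linarith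

lemma symbol_nonneg: "symbol \<xi> \<ge> 0"
  using h_nonneg h_sum_pos[of \<xi>] by (simp add: symbol_def)

lemma symbol_shift: "symbol (\<xi> + 2 * pi * of_int k) = h (\<xi> + 2 * pi * of_int k) / h_sum \<xi>"
  by (simp add: symbol_def h_sum_periodic)

lemma symbol_measurable [measurable]: "symbol \<in> borel_measurable borel"
proof -
  have "h_sum \<in> borel_measurable borel"
    unfolding h_sum_def[abs_def] by (intro borel_measurable_infsum_int summable_on_h) measurable
  then show ?thesis unfolding symbol_def[abs_def] by measurable
qed

lemma has_sum_symbol: "((\<lambda>k::int. symbol (\<xi> + 2 * pi * of_int k)) has_sum 1) UNIV"
proof -
  have "((\<lambda>k::int. h (\<xi> + 2 * pi * of_int k)) has_sum h_sum \<xi>) UNIV"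
    unfolding h_sum_def by (rule has_sum_infsum) (rule summable_on_h)
  from has_sum_divide_const[OF this, of "h_sum \<xi>"] show ?thesis
    using h_sum_pos[of \<xi>] by (simp add: symbol_shift)
qed

lemma symbol_le_exp:
  obtains D where "D > 0" "\<And>\<xi>. symbol \<xi> \<le> D * exp (- (c / 4) * \<bar>\<xi>\<bar>)"
proof -
  obtain D where D: "D > 0" "\<And>\<xi>. \<bar>\<xi>\<bar> \<ge> pi \<Longrightarrow> h \<xi> \<le> D * exp (- (c / 4) * \<bar>\<xi>\<bar>)"
    using h_le_exp by blast
  define m where "m = bessel_mix \<nu> (c * (3 * pi))"
  have m: "m > 0" "m \<le> h_sum \<xi>" for \<xi> using h_sum_lower_bound(1)[of \<xi>] h_sum_lower_bound(2) by (auto simp: m_def)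
  have "symbol \<xi> \<le> (D / m + exp (c / 4 * pi)) * exp (- (c / 4) * \<bar>\<xi>\<bar>)" for \<xi>
  proof (cases "\<bar>\<xi>\<bar> \<ge> pi")
    case True
    have "symbol \<xi> \<le> (D * exp (- (c / 4) * \<bar>\<xi>\<bar>)) / m"
      unfolding symbol_def using D(2)[OF True] m h_nonneg D(1) by (intro frac_le) auto
    also have "\<dots> \<le> (D / m + exp (c / 4 * pi)) * exp (- (c / 4) * \<bar>\<xi>\<bar>)"
      by (simp add: field_simps)
    finally show ?thesis .
  next
    case False
    have "symbol \<xi> \<le> 1" using h_le_h_sum[of \<xi> 0] h_sum_pos[of \<xi>] by (simp add: symbol_def)
    also have "1 \<le> exp (c / 4 * pi - c / 4 * \<bar>\<xi>\<bar>)" using False c by simp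
    also have "\<dots> = exp (c / 4 * pi) * exp (- (c / 4) * \<bar>\<xi>\<bar>)" by (simp flip: exp_add)
    also have "\<dots> \<le> (D / m + exp (c / 4 * pi)) * exp (- (c / 4) * \<bar>\<xi>\<bar>)"
      using D m by (intro mult_right_mono) auto
    finally show ?thesis .
  qed
  moreover have "D / m + exp (c / 4 * pi) > 0" using D m by (intro add_pos_pos) auto
  ultimately show ?thesis using that by blast
qed

text \<open>
  Cancelling \<open>h t\<close> turns the quotient into one whose denominator is at least 1 and in which all
  ingredients remain Lipschitz at \<open>0\<close>, where \<open>h\<close> itself may blow up.
\<close>

lemma bdd_lipschitz_on_twisted_sum: "bdd_lipschitz_on ({-pi..pi} - {0}) (twisted_sum x)"
proof -
  let ?X = "{-pi..pi} - {0 :: real}"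
  define T where "T x t = (\<Sum>\<^sub>\<infinity>k\<in>UNIV - {0::int}. of_real (h (t + 2 * pi * of_int k)) * cis (x * (t + 2 * pi * of_int k)))" for x t
  define R where "R t = inverse (complex_of_real (h t))" for t
  obtain D where D: "D > 0" "\<And>\<xi>. \<bar>\<xi>\<bar> \<ge> pi \<Longrightarrow> h \<xi> \<le> D * exp (- (c / 4) * \<bar>\<xi>\<bar>)"
    using h_le_exp by blast
  obtain E where E: "E > 0" "\<And>\<xi> \<eta> r. r \<ge> pi \<Longrightarrow> \<bar>\<xi>\<bar> \<ge> r \<Longrightarrow> \<bar>\<eta>\<bar> \<ge> r \<Longrightarrow> \<bar>\<xi> - \<eta>\<bar> \<le> 2 * pi \<Longrightarrow>
    \<bar>h \<xi> - h \<eta>\<bar> \<le> E * exp (- (c / 4) * r) * \<bar>\<xi> - \<eta>\<bar>"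
    using h_lipschitz by blast
  \<comment> \<open>\<open>D\<close> bounds the values of the k-th term, D|x| accounts for the
    variation of the character and \<open>E\<close> for that of \<open>h\<close>; the exponential is
    the decay at distance pi |k|.\<close>
  define b where "b x k = (D * (1 + \<bar>x\<bar>) + E) * exp (- (c / 4 * pi) * \<bar>of_int k\<bar>)" for x and k :: int
  have T: "bdd_lipschitz_on ?X (T x)" for x
    unfolding T_def[abs_def]
  proof (rule bdd_lipschitz_on_infsum)
    show "b x summable_on UNIV - {0}"
      unfolding b_def using c by (intro summable_on_cmult_right summable_on_subset[OF summable_on_int_exp]) auto
    fix k :: int assume "k \<in> UNIV - {0}"
    then have k: "k \<noteq> 0" by simp
    let ?r = "pi * \<bar>real_of_int k\<bar>" and ?e = "exp (- (c / 4 * pi) * \<bar>of_int k\<bar>)"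
    have hb: "h (t + 2 * pi * of_int k) \<le> D * ?e" if "t \<in> ?X" for t
    proof -
      have t: "\<bar>t\<bar> \<le> pi" using that by auto
      have "h (t + 2 * pi * of_int k) \<le> D * exp (- (c / 4) * \<bar>t + 2 * pi * of_int k\<bar>)"
        using abs_shift_ge[OF k t] by (intro D(2)) linarith
      also have "\<dots> \<le> D * ?e"
        using abs_shift_ge[OF k t] D(1) c by (simp add: mult.assoc)
      finally show ?thesis .
    qed
    show "norm (of_real (h (t + 2 * pi * of_int k)) * cis (x * (t + 2 * pi * of_int k))) \<le> b x k" if "t \<in> ?X" for t
    proof -
      have "D * ?e \<le> b x k" unfolding b_def using D E by (intro mult_right_mono) (auto simp: algebra_simps)
      then show ?thesis using hb[OF that] h_nonneg by (simp add: norm_mult)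
    qed
    show "norm (of_real (h (t + 2 * pi * of_int k)) * cis (x * (t + 2 * pi * of_int k))
        - of_real (h (s + 2 * pi * of_int k)) * cis (x * (s + 2 * pi * of_int k))) \<le> b x k * \<bar>t - s\<bar>"
      if "t \<in> ?X" "s \<in> ?X" for t s
    proof -
      have ts: "\<bar>t\<bar> \<le> pi" "\<bar>s\<bar> \<le> pi" using that by auto
      let ?\<xi> = "t + 2 * pi * of_int k" and ?\<eta> = "s + 2 * pi * of_int k"
      have "of_real (h ?\<xi>) * cis (x * ?\<xi>) - of_real (h ?\<eta>) * cis (x * ?\<eta>)
          = of_real (h ?\<xi>) * (cis (x * ?\<xi>) - cis (x * ?\<eta>)) + of_real (h ?\<xi> - h ?\<eta>) * cis (x * ?\<eta>)"
        by (simp add: algebra_simps)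
      also have "norm \<dots> \<le> h ?\<xi> * norm (cis (x * ?\<xi>) - cis (x * ?\<eta>)) + \<bar>h ?\<xi> - h ?\<eta>\<bar>"
        by (rule order_trans[OF norm_triangle_ineq]) (simp add: norm_mult h_nonneg del: of_real_diff)
      also have "\<dots> \<le> (D * ?e) * (\<bar>x\<bar> * \<bar>t - s\<bar>) + E * ?e * \<bar>t - s\<bar>"
      proof (intro add_mono mult_mono)
        show "norm (cis (x * ?\<xi>) - cis (x * ?\<eta>)) \<le> \<bar>x\<bar> * \<bar>t - s\<bar>"
          using norm_cis_diff_le[of "x * ?\<xi>" "x * ?\<eta>"] by (simp flip: abs_mult right_diff_distrib)
        show "\<bar>h ?\<xi> - h ?\<eta>\<bar> \<le> E * ?e * \<bar>t - s\<bar>"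
          using E(2)[of ?r ?\<xi> ?\<eta>] abs_shift_ge[OF k ts(1)] abs_shift_ge[OF k ts(2)] ts
          by (simp add: mult.assoc)
      qed (use hb[OF that(1)] D in auto)
      also have "\<dots> \<le> b x k * \<bar>t - s\<bar>"
        using D by (simp add: b_def algebra_simps)
      finally show ?thesis .
    qed
  qed
  have R: "bdd_lipschitz_on ?X R"
  proof -
    have "bdd_lipschitz_on ?X (\<lambda>t. inverse (of_real (bessel_mix \<nu> (c * \<bar>t\<bar>))))"
    proof (rule bdd_lipschitz_on_compose[where g = "\<lambda>t. c * \<bar>t\<bar>" and L = c])
      show "bdd_lipschitz_on {0<..c * pi} (\<lambda>z. inverse (of_real (bessel_mix \<nu> z)))"
        using \<nu> c by (intro bdd_lipschitz_on_inverse_bessel_mix) auto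
      show "\<bar>c * \<bar>t\<bar> - c * \<bar>s\<bar>\<bar> \<le> c * \<bar>t - s\<bar>" for t s
      proof -
        have "c * \<bar>\<bar>t\<bar> - \<bar>s\<bar>\<bar> \<le> c * \<bar>t - s\<bar>" using c by (intro mult_left_mono) linarith+
        then show ?thesis using c by (simp add: abs_mult flip: right_diff_distrib)
      qed
    qed (use c in auto)
    then show ?thesis by (simp add: R_def[abs_def] h_def)
  qed
  \<comment> \<open>Numerator and denominator of the quotient are both multiplied by 1 / h t. At x =
    0 the tail \<open>T\<close> is a nonnegative real number, hence the lower bound 1.\<close>
  have eq: "twisted_sum x t = (cis (x * t) + R t * T x t) * inverse (1 + R t * T 0 t)"
    and ge: "norm (1 + R t * T 0 t) \<ge> 1" if "t \<in> ?X" for t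
  proof -
    have "h t > 0" using that by (intro h_pos) auto
    have split: "(\<Sum>\<^sub>\<infinity>k::int. of_real (h (t + 2 * pi * of_int k)) * cis (y * (t + 2 * pi * of_int k)))
        = of_real (h t) * cis (y * t) + T y t" for y
    proof -
      have S: "(\<lambda>k::int. of_real (h (t + 2 * pi * of_int k)) * cis (y * (t + 2 * pi * of_int k))) summable_on A" for A
        by (rule abs_summable_on_comparison(2)[OF summable_on_h[of t]]) (simp add: norm_mult h_nonneg)
      have "(\<Sum>\<^sub>\<infinity>k\<in>insert 0 (UNIV - {0::int}). of_real (h (t + 2 * pi * of_int k)) * cis (y * (t + 2 * pi * of_int k)))
          = of_real (h t) * cis (y * t) + T y t"
        unfolding T_def by (subst infsum_insert) (use S in auto)
      then show ?thesis by (simp add: insert_UNIV)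
    qed
    have T0: "T 0 t = of_real (\<Sum>\<^sub>\<infinity>k\<in>UNIV - {0::int}. h (t + 2 * pi * of_int k))"
      unfolding T_def by (simp add: infsum_complex_of_real summable_on_h)
    have hs: "complex_of_real (h_sum t) = of_real (h t) + T 0 t"
      using split[of 0] unfolding h_sum_def by (simp add: infsum_complex_of_real summable_on_h)
    have "twisted_sum x t = (\<Sum>\<^sub>\<infinity>k::int. inverse (of_real (h_sum t)) * (of_real (h (t + 2 * pi * of_int k)) * cis (x * (t + 2 * pi * of_int k))))"
      unfolding twisted_sum_def symbol_shift by (simp add: divide_inverse mult_ac)
    also have "\<dots> = inverse (of_real (h_sum t)) * (of_real (h t) * cis (x * t) + T x t)"
      by (simp only: infsum_cmult_right' split)
    also have "\<dots> = (cis (x * t) + R t * T x t) * inverse (1 + R t * T 0 t)"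
    proof -
      have "1 + R t * T 0 t = R t * of_real (h_sum t)" "cis (x * t) + R t * T x t = R t * (of_real (h t) * cis (x * t) + T x t)"
        unfolding hs R_def using \<open>h t > 0\<close> by (simp_all add: field_simps)
      then show ?thesis using \<open>h t > 0\<close> by (simp add: R_def)
    qed
    finally show "twisted_sum x t = (cis (x * t) + R t * T x t) * inverse (1 + R t * T 0 t)" .
    have "1 + R t * T 0 t = of_real (1 + (\<Sum>\<^sub>\<infinity>k\<in>UNIV - {0::int}. h (t + 2 * pi * of_int k)) / h t)"
      unfolding T0 R_def by (simp add: field_simps)
    moreover have "(\<Sum>\<^sub>\<infinity>k\<in>UNIV - {0::int}. h (t + 2 * pi * of_int k)) / h t \<ge> 0"
      by (intro divide_nonneg_nonneg infsum_nonneg h_nonneg)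
    ultimately show "norm (1 + R t * T 0 t) \<ge> 1" by (simp del: of_real_add)
  qed
  have "bdd_lipschitz_on ?X (\<lambda>t. (cis (x * t) + R t * T x t) * inverse (1 + R t * T 0 t))"
    using ge by (intro bdd_lipschitz_on_mult bdd_lipschitz_on_add bdd_lipschitz_on_cis R T
        bdd_lipschitz_on_inverse[of _ _ 1] bdd_lipschitz_on_const) auto
  then show ?thesis using eq by (subst bdd_lipschitz_on_cong) auto
qed

end

subsection \<open>Poisson summation for the fundamental function\<close>

text \<open>The exceptional set of the Poisson formula: off it no translate of the argument is 0,
  and \<open>L_hat\<close> is a literal quotient.\<close>

definition period_lattice :: "real set" where
  "period_lattice = range (\<lambda>k::int. 2 * pi * of_int k)"

lemma countable_period_lattice: "countable period_lattice"
  unfolding period_lattice_def by simp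

lemma period_lattice_shift_iff: "t + 2 * pi * of_int m \<in> period_lattice \<longleftrightarrow> t \<in> period_lattice"
proof -
  have "t + 2 * pi * of_int m \<in> period_lattice" if t: "t \<in> period_lattice" for t and m :: int
  proof -
    obtain k :: int where "t = 2 * pi * of_int k" using t by (auto simp: period_lattice_def)
    then have "t + 2 * pi * of_int m = 2 * pi * of_int (k + m)" by (simp add: algebra_simps)
    then show ?thesis unfolding period_lattice_def by blast
  qed
  from this[of t m] this[of "t + 2 * pi * of_int m" "- m"] show ?thesis by auto
qed

lemma zero_in_period_lattice: "0 \<in> period_lattice"
  unfolding period_lattice_def by (auto intro: image_eqI[of _ _ 0])

lemma period_lattice_small: "t \<in> period_lattice \<Longrightarrow> \<bar>t\<bar> \<le> pi \<Longrightarrow> t = 0"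
proof -
  assume t: "t \<in> period_lattice" "\<bar>t\<bar> \<le> pi"
  obtain k :: int where k: "t = 2 * pi * of_int k" using t(1) by (auto simp: period_lattice_def)
  have "k = 0"
  proof (rule ccontr)
    assume "k \<noteq> 0"
    then have "2 * pi \<le> 2 * pi * \<bar>real_of_int k\<bar>" by simp
    also have "\<dots> = \<bar>t\<bar>" by (simp add: k abs_mult)
    finally show False using t(2) pi_gt_zero by linarith
  qed
  then show ?thesis by (simp add: k)
qed

lemma exists_shift_into_period:
  obtains m :: int where "t + 2 * pi * of_int m \<in> {-pi..<pi}"
proof
  define k where "k = \<lfloor>(t + pi) / (2 * pi)\<rfloor>"
  have "of_int k \<le> (t + pi) / (2 * pi)" "(t + pi) / (2 * pi) < of_int k + 1"
    unfolding k_def by linarith+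
  then show "t + 2 * pi * of_int (- k) \<in> {-pi..<pi}"
    by (auto simp: field_simps)
qed

context multiquadric_symbol
begin

lemma twisted_sum_periodic: "twisted_sum x (t + 2 * pi * of_int m) = twisted_sum x t"
  unfolding twisted_sum_def
  using infsum_int_shift[of "\<lambda>k. of_real (symbol (t + 2 * pi * of_int k)) * cis (x * (t + 2 * pi * of_int k))" m]
  by (simp add: algebra_simps)

text \<open>After a shift the starting point lies in one period. As |d| \<le> pi, the step crosses
  at most one end of it; it is then broken at pi or -pi, where the values agree by periodicity, and
  the two lengths add up to |d|. Crossing 0 costs nothing, since the one-period estimate already
  compares its two sides.\<close>

lemma twisted_sum_lipschitz:
  obtains C where "\<And>t d. t \<notin> period_lattice \<Longrightarrow> t + d \<notin> period_lattice \<Longrightarrow> \<bar>d\<bar> \<le> pi \<Longrightarrow>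
    norm (twisted_sum x (t + d) - twisted_sum x t) \<le> C * \<bar>d\<bar>"
proof -
  obtain B where B: "B \<ge> 0" "\<And>t s. t \<in> {-pi..pi} - {0} \<Longrightarrow> s \<in> {-pi..pi} - {0} \<Longrightarrow>
      norm (twisted_sum x t - twisted_sum x s) \<le> B * \<bar>t - s\<bar>"
    using bdd_lipschitz_on_twisted_sum[of x] by (metis bdd_lipschitz_onE)
  have ends: "twisted_sum x (- pi) = twisted_sum x pi"
    using twisted_sum_periodic[of x "- pi" 1] by simp
  have "norm (twisted_sum x (t + d) - twisted_sum x t) \<le> B * \<bar>d\<bar>"
    if t: "t \<notin> period_lattice" "t + d \<notin> period_lattice" "\<bar>d\<bar> \<le> pi" for t d
  proof -
    obtain m :: int where m: "t + 2 * pi * of_int m \<in> {-pi..<pi}" by (rule exists_shift_into_period)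
    define s where "s = t + 2 * pi * of_int m"
    have sd: "s + d = (t + d) + 2 * pi * of_int m" by (simp add: s_def)
    have s: "s \<in> {-pi..<pi}" "s \<noteq> 0"
      using m t(1) period_lattice_shift_iff[of t m] zero_in_period_lattice by (auto simp: s_def)
    have nz: "s + d + 2 * pi * of_int k \<noteq> 0" for k :: int
      using t(2) period_lattice_shift_iff[of "t + d" m] period_lattice_shift_iff[of "s + d" k] zero_in_period_lattice
      unfolding sd by metis
    have eq: "twisted_sum x t = twisted_sum x s" "twisted_sum x (t + d) = twisted_sum x (s + d)"
      unfolding sd by (simp_all only: s_def twisted_sum_periodic)
    consider "\<bar>s + d\<bar> \<le> pi" | "s + d > pi" | "s + d < - pi" by linarith
    then show ?thesis
    proof cases
      case 1
      have "s + d \<noteq> 0" using nz[of 0] by simp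
      then have "s + d \<in> {-pi..pi} - {0}" "s \<in> {-pi..pi} - {0}"
        using 1 s unfolding abs_le_iff by simp_all
      from B(2)[OF this] show ?thesis unfolding eq by simp
    next
      case 2
      then have r: "s + d + 2 * pi * of_int (- 1) \<in> {-pi..pi} - {0}"
        using s t(3) nz[of "-1"] by auto
      have "twisted_sum x (s + d) - twisted_sum x s
          = (twisted_sum x (s + d + 2 * pi * of_int (- 1)) - twisted_sum x (- pi)) + (twisted_sum x pi - twisted_sum x s)"
        by (simp only: twisted_sum_periodic ends) simp
      also have "norm \<dots> \<le> B * \<bar>s + d + 2 * pi * of_int (- 1) - (- pi)\<bar> + B * \<bar>pi - s\<bar>"
        using r s by (intro order_trans[OF norm_triangle_ineq] add_mono B(2)) auto
      also have "\<dots> = B * \<bar>d\<bar>"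
      proof -
        have "\<bar>s + d + 2 * pi * of_int (- 1) - (- pi)\<bar> = s + d - pi" "\<bar>pi - s\<bar> = pi - s" "\<bar>d\<bar> = d"
          using 2 s(1) t(3) by auto
        then show ?thesis by (simp add: algebra_simps)
      qed
      finally show ?thesis unfolding eq .
    next
      case 3
      then have r: "s + d + 2 * pi * of_int 1 \<in> {-pi..pi} - {0}"
        using s t(3) nz[of 1] by auto
      have "twisted_sum x (s + d) - twisted_sum x s
          = (twisted_sum x (s + d + 2 * pi * of_int 1) - twisted_sum x pi) + (twisted_sum x (- pi) - twisted_sum x s)"
        by (simp only: twisted_sum_periodic ends) simp
      also have "norm \<dots> \<le> B * \<bar>s + d + 2 * pi * of_int 1 - pi\<bar> + B * \<bar>- pi - s\<bar>"
        using r s by (intro order_trans[OF norm_triangle_ineq] add_mono B(2)) auto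
      also have "\<dots> = B * \<bar>d\<bar>"
      proof -
        have "\<bar>s + d + 2 * pi * of_int 1 - pi\<bar> = - (s + d) - pi" "\<bar>- pi - s\<bar> = s + pi" "\<bar>d\<bar> = - d"
          using 3 s(1) t(3) by auto
        then show ?thesis by (simp add: algebra_simps)
      qed
      finally show ?thesis unfolding eq .
    qed
  qed
  then show ?thesis by (rule that)
qed

lemma has_sum_symbol_off_zero:
  "((\<lambda>k::int. if k = 0 then 0 else symbol (t + 2 * pi * of_int k)) has_sum 1 - symbol t) UNIV"
proof -
  have "((\<lambda>k::int. if k = 0 then - symbol t else 0) has_sum - symbol t) UNIV"
    by (rule has_sum_finite_neutralI[of "{0}"]) simp_all
  from has_sum_add[OF has_sum_symbol[of t] this]
  have "((\<lambda>k::int. symbol (t + 2 * pi * of_int k) + (if k = 0 then - symbol t else 0)) has_sum 1 - symbol t) UNIV"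
    by simp
  moreover have "symbol (t + 2 * pi * of_int k) + (if k = 0 then - symbol t else 0)
      = (if k = 0 then 0 else symbol (t + 2 * pi * of_int k))" for k :: int by simp
  ultimately show ?thesis by (simp only:)
qed

lemma symbol_le_1: "symbol t \<le> 1"
  using has_sum_nonneg[OF has_sum_symbol_off_zero[of t]] by (simp add: symbol_nonneg)

lemma summable_on_twisted:
  "(\<lambda>k::int. of_real (symbol (t + 2 * pi * of_int k)) * cis (x * (t + 2 * pi * of_int k))) summable_on UNIV"
  by (rule abs_summable_on_comparison(2)[OF has_sum_imp_summable[OF has_sum_symbol[of t]]])
    (simp add: norm_mult symbol_nonneg)

text \<open>The weights sum to 1, so the character at t can be subtracted under the sum. The term k
  = 0 cancels, and the others have total weight 1 - symbol t, each attached to a difference of two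
  unit numbers.\<close>

lemma norm_twisted_sum_diff_le: "norm (twisted_sum x t - cis (x * t)) \<le> 2 * (1 - symbol t)"
proof -
  have "((\<lambda>k::int. complex_of_real (symbol (t + 2 * pi * of_int k))) has_sum of_real 1) UNIV"
    by (intro has_sum_of_real has_sum_symbol)
  from has_sum_cmult_left[OF this, of "- cis (x * t)"]
  have "((\<lambda>k::int. of_real (symbol (t + 2 * pi * of_int k)) * - cis (x * t)) has_sum - cis (x * t)) UNIV"
    by simp
  from has_sum_add[OF has_sum_infsum[OF summable_on_twisted[of t x]] this]
  have "twisted_sum x t + - cis (x * t)
      = (\<Sum>\<^sub>\<infinity>k::int. of_real (symbol (t + 2 * pi * of_int k)) * cis (x * (t + 2 * pi * of_int k))
          + of_real (symbol (t + 2 * pi * of_int k)) * - cis (x * t))"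
    unfolding twisted_sum_def by (rule infsumI[symmetric])
  also have "\<dots> = (\<Sum>\<^sub>\<infinity>k::int. of_real (symbol (t + 2 * pi * of_int k)) * (cis (x * (t + 2 * pi * of_int k)) - cis (x * t)))"
    by (intro infsum_cong) (simp only: right_diff_distrib mult_minus_right add_uminus_conv_diff)
  finally have eq: "twisted_sum x t - cis (x * t)
      = (\<Sum>\<^sub>\<infinity>k::int. of_real (symbol (t + 2 * pi * of_int k)) * (cis (x * (t + 2 * pi * of_int k)) - cis (x * t)))"
    by (simp only: add_uminus_conv_diff)
  have "norm (twisted_sum x t - cis (x * t)) \<le> (\<Sum>\<^sub>\<infinity>k::int. 2 * (if k = 0 then 0 else symbol (t + 2 * pi * of_int k)))"
    unfolding eq
  proof (rule abs_summable_on_comparison(3))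
    show "(\<lambda>k::int. 2 * (if k = 0 then 0 else symbol (t + 2 * pi * of_int k))) summable_on UNIV"
      by (rule summable_on_cmult_right[OF has_sum_imp_summable[OF has_sum_symbol_off_zero]])
    show "norm (of_real (symbol (t + 2 * pi * of_int k)) * (cis (x * (t + 2 * pi * of_int k)) - cis (x * t)))
        \<le> 2 * (if k = 0 then 0 else symbol (t + 2 * pi * of_int k))" for k :: int
    proof (cases "k = 0")
      case False
      have "norm (cis (x * (t + 2 * pi * of_int k)) - cis (x * t)) \<le> 2"
        using norm_triangle_ineq4[of "cis (x * (t + 2 * pi * of_int k))" "cis (x * t)"] by simp
      then have "symbol (t + 2 * pi * of_int k) * norm (cis (x * (t + 2 * pi * of_int k)) - cis (x * t))
          \<le> symbol (t + 2 * pi * of_int k) * 2" by (intro mult_left_mono symbol_nonneg)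
      then show ?thesis using False by (simp add: norm_mult symbol_nonneg)
    qed simp
  qed
  also have "\<dots> = 2 * (1 - symbol t)"
    by (rule infsumI[OF has_sum_cmult_right[OF has_sum_symbol_off_zero]])
  finally show ?thesis .
qed

lemma twisted_sum_measurable [measurable]: "twisted_sum x \<in> borel_measurable borel"
  unfolding twisted_sum_def[abs_def]
  by (intro borel_measurable_infsum_int summable_on_twisted) measurable

lemma norm_twisted_sum_le: "norm (twisted_sum x t) \<le> 3"
proof -
  have "norm (twisted_sum x t) \<le> norm (twisted_sum x t - cis (x * t)) + norm (cis (x * t))"
    by (metis diff_add_cancel norm_triangle_ineq)
  then show ?thesis using norm_twisted_sum_diff_le[of x t] symbol_nonneg[of t] by simp
qed

lemma L_hat_eq_symbol:
  assumes "\<alpha> + 1 / 2 = \<nu>" "- \<alpha> \<notin> \<int>\<^sub>\<le>\<^sub>0" "\<xi> \<notin> period_lattice"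
  shows "L_hat \<alpha> c \<xi> = symbol \<xi>"
proof -
  \<comment> \<open>The powers of |\<eta>| cancel, leaving c^(2\<nu>); the 1/2 comes from unfolding
    the Bessel integral. \<open>K\<close> is nonzero because Gamma has no zeros, so it can be
    cancelled.\<close>
  define K where "K = 2 powr (1 + \<alpha>) / Gamma (- \<alpha>) * c powr (2 * \<nu>) / 2"
  have "K \<noteq> 0" using c Gamma_nonzero[OF assms(2)] by (simp add: K_def)
  have phi: "phi_hat \<alpha> c \<eta> = K * h \<eta>" if "\<eta> \<noteq> 0" for \<eta>
  proof -
    have "(c / \<bar>\<eta>\<bar>) powr \<nu> * (c * \<bar>\<eta>\<bar>) powr \<nu> = c powr (2 * \<nu>)"
      using c that by (simp add: powr_divide powr_mult flip: powr_add)
    then show ?thesis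
      unfolding phi_hat_def assms(1) using c that
      by (simp add: bessel_K_eq_mix h_def K_def mult_ac)
  qed
  have nz: "\<xi> + 2 * pi * of_int k \<noteq> 0" for k :: int
    using assms(3) period_lattice_shift_iff[of \<xi> k] zero_in_period_lattice by metis
  have "L_hat \<alpha> c \<xi> = phi_hat \<alpha> c \<xi> / (\<Sum>\<^sub>\<infinity>j::int. phi_hat \<alpha> c (\<xi> + 2 * pi * of_int j))"
    using assms(3) by (auto simp: L_hat_def L_hat_quotient_def period_lattice_def)
  also have "\<dots> = (K * h \<xi>) / (K * h_sum \<xi>)"
    unfolding h_sum_def using nz nz[of 0] by (simp add: phi infsum_cmult_right')
  finally show ?thesis using \<open>K \<noteq> 0\<close> by (simp add: symbol_def)
qed

context
  fixes \<alpha> :: real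
  assumes \<alpha>: "\<alpha> + 1 / 2 = \<nu>" "- \<alpha> \<notin> \<int>\<^sub>\<le>\<^sub>0"
begin

text \<open>Exhibits the shifted values as the Fourier coefficients to which the periodization
  theorem applies, for a function whose periodization is \<open>twisted_sum x\<close>.\<close>

lemma fundamental_function_eq:
  "fundamental_function \<alpha> c (x - of_int j)
    = (LBINT \<xi>. (of_real (symbol \<xi>) * cis (x * \<xi>)) * cis (- of_int j * \<xi>)) / (2 * pi)"
proof -
  have "(LBINT \<xi>. of_real (L_hat \<alpha> c \<xi>) * exp (\<i> * of_real (x - of_int j) * of_real \<xi>))
      = (LBINT \<xi>. (of_real (symbol \<xi>) * cis (x * \<xi>)) * cis (- of_int j * \<xi>))"
  proof (rule integral_cong_AE)
    have exp_eq: "exp (\<i> * of_real (x - of_int j) * of_real \<xi>) = cis (x * \<xi>) * cis (- of_int j * \<xi>)" for \<xi>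
      by (simp add: cis_mult) (simp add: cis_conv_exp algebra_simps)
    have AE: "AE \<xi> in lborel. \<xi> \<notin> period_lattice"
      by (rule AE_not_in) (simp add: countable_imp_null_set_lborel countable_period_lattice)
    then show "AE \<xi> in lborel. of_real (L_hat \<alpha> c \<xi>) * exp (\<i> * of_real (x - of_int j) * of_real \<xi>)
        = (of_real (symbol \<xi>) * cis (x * \<xi>)) * cis (- of_int j * \<xi>)"
      by eventually_elim (simp only: L_hat_eq_symbol[OF \<alpha>] exp_eq not_False_eq_True, simp only: mult.assoc)
    show "(\<lambda>\<xi>. of_real (L_hat \<alpha> c \<xi>) * exp (\<i> * of_real (x - of_int j) * of_real \<xi>)) \<in> borel_measurable lborel"
    proof -
      \<comment> \<open>Measurability follows from that of \<open>symbol\<close>, as the two differ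
        on a countable set at most; the limits at lattice points are never evaluated.\<close>
      have "L_hat \<alpha> c \<in> borel_measurable borel"
      proof (rule measurable_discrete_difference[where f = symbol and X = period_lattice])
        show "symbol \<xi> = L_hat \<alpha> c \<xi>" if "\<xi> \<notin> period_lattice" for \<xi>
          by (rule L_hat_eq_symbol[OF \<alpha> that, symmetric])
      qed (auto simp: countable_period_lattice)
      then show ?thesis by measurable
    qed
    show "(\<lambda>\<xi>. (of_real (symbol \<xi>) * cis (x * \<xi>)) * cis (- of_int j * \<xi>)) \<in> borel_measurable lborel"
      by measurable
  qed
  then show ?thesis by (simp add: fundamental_function_def)
qed

lemma
  shows abs_summable_on_fundamental_function:
      "(\<lambda>j. norm (fundamental_function \<alpha> c (x - of_int j))) summable_on UNIV"
    and fundamental_function_series_tendsto: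
      "s \<notin> period_lattice \<Longrightarrow> (\<lambda>N. \<Sum>j\<in>{- int N..int N}. fundamental_function \<alpha> c (x - of_int j) * cis (of_int j * s))
        \<longlonglongrightarrow> twisted_sum x s"
proof -
  obtain D where D: "D > 0" "\<And>\<xi>. symbol \<xi> \<le> D * exp (- (c / 4) * \<bar>\<xi>\<bar>)" using symbol_le_exp by blast
  have le: "norm (of_real (symbol \<xi>) * cis (x * \<xi>)) \<le> D * exp (- (c / 4) * \<bar>\<xi>\<bar>)" for \<xi>
    using D(2)[of \<xi>] by (simp add: norm_mult symbol_nonneg)
  obtain C where C: "\<And>t d. t \<notin> period_lattice \<Longrightarrow> t + d \<notin> period_lattice \<Longrightarrow> \<bar>d\<bar> \<le> pi \<Longrightarrow>
    norm (twisted_sum x (t + d) - twisted_sum x t) \<le> C * \<bar>d\<bar>" using twisted_sum_lipschitz by blast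
  have "c / 4 > 0" using c by simp
  note * = this le _ countable_period_lattice C[unfolded twisted_sum_def]
  show "(\<lambda>j. norm (fundamental_function \<alpha> c (x - of_int j))) summable_on UNIV"
    unfolding fundamental_function_eq
    by (rule abs_summable_on_periodization_coeff[OF *]) measurable
  show "(\<lambda>N. \<Sum>j\<in>{- int N..int N}. fundamental_function \<alpha> c (x - of_int j) * cis (of_int j * s))
        \<longlonglongrightarrow> twisted_sum x s" if "s \<notin> period_lattice"
    unfolding fundamental_function_eq twisted_sum_def
    by (rule fourier_series_periodization_tendsto[OF * that]) measurable
qed

end

end

text \<open>For |s| < pi every other translate is farther from 0 than s, by at least \<delta> = 2 pi
  - 2|s|, so its value of \<open>h\<close> relative to \<open>h s\<close> carries a factor exp(-c(b
  - a)) with b - a \<ge> \<delta>. Of the weight c, the part c - 1 yields the vanishing factor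
  exp(-\<delta>(c - 1)); the remaining unit pays for the power of b and for summability over
  k.\<close>

lemma symbol_tendsto_1:
  assumes \<nu>: "\<bar>\<nu>\<bar> > 1 / 2" and s: "0 < \<bar>s\<bar>" "\<bar>s\<bar> < pi"
  shows "((\<lambda>c. multiquadric_symbol.symbol \<nu> c s) \<longlongrightarrow> 1) at_top"
proof -
  define a where "a = \<bar>s\<bar>"
  define \<delta> where "\<delta> = 2 * pi - 2 * a"
  have a: "a > 0" "a < pi" and \<delta>: "\<delta> > 0" using s by (auto simp: a_def \<delta>_def)
  obtain C where C: "C > 0" "\<And>z. z \<ge> pi \<Longrightarrow> z powr (- \<nu>) \<le> C * exp (1 / 2 * z)"
    using powr_le_const_exp[of "1 / 2" pi "- \<nu>"] by auto
  \<comment> \<open>Half of exp(-(b - a)) has absorbed the power b^(-\<nu>), at the price of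
    \<open>C\<close>. What remains is exp a * exp(-b/2), and b \<ge> pi |k|.\<close>
  define w where "w k = a powr \<nu> * C * exp a * exp (- (pi / 2) * \<bar>of_int k\<bar>)" for k :: int
  have w: "w summable_on UNIV"
    unfolding w_def by (intro summable_on_cmult_right summable_on_int_exp) auto
  define W where "W = (\<Sum>\<^sub>\<infinity>k. w k)"
  have bound: "\<bar>1 - multiquadric_symbol.symbol \<nu> c s\<bar> \<le> W * exp (- (\<delta> * (c - 1)))" if "c \<ge> 1" for c
  proof -
    interpret multiquadric_symbol \<nu> c by unfold_locales (use \<nu> that in auto)
    have hs: "h s > 0" using s by (intro h_pos) auto
    have term_le: "(if k = 0 then 0 else symbol (s + 2 * pi * of_int k)) \<le> exp (- (\<delta> * (c - 1))) * w k" for k :: int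
    proof (cases "k = 0")
      case True
      then show ?thesis using C by (simp add: w_def)
    next
      case False
      define b where "b = \<bar>s + 2 * pi * of_int k\<bar>"
      have bk: "pi * \<bar>of_int k\<bar> \<le> b" "pi \<le> b"
        using abs_shift_ge[OF False less_imp_le[OF s(2)]] unfolding b_def by linarith+
      have ba: "b - a \<ge> \<delta>"
      proof -
        have "1 \<le> \<bar>real_of_int k\<bar>" using False by linarith
        then have "2 * pi \<le> \<bar>2 * pi * real_of_int k\<bar>" by (simp add: abs_mult)
        then show ?thesis unfolding a_def b_def \<delta>_def by linarith
      qed
      have "h (s + 2 * pi * of_int k) = bessel_mix \<nu> (c * b)" by (simp add: h_def b_def)
      also have "\<dots> \<le> ((c * b) / (c * a)) powr (- \<nu>) * exp (- (c * b - c * a)) * bessel_mix \<nu> (c * a)"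
        using a bk ba \<delta> c by (intro bessel_mix_exp_decay) auto
      also have "\<dots> = (a powr \<nu> * b powr (- \<nu>)) * exp (- (c * b - c * a)) * h s"
        using a bk c by (simp add: powr_divide powr_minus h_def a_def field_simps)
      also have "\<dots> \<le> (a powr \<nu> * (C * exp (1 / 2 * b))) * exp (- (\<delta> * (c - 1)) - (b - a)) * h s"
      proof (intro mult_right_mono mult_mono)
        have "(c - 1) * \<delta> \<le> (c - 1) * (b - a)" using ba that by (intro mult_left_mono) auto
        then show "exp (- (c * b - c * a)) \<le> exp (- (\<delta> * (c - 1)) - (b - a))"
          by (simp add: algebra_simps)
      qed (use C bk hs in auto)
      also have "\<dots> = exp (- (\<delta> * (c - 1))) * (a powr \<nu> * C * exp a * exp (- b / 2)) * h s"
      proof -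
        have "exp (1 / 2 * b) * exp (- (\<delta> * (c - 1)) - (b - a)) = exp (- (\<delta> * (c - 1))) * (exp a * exp (- b / 2))"
          by (simp flip: exp_add)
        then show ?thesis by (simp add: mult_ac)
      qed
      also have "\<dots> \<le> exp (- (\<delta> * (c - 1))) * w k * h s"
        unfolding w_def using C hs bk by (intro mult_right_mono mult_left_mono) auto
      finally have hk: "h (s + 2 * pi * of_int k) \<le> exp (- (\<delta> * (c - 1))) * w k * h s" .
      have "symbol (s + 2 * pi * of_int k) \<le> h (s + 2 * pi * of_int k) / h s"
        unfolding symbol_shift using h_le_h_sum[of s 0] hs h_nonneg by (intro divide_left_mono) auto
      also have "\<dots> \<le> exp (- (\<delta> * (c - 1))) * w k"
        using hk hs by (simp add: pos_divide_le_eq)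
      finally show ?thesis using False by simp
    qed
    have "1 - symbol s \<le> exp (- (\<delta> * (c - 1))) * W"
      unfolding W_def
      by (rule has_sum_mono[OF has_sum_symbol_off_zero[of s] has_sum_cmult_right[OF has_sum_infsum[OF w]]])
        (rule term_le)
    then show ?thesis using symbol_le_1[of s] by (simp add: mult.commute)
  qed
  have lim: "((\<lambda>c. W * exp (- (\<delta> * (c - 1)))) \<longlongrightarrow> 0) at_top"
  proof -
    have "filterlim (\<lambda>c. \<delta> * (- 1 + c)) at_top at_top"
      by (intro filterlim_tendsto_pos_mult_at_top[OF tendsto_const \<delta>] filterlim_tendsto_add_at_top[OF tendsto_const] filterlim_ident)
    then have "((\<lambda>c. exp (- (\<delta> * (c - 1)))) \<longlongrightarrow> 0) at_top"
      by (intro filterlim_compose[OF exp_at_bot] filterlim_compose[OF filterlim_uminus_at_bot_at_top]) simp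
    then show ?thesis by (rule tendsto_mult_right_zero)
  qed
  have "((\<lambda>c. 1 - multiquadric_symbol.symbol \<nu> c s) \<longlongrightarrow> 0) at_top"
    by (rule Lim_null_comparison[OF _ lim]) (use bound in \<open>auto intro!: eventually_mono[OF eventually_ge_at_top[of 1]]\<close>)
  from tendsto_diff[OF tendsto_const[of 1] this] show ?thesis by simp
qed

subsection \<open>Finiteness of the variation of a signed measure\<close>

text \<open>Suppose the values on subsets of E are unbounded. A subset A with |\<nu> A| > |\<nu> E|
  + 1 splits E into two pieces of modulus above 1, one of which is again unbounded. Keeping that
  piece and iterating gives a decreasing sequence whose successive differences are disjoint and of
  modulus above 1, against the convergence of the sum of their values.\<close>

lemma countably_additive_imp_bounded:
  fixes \<nu> :: "'a set \<Rightarrow> real"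
  assumes add: "\<And>A :: nat \<Rightarrow> 'a set. range A \<subseteq> sets M \<Longrightarrow> disjoint_family A \<Longrightarrow> (\<lambda>n. \<nu> (A n)) sums \<nu> (\<Union>n. A n)"
  shows "\<exists>B. \<forall>A\<in>sets M. \<bar>\<nu> A\<bar> \<le> B"
proof (rule ccontr)
  assume unbounded: "\<not> ?thesis"
  have empty: "\<nu> {} = 0"
  proof -
    have "(\<lambda>n::nat. \<nu> {}) sums \<nu> {}"
      using add[of "\<lambda>_. {}"] by (simp add: disjoint_family_on_def)
    then show ?thesis using sums_summable summable_const_iff by blast
  qed
  have Un: "\<nu> (A \<union> B) = \<nu> A + \<nu> B" if "A \<in> sets M" "B \<in> sets M" "A \<inter> B = {}" for A B
  proof -
    have "(\<lambda>n. \<nu> (binaryset A B n)) sums \<nu> (\<Union>n. binaryset A B n)"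
    proof (rule add)
      show "range (binaryset A B) \<subseteq> sets M" "disjoint_family (binaryset A B)"
        using that unfolding disjoint_family_on_def by (auto simp: range_binaryset_eq binaryset_def)
    qed
    moreover have "(\<lambda>n. \<nu> (binaryset A B n)) sums (\<nu> A + \<nu> B)"
      by (rule binaryset_sums) (rule empty)
    ultimately show ?thesis by (simp add: UN_binaryset_eq sums_unique2)
  qed
  define bad where "bad E \<longleftrightarrow> E \<in> sets M \<and> (\<forall>B. \<exists>A\<in>sets M. A \<subseteq> E \<and> \<bar>\<nu> A\<bar> > B)" for E
  have "bad (space M)"
    unfolding bad_def using unbounded sets.sets_into_space by (metis linorder_not_le sets.top)
  moreover have "\<exists>E'. bad E' \<and> E' \<subseteq> E \<and> \<bar>\<nu> (E - E')\<bar> > 1" if E: "bad E" for E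
  proof -
    obtain A where A: "A \<in> sets M" "A \<subseteq> E" "\<bar>\<nu> A\<bar> > \<bar>\<nu> E\<bar> + 1"
      using E unfolding bad_def by blast
    have ES: "E \<in> sets M" using E by (simp add: bad_def)
    have split: "\<nu> E = \<nu> A + \<nu> (E - A)"
      using Un[of A "E - A"] A ES by (simp add: Un_absorb1)
    show ?thesis
    proof (cases "bad (E - A)")
      case True
      then show ?thesis using A by (intro exI[of _ "E - A"]) (auto simp: double_diff)
    next
      case False
      then obtain B1 where B1: "\<And>A'. A' \<in> sets M \<Longrightarrow> A' \<subseteq> E - A \<Longrightarrow> \<bar>\<nu> A'\<bar> \<le> B1"
        using A ES unfolding bad_def by (meson linorder_not_le sets.Diff)
      have "bad A"
        unfolding bad_def
      proof (intro conjI allI)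
        fix B
        obtain A' where A': "A' \<in> sets M" "A' \<subseteq> E" "\<bar>\<nu> A'\<bar> > B + B1"
          using E unfolding bad_def by blast
        have "\<nu> A' = \<nu> (A' \<inter> A) + \<nu> (A' - A)"
          using Un[of "A' \<inter> A" "A' - A"] A A' by (simp add: Int_Diff_Un Int_Diff_disjoint)
        moreover have "\<bar>\<nu> (A' - A)\<bar> \<le> B1" using A A' by (intro B1) auto
        ultimately have "\<bar>\<nu> (A' \<inter> A)\<bar> > B" using A'(3) by linarith
        then show "\<exists>A''\<in>sets M. A'' \<subseteq> A \<and> \<bar>\<nu> A''\<bar> > B" using A A' by blast
      qed (rule A)
      moreover have "\<bar>\<nu> (E - A)\<bar> > 1" using split A(3) by linarith
      ultimately show ?thesis using A by blast
    qed
  qed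
  ultimately obtain E where E: "\<And>n. bad (E n)" "\<And>n. E (Suc n) \<subseteq> E n \<and> \<bar>\<nu> (E n - E (Suc n))\<bar> > 1"
    using dependent_nat_choice[of "\<lambda>_. bad" "\<lambda>_ E E'. E' \<subseteq> E \<and> \<bar>\<nu> (E - E')\<bar> > 1"] by metis
  have dec: "decseq E" using E(2) by (intro decseq_SucI) auto
  have "disjoint_family (\<lambda>n. E n - E (Suc n))"
  proof -
    have "(E m - E (Suc m)) \<inter> (E n - E (Suc n)) = {}" if "m < n" for m n
      using decseqD[OF dec, of "Suc m" n] that by auto
    then show ?thesis
      unfolding disjoint_family_on_def by (metis Int_commute linorder_neq_iff)
  qed
  then have "(\<lambda>n. \<nu> (E n - E (Suc n))) sums \<nu> (\<Union>n. E n - E (Suc n))"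
    using E(1) by (intro add) (auto simp: bad_def)
  then have "(\<lambda>n. \<nu> (E n - E (Suc n))) \<longlonglongrightarrow> 0"
    by (intro summable_LIMSEQ_zero sums_summable)
  then have "\<forall>\<^sub>F n in sequentially. \<bar>\<nu> (E n - E (Suc n))\<bar> < 1"
    using tendstoD[of "\<lambda>n. \<nu> (E n - E (Suc n))" 0 sequentially 1] by simp
  then obtain n where "\<bar>\<nu> (E n - E (Suc n))\<bar> < 1"
    by (meson eventually_happens trivial_limit_sequentially)
  then show False using E(2)[of n] by simp
qed

lemma positive_part_finite:
  assumes add: "\<And>A :: nat \<Rightarrow> real set. range A \<subseteq> sets borel \<Longrightarrow> disjoint_family A \<Longrightarrow>
      (\<Union>n. A n) \<subseteq> {-pi..<pi} \<Longrightarrow> (\<lambda>n. \<nu> (A n)) sums \<nu> (\<Union>n. A n)"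
  shows "finite_measure (positive_part \<nu>)"
proof (rule finite_measureI)
  let ?M = "restrict_space borel {-pi..<pi} :: real measure"
  have sets: "A \<in> sets ?M \<longleftrightarrow> A \<in> sets borel \<and> A \<subseteq> {-pi..<pi}" for A
    by (subst sets_restrict_space_iff) auto
  have "\<exists>B. \<forall>A\<in>sets ?M. \<bar>\<nu> A\<bar> \<le> B"
  proof (rule countably_additive_imp_bounded)
    fix A :: "nat \<Rightarrow> real set" assume "range A \<subseteq> sets ?M" "disjoint_family A"
    then show "(\<lambda>n. \<nu> (A n)) sums \<nu> (\<Union>n. A n)"
      using sets by (intro add) blast+
  qed
  then obtain B where B: "\<And>A. A \<in> sets borel \<Longrightarrow> A \<subseteq> {-pi..<pi} \<Longrightarrow> \<bar>\<nu> A\<bar> \<le> B"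
    using sets by blast
  have "emeasure (positive_part \<nu>) {-pi..<pi} = (SUP A \<in> {A \<in> sets borel. A \<subseteq> {-pi..<pi}}. ennreal (\<nu> A))"
    by (rule emeasure_positive_part[OF add]) auto
  also have "\<dots> \<le> ennreal B"
    using B by (intro SUP_least ennreal_leI) force
  finally show "emeasure (positive_part \<nu>) (space (positive_part \<nu>)) \<noteq> \<infinity>"
    by (auto simp: space_positive_part top_unique)
qed

lemma emeasure_positive_part_null:
  assumes add: "\<And>A :: nat \<Rightarrow> real set. range A \<subseteq> sets borel \<Longrightarrow> disjoint_family A \<Longrightarrow>
      (\<Union>n. A n) \<subseteq> {-pi..<pi} \<Longrightarrow> (\<lambda>n. \<nu> (A n)) sums \<nu> (\<Union>n. A n)"
    and E: "E \<in> sets borel" "E \<subseteq> {-pi..<pi}"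
    and null: "\<And>A. A \<in> sets borel \<Longrightarrow> A \<subseteq> E \<Longrightarrow> \<nu> A = 0"
  shows "emeasure (positive_part \<nu>) E = 0"
proof -
  have "emeasure (positive_part \<nu>) E = (SUP A \<in> {A \<in> sets borel. A \<subseteq> E}. ennreal (\<nu> A))"
    by (rule emeasure_positive_part[OF add E])
  also have "\<dots> \<le> 0" by (intro SUP_least) (auto simp: null)
  finally show ?thesis by simp
qed

section \<open>Interpolation error for a single positive measure\<close>

lemma has_sum_sum:
  fixes f :: "'i \<Rightarrow> 'a \<Rightarrow> 'b :: topological_comm_monoid_add"
  assumes "finite I" "\<And>i. i \<in> I \<Longrightarrow> (f i has_sum s i) A"
  shows "((\<lambda>x. \<Sum>i\<in>I. f i x) has_sum (\<Sum>i\<in>I. s i)) A"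
  using assms by (induction I rule: finite_induct) (auto intro: has_sum_add)

locale period_measure = finite_measure M for M :: "real measure" +
  assumes space_M: "space M = {-pi..<pi}"
    and sets_M: "sets M = {E \<in> sets borel. E \<subseteq> {-pi..<pi}}"
    and no_atoms: "emeasure M {0} = 0" "emeasure M {-pi} = 0"
begin

lemma measurable_M: "f \<in> borel_measurable borel \<Longrightarrow> f \<in> borel_measurable M"
proof -
  assume "f \<in> borel_measurable borel"
  then have "f \<in> borel_measurable (restrict_space borel {-pi..<pi})"
    by (rule measurable_restrict_space1)
  moreover have "sets (restrict_space borel {-pi..<pi}) = sets M"
    unfolding sets_M by (simp add: sets_restrict_space_iff set_eq_iff conj_commute)
  ultimately show ?thesis using measurable_cong_sets by blast
qed

lemma AE_nonzero: "AE t in M. t \<noteq> 0 \<and> t \<noteq> - pi"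
proof -
  have "{0} \<in> null_sets M" "{-pi} \<in> null_sets M"
    using no_atoms by (auto simp: null_sets_def sets_M)
  from this[THEN AE_not_in] show ?thesis by eventually_elim simp
qed

lemma AE_interior: "AE t in M. 0 < \<bar>- t\<bar> \<and> \<bar>- t\<bar> < pi"
  using AE_nonzero AE_space by eventually_elim (auto simp: space_M)

lemma AE_not_lattice: "AE t in M. - t \<notin> period_lattice"
  using AE_interior by eventually_elim (use period_lattice_small in force)

text \<open>The sign of the exponent is that of the transform in the theorem; for this reason
  \<open>symbol\<close> and \<open>twisted_sum\<close> are evaluated at - t from here on.\<close>

definition char_fn :: "real \<Rightarrow> complex" where
  "char_fn x = (LINT t|M. exp (- \<i> * of_real x * of_real t))"

lemma char_fn_cis: "char_fn x = (LINT t|M. cis (x * (- t)))"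
  unfolding char_fn_def by (simp add: cis_conv_exp mult_ac)

lemma bounded_integrable:
  fixes f :: "real \<Rightarrow> 'b :: {banach, second_countable_topology}"
  assumes "f \<in> borel_measurable borel" "\<And>t. norm (f t) \<le> B"
  shows "integrable M f"
  using assms by (intro integrable_const_bound[of _ B] measurable_M) auto

lemma cis_integrable: "integrable M (\<lambda>t. cis (x * (- t)))"
  by (rule bounded_integrable[of _ 1]) auto

lemma norm_char_fn_le: "norm (char_fn x) \<le> measure M (space M)"
proof -
  have "norm (char_fn x) \<le> (LINT t|M. norm (cis (x * (- t))))"
    unfolding char_fn_cis by (rule integral_norm_bound)
  then show ?thesis by simp
qed

end

text \<open>Summation over j and integration over t are exchanged by dominated convergence, with the
  constant sum of |L j| as majorant; the pointwise limit holds off the lattice, hence almost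
  everywhere. Absolute summability makes the symmetric limit the unordered sum. The error is the
  pointwise estimate integrated, and its bound is free of x.\<close>

lemma (in multiquadric_symbol)
  assumes \<alpha>: "\<alpha> + 1 / 2 = \<nu>" "- \<alpha> \<notin> \<int>\<^sub>\<le>\<^sub>0" and M: "period_measure M"
  shows has_sum_interpolant: "((\<lambda>j. period_measure.char_fn M (of_int j) * fundamental_function \<alpha> c (x - of_int j))
      has_sum (LINT t|M. twisted_sum x (- t))) UNIV"
    and interpolant_error: "norm ((LINT t|M. twisted_sum x (- t)) - period_measure.char_fn M x)
      \<le> 2 * (LINT t|M. 1 - symbol (- t))"
proof -
  interpret period_measure M by fact
  define L where "L j = fundamental_function \<alpha> c (x - of_int j)" for j :: int
  have L: "(\<lambda>j. norm (L j)) summable_on UNIV"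
    unfolding L_def by (rule abs_summable_on_fundamental_function[OF \<alpha>])
  have summable: "(\<lambda>j. char_fn (of_int j) * L j) summable_on UNIV"
  proof (rule abs_summable_on_comparison(2))
    show "(\<lambda>j. measure M (space M) * norm (L j)) summable_on UNIV"
      by (rule summable_on_cmult_right[OF L])
    show "norm (char_fn (of_int j) * L j) \<le> measure M (space M) * norm (L j)" for j :: int
      unfolding norm_mult by (intro mult_right_mono norm_char_fn_le) simp
  qed
  have tI: "integrable M (\<lambda>t. twisted_sum x (- t))"
    by (rule bounded_integrable[of _ 3]) (auto simp: norm_twisted_sum_le)
  have "(\<lambda>N. LINT t|M. (\<Sum>j\<in>{- int N..int N}. L j * cis (of_int j * (- t)))) \<longlonglongrightarrow> (LINT t|M. twisted_sum x (- t))"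
  proof (rule integral_dominated_convergence)
    show "integrable M (\<lambda>_. infsum (\<lambda>j. norm (L j)) UNIV)" by simp
    show "AE t in M. (\<lambda>N. \<Sum>j\<in>{- int N..int N}. L j * cis (of_int j * (- t))) \<longlonglongrightarrow> twisted_sum x (- t)"
      using AE_not_lattice unfolding L_def
      by eventually_elim (rule fundamental_function_series_tendsto[OF \<alpha>])
    show "AE t in M. norm (\<Sum>j\<in>{- int N..int N}. L j * cis (of_int j * (- t))) \<le> infsum (\<lambda>j. norm (L j)) UNIV" for N
      by (intro AE_I2 norm_sum_le_infsum L) (auto simp: norm_mult)
    show "(\<lambda>t. twisted_sum x (- t)) \<in> borel_measurable M" by (rule measurable_M) measurable
    show "(\<lambda>t. \<Sum>j\<in>{- int N..int N}. L j * cis (of_int j * (- t))) \<in> borel_measurable M" for N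
      by (rule measurable_M) measurable
  qed
  moreover have "(LINT t|M. (\<Sum>j\<in>{- int N..int N}. L j * cis (of_int j * (- t))))
      = (\<Sum>j\<in>{- int N..int N}. char_fn (of_int j) * L j)" for N
  proof -
    have "(LINT t|M. (\<Sum>j\<in>{- int N..int N}. L j * cis (of_int j * (- t))))
        = (\<Sum>j\<in>{- int N..int N}. (LINT t|M. L j * cis (of_int j * (- t))))"
      by (intro Bochner_Integration.integral_sum integrable_mult_right cis_integrable)
    then show ?thesis
      unfolding char_fn_cis by (simp only: integral_mult_right_zero mult.commute)
  qed
  ultimately have "(\<lambda>N. \<Sum>j\<in>{- int N..int N}. char_fn (of_int j) * L j) \<longlonglongrightarrow> (LINT t|M. twisted_sum x (- t))"
    by simp
  then have "(\<Sum>\<^sub>\<infinity>j. char_fn (of_int j) * L j) = (LINT t|M. twisted_sum x (- t))"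
    by (rule LIMSEQ_unique[OF has_sum_int_symmetric[OF has_sum_infsum[OF summable]]])
  then show "((\<lambda>j. char_fn (of_int j) * fundamental_function \<alpha> c (x - of_int j))
      has_sum (LINT t|M. twisted_sum x (- t))) UNIV"
    using has_sum_infsum[OF summable] by (simp add: L_def)
  have sI: "integrable M (\<lambda>t. 1 - symbol (- t))"
  proof (rule bounded_integrable)
    show "norm (1 - symbol (- t)) \<le> 1" for t using symbol_nonneg[of "- t"] symbol_le_1[of "- t"] by simp
  qed measurable
  have "(LINT t|M. twisted_sum x (- t)) - char_fn x = (LINT t|M. twisted_sum x (- t) - cis (x * (- t)))"
    unfolding char_fn_cis by (rule Bochner_Integration.integral_diff[symmetric, OF tI cis_integrable])
  then have "norm ((LINT t|M. twisted_sum x (- t)) - char_fn x)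
      \<le> (LINT t|M. norm (twisted_sum x (- t) - cis (x * (- t))))"
    using integral_norm_bound by simp
  also have "\<dots> \<le> (LINT t|M. 2 * (1 - symbol (- t)))"
  proof (rule integral_mono)
    show "norm (twisted_sum x (- t) - cis (x * (- t))) \<le> 2 * (1 - symbol (- t))" for t
      by (rule norm_twisted_sum_diff_le)
    show "integrable M (\<lambda>t. norm (twisted_sum x (- t) - cis (x * (- t))))"
      using tI cis_integrable[of x] by (intro integrable_norm Bochner_Integration.integrable_diff)
    show "integrable M (\<lambda>t. 2 * (1 - symbol (- t)))" by (intro integrable_mult_right sI)
  qed
  also have "\<dots> = 2 * (LINT t|M. 1 - symbol (- t))" by (rule integral_mult_right_zero)
  finally show "norm ((LINT t|M. twisted_sum x (- t)) - char_fn x) \<le> 2 * (LINT t|M. 1 - symbol (- t))" .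
qed

text \<open>The truncation \<open>max c 1\<close> provides a valid shape parameter for every real c,
  as measurability is demanded for all c; it is invisible once c \<ge> 1.\<close>

lemma (in period_measure) symbol_defect_tendsto_0:
  assumes "\<bar>\<nu>\<bar> > 1 / 2"
  shows "((\<lambda>c. LINT t|M. 1 - multiquadric_symbol.symbol \<nu> (max c 1) (- t)) \<longlongrightarrow> 0) at_top"
proof -
  have *: "multiquadric_symbol \<nu> (max c 1)" for c by unfold_locales (use assms in auto)
  have "((\<lambda>c. LINT t|M. 1 - multiquadric_symbol.symbol \<nu> (max c 1) (- t)) \<longlongrightarrow> (LINT t|M. 0)) at_top"
  proof (rule integral_dominated_convergence_at_top[where w = "\<lambda>_. 1"])
    show "(\<lambda>t. 1 - multiquadric_symbol.symbol \<nu> (max c 1) (- t)) \<in> borel_measurable M" for c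
    proof (rule measurable_M)
      note [measurable] = multiquadric_symbol.symbol_measurable[OF *[of c]]
      show "(\<lambda>t. 1 - multiquadric_symbol.symbol \<nu> (max c 1) (- t)) \<in> borel_measurable borel"
        by measurable
    qed
    show "\<forall>\<^sub>F c in at_top. AE t in M. norm (1 - multiquadric_symbol.symbol \<nu> (max c 1) (- t)) \<le> 1"
      using multiquadric_symbol.symbol_nonneg[OF *] multiquadric_symbol.symbol_le_1[OF *]
      by (intro always_eventually allI AE_I2) simp
    show "AE t in M. ((\<lambda>c. 1 - multiquadric_symbol.symbol \<nu> (max c 1) (- t)) \<longlongrightarrow> 0) at_top"
      using AE_interior
    proof eventually_elim
      case (elim t)
      have "((\<lambda>c. multiquadric_symbol.symbol \<nu> c (- t)) \<longlongrightarrow> 1) at_top"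
        using elim assms by (intro symbol_tendsto_1) auto
      then have "((\<lambda>c. multiquadric_symbol.symbol \<nu> (max c 1) (- t)) \<longlongrightarrow> 1) at_top"
        by (rule Lim_transform_eventually)
          (auto intro!: eventually_mono[OF eventually_ge_at_top[of 1]] simp: max_def)
      from tendsto_diff[OF tendsto_const[of 1] this] show ?case by simp
    qed
  qed auto
  then show ?thesis by simp
qed

section \<open>Reduction to the four Jordan parts\<close>

lemma period_measure_positive_part:
  assumes add: "\<And>A :: nat \<Rightarrow> real set. range A \<subseteq> sets borel \<Longrightarrow> disjoint_family A \<Longrightarrow>
      (\<Union>n. A n) \<subseteq> {-pi..<pi} \<Longrightarrow> (\<lambda>n. \<nu> (A n)) sums \<nu> (\<Union>n. A n)"
    and null: "\<And>E. E \<in> null_sets lborel \<Longrightarrow> bounded E \<Longrightarrow> \<nu> E = 0"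
  shows "period_measure (positive_part \<nu>)"
proof -
  have null_point: "\<nu> A = 0" if "A \<subseteq> {t}" for A and t :: real
  proof (rule null)
    have "A = {} \<or> A = {t}" using that by auto
    then show "A \<in> null_sets lborel" "bounded A" by auto
  qed
  interpret finite_measure "positive_part \<nu>" by (rule positive_part_finite[OF add])
  show ?thesis
  proof
    show "emeasure (positive_part \<nu>) {0} = 0" "emeasure (positive_part \<nu>) {-pi} = 0"
      by (rule emeasure_positive_part_null[OF add]; (rule null_point)?; simp)+
  qed (simp_all add: space_positive_part sets_positive_part)
qed

theorem theorem29:
  fixes \<alpha> :: real and \<mu> :: "real set \<Rightarrow> complex" and f :: "real \<Rightarrow> complex"
  assumes "\<alpha> \<in> {..< -3/2} \<union> ({1/2..} - \<nat>)"
    and "periodic_complex_measure \<mu>"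
    and "abs_continuous \<mu>"
    and "\<And>x. f x = integral_cm \<mu> (\<lambda>t. exp (- \<i> * of_real x * of_real t))"
  shows "uniform_limit UNIV (\<lambda>c. cardinal_interpolant \<alpha> c f) f at_top"
proof -
  define \<nu> where "\<nu> = \<alpha> + 1 / 2"
  \<comment> \<open>The two ranges of \<alpha> give \<nu> < -1 and \<nu> \<ge> 1
    respectively.\<close>
  have \<nu>: "\<bar>\<nu>\<bar> > 1 / 2" using assms(1) by (auto simp: \<nu>_def)
  have \<alpha>: "- \<alpha> \<notin> \<int>\<^sub>\<le>\<^sub>0"
  proof
    assume "- \<alpha> \<in> \<int>\<^sub>\<le>\<^sub>0"
    then obtain n :: nat where "- \<alpha> = - of_nat n" by (elim nonpos_Ints_cases')
    then show False using assms(1) by auto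
  qed
  have add: "(\<lambda>n. \<mu> (A n)) sums \<mu> (\<Union>n. A n)"
    if "range A \<subseteq> sets borel" "disjoint_family A" "(\<Union>n. A n) \<subseteq> {-pi..<pi}" for A :: "nat \<Rightarrow> real set"
  proof -
    have "(\<Union>n. A n) \<subseteq> {-pi..pi}" using that(3) by (rule order_trans) auto
    then have "bounded (\<Union>n. A n)" by (rule bounded_subset[OF compact_imp_bounded[OF compact_Icc]])
    then show ?thesis
      using assms(2)[unfolded periodic_complex_measure_def, THEN conjunct1, rule_format, OF that(1,2)] by simp
  qed
  have null: "\<mu> E = 0" if "E \<in> null_sets lborel" "bounded E" for E
    using assms(3) that unfolding abs_continuous_def by blast
  \<comment> \<open>Indexing the parts with their coefficients of modulus 1 makes \<open>f\<close> a
    finite linear combination of transforms of positive measures, so the interpolant and its error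
    split accordingly.\<close>
  define M where "M = (\<lambda>i::nat. [positive_part (\<lambda>E. Re (\<mu> E)), positive_part (\<lambda>E. - Re (\<mu> E)),
    positive_part (\<lambda>E. Im (\<mu> E)), positive_part (\<lambda>E. - Im (\<mu> E))] ! i)"
  define u where "u = (\<lambda>i::nat. [1, - 1, \<i>, - \<i>] ! i)"
  have M: "period_measure (M i)" if "i < 4" for i
  proof -
    have "period_measure (positive_part (\<lambda>E. Re (\<mu> E)))" "period_measure (positive_part (\<lambda>E. - Re (\<mu> E)))"
      "period_measure (positive_part (\<lambda>E. Im (\<mu> E)))" "period_measure (positive_part (\<lambda>E. - Im (\<mu> E)))"
      by (intro period_measure_positive_part sums_minus sums_Re sums_Im add; simp add: null)+
    then show ?thesis using that by (auto simp: M_def less_Suc_eq numeral_eq_Suc)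
  qed
  have u: "norm (u i) = 1" if "i < 4" for i
    using that by (auto simp: u_def less_Suc_eq numeral_eq_Suc)
  have f: "f x = (\<Sum>i<4. u i * period_measure.char_fn (M i) x)" for x
    unfolding assms(4) integral_cm_def using M
    by (simp add: eval_nat_numeral period_measure.char_fn_def) (simp add: M_def u_def algebra_simps)
  \<comment> \<open>This majorant does not depend on x, which makes the convergence uniform.\<close>
  define err where "err c = (\<Sum>i<4. 2 * (LINT t|M i. 1 - multiquadric_symbol.symbol \<nu> (max c 1) (- t)))" for c
  have err: "(err \<longlongrightarrow> 0) at_top"
  proof -
    have "(err \<longlongrightarrow> (\<Sum>i<4::nat. 2 * 0)) at_top"
      unfolding err_def[abs_def]
      by (intro tendsto_intros period_measure.symbol_defect_tendsto_0 M \<nu>) auto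
    then show ?thesis by simp
  qed
  have bound: "norm (cardinal_interpolant \<alpha> c f x - f x) \<le> err c" if "c \<ge> 1" for c x
  proof -
    interpret multiquadric_symbol \<nu> c by unfold_locales (use \<nu> that in auto)
    define T where "T i = (LINT t|M i. twisted_sum x (- t))" for i
    have summand: "((\<lambda>j. u i * (period_measure.char_fn (M i) (of_int j) * fundamental_function \<alpha> c (x - of_int j)))
        has_sum u i * T i) UNIV" if "i < 4" for i
      unfolding T_def by (rule has_sum_cmult_right[OF has_sum_interpolant[OF \<nu>_def[symmetric] \<alpha> M[OF that]]])
    have "((\<lambda>j. \<Sum>i<4. u i * (period_measure.char_fn (M i) (of_int j) * fundamental_function \<alpha> c (x - of_int j)))
        has_sum (\<Sum>i<4. u i * T i)) UNIV"
      by (rule has_sum_sum) (simp_all add: summand)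
    then have "cardinal_interpolant \<alpha> c f x = (\<Sum>i<4. u i * T i)"
      unfolding cardinal_interpolant_def f sum_distrib_right mult.assoc by (rule infsumI)
    then have "cardinal_interpolant \<alpha> c f x - f x = (\<Sum>i<4. u i * (T i - period_measure.char_fn (M i) x))"
      by (simp add: f sum_subtractf right_diff_distrib)
    also have "norm \<dots> \<le> err c"
      unfolding err_def
    proof (rule sum_norm_le)
      fix i :: nat assume "i \<in> {..<4}"
      then have i: "i < 4" by simp
      then have "norm (T i - period_measure.char_fn (M i) x) \<le> 2 * (LINT t|M i. 1 - symbol (- t))"
        unfolding T_def by (intro interpolant_error[OF \<nu>_def[symmetric] \<alpha> M])
      then show "norm (u i * (T i - period_measure.char_fn (M i) x))
          \<le> 2 * (LINT t|M i. 1 - multiquadric_symbol.symbol \<nu> (max c 1) (- t))"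
        using u[OF i] that by (simp add: norm_mult max_absorb1)
    qed
    finally show ?thesis .
  qed
  show ?thesis
  proof (rule uniform_limitI)
    fix e :: real assume "e > 0"
    have "\<forall>\<^sub>F c in at_top. err c < e" using order_tendstoD(2)[OF err \<open>e > 0\<close>] .
    then show "\<forall>\<^sub>F c in at_top. \<forall>x\<in>UNIV. dist (cardinal_interpolant \<alpha> c f x) (f x) < e"
      using eventually_ge_at_top[of 1]
      by eventually_elim (use bound in \<open>auto simp: dist_norm intro: le_less_trans\<close>)
  qed
qed

end
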